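(* Let $n\ge 3$ and $0\le k\le n$, and let $y_1,\dots,y_k$ and $x_1,\dots,x_{n-k}$ be non-negative integers. If $T$ and $T'$ are any two planar trees with all internal vertices trivalent and with $n$ external edges, $k$ ending at the top and $n-k$ ending at the bottom, then the corresponding $n$-vertices coincide: $$v_T=v_{T'}:\;V_{(y_1,y_1)}\otimes\cdots\otimes V_{(y_k,y_k)}\longrightarrow V_{(x_1,x_1)}\otimes\cdots\otimes V_{(x_{n-k},x_{n-k})}.$$ That is, the value of an $n$-vertex depends only on its source and its target.
   Context: Temperley–Lieb recoupling. Fix $A\in\mathbb{C}\setminus\{0\}$ such that $\Delta_n:=(-1)^n\sum_{s=0}^n A^{2n-4s}\neq 0$ for all integers $n\ge 0$; the deformation parameter is $q=A^4$, and replacing $q$ by $q^{-1}$ means replacing $A$ by $A^{-1}$. The Temperley–Lieb category $TL_A$ has objects the non-negative integers and morphisms $m\to n$ the $\mathbb{C}$-linear combinations of crossingless planar tangle diagrams with $m$ top and $n$ bottom endpoints (read from top to bottom), modulo isotopy rel endpoints and deletion of a closed loop at the cost of a factor $-A^2-A^{-2}$; tensor product is juxtaposition. An edge labelled $n$ means $n$ parallel strands with the Jones–Wenzl idempotent $f_n$ (the unique non-zero idempotent of $\mathrm{End}(n)$ killed by composition with every turn-back) inserted; $V_n$ denotes the corresponding object of the idempotent completion $\mathcal{C}_A$ of $TL_A$ (the irreducible representation of $U_q(\mathfrak{sl}_2)$ of dimension $n+1$). A triple $(a,b,c)$ is admissible if $a+b+c$ is even and each of $a,b,c$ is at most the sum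 of the other two. The Kauffman–Lins 3-vertex with legs labelled $a,b,c$ is obtained by planarly joining the legs pairwise by $\frac{a+b-c}{2},\frac{b+c-a}{2},\frac{a+c-b}{2}$ strands, with idempotents on the legs; it is $0$ if $(a,b,c)$ is not admissible. $\Delta_n$ is the value of a closed loop labelled $n$, and $\theta(a,b,c)$ is the value of the planar theta graph with edges labelled $a,b,c$ (non-zero for admissible triples). $\Delta_n$ and $\theta$ are unchanged under $A\mapsto A^{-1}$. Balanced theory. We work in $\mathrm{Rep}(U_q^{\rm bal}(\mathfrak{so}_4))=\mathcal{C}_A\boxtimes\mathcal{C}_{A^{-1}}$, where $U_q^{\rm bal}(\mathfrak{so}_4)=U_q(\mathfrak{sl}_2)\otimes U_{q^{-1}}(\mathfrak{sl}_2)$. Its irreducibles are $V_{(i,j)}=V_i\otimes W_j$, with $V_i$ from $\mathcal{C}_A$ and $W_j$ from $\mathcal{C}_{A^{-1}}$. A diagram with edges labelled by pairs denotes the tensor product of the diagram with the first labels, evaluated with parameter $A$, and the diagram with the second labels, evaluated with parameter $A^{-1}$. Irreducibles $V_{(j,j)}$ are called balanced. Normalized 3-vertex. For balanced labels $(a,a),(b,b),(c,c)$ the normalized 3-vertex is $\frac{1}{\theta(a,b,c)}$ times the pair-labelled Kauffman–Lins 3-vertex (and $0$ if $(a,b,c)$ is not admissible). $n$-vertices. Let $T$ be a planar tree in the strip $\mathbb{R}\times[0,1]$ with $n\ge3$ external edges, $k$ of them ending on the top line and $n-k$ on the bottom line, and with all internal vertices trivalent (so there are $n-2$ internal vertices and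 $n-3$ internal edges). Label the external edges ending on top by $(y_1,y_1),\dots,(y_k,y_k)$ and those ending on the bottom by $(x_1,x_1),\dots,(x_{n-k},x_{n-k})$, from left to right. The $n$-vertex $v_T$ is $$v_T=\sum_{(j_e)}\Bigl(\prod_{e}\Delta_{j_e}\Bigr)\,D_{(j_e)},$$ where $e$ runs over the internal edges of $T$, the sum is over all labellings of the internal edges by balanced labels $(j_e,j_e)$ making all vertices admissible (a finite sum), and $D_{(j_e)}$ is the map given by the so-labelled tree with every trivalent vertex interpreted as a normalized 3-vertex. *)

theory Defs
  imports Complex_Main "HOL-Library.Poly_Mapping" "HOL-Library.Disjoint_Sets"
begin

section \<open>Crossingless diagrams\<close>

text \<open>
  Up to isotopy rel endpoints, a crossingless diagram without closed loops is determined by which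
  endpoints it joins, and exactly the noncrossing perfect matchings of the endpoints arise.
  Endpoints on each line are numbered from left to right, starting with 0.
\<close>

datatype point = Top nat | Bot nat

datatype diagram = Diagram (dtop: nat) (dbot: nat) (arcs: "point set set")

definition points :: "nat \<Rightarrow> nat \<Rightarrow> point set" where
  "points m n = Top ` {..<m} \<union> Bot ` {..<n}"

text \<open>Position of an endpoint when the boundary of the strip is traversed clockwise,
  starting at the leftmost top endpoint.\<close>

fun bpos :: "nat \<Rightarrow> nat \<Rightarrow> point \<Rightarrow> nat" where
  "bpos m n (Top i) = i"
| "bpos m n (Bot j) = m + n - 1 - j"

definition noncrossing :: "nat \<Rightarrow> nat \<Rightarrow> point set set \<Rightarrow> bool" where
  "noncrossing m n P \<longleftrightarrow>
     (\<forall>a\<in>P. \<forall>b\<in>P. \<forall>p\<in>a. \<forall>q\<in>a. \<forall>r\<in>b. \<forall>s\<in>b.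
        \<not> (bpos m n p < bpos m n r \<and> bpos m n r < bpos m n q \<and> bpos m n q < bpos m n s))"

definition tl_diagrams :: "nat \<Rightarrow> nat \<Rightarrow> diagram set" where
  "tl_diagrams m n =
     {Diagram m n P | P. partition_on (points m n) P \<and> (\<forall>a\<in>P. card a = 2) \<and> noncrossing m n P}"

text \<open>
  Stacking \<open>d\<close> on top of \<open>e\<close>: the levels 0, 1, 2 are the top line, the glued middle line and the
  bottom line. The connected components of the resulting curve that miss the top and the bottom
  line are the closed loops; the others are the arcs of the composite.
\<close>

fun upper :: "point \<Rightarrow> nat \<times> nat" where
  "upper (Top i) = (0, i)"
| "upper (Bot j) = (1, j)"

fun lower :: "point \<Rightarrow> nat \<times> nat" where
  "lower (Top i) = (1, i)"
| "lower (Bot j) = (2, j)"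

fun outer :: "point \<Rightarrow> nat \<times> nat" where
  "outer (Top i) = (0, i)"
| "outer (Bot j) = (2, j)"

definition stack_arcs :: "diagram \<Rightarrow> diagram \<Rightarrow> (nat \<times> nat) set set" where
  "stack_arcs d e = image upper ` arcs d \<union> image lower ` arcs e"

definition stack_components :: "diagram \<Rightarrow> diagram \<Rightarrow> (nat \<times> nat) set set" where
  "stack_components d e =
     \<Union>(stack_arcs d e) // {(x, y). \<exists>a\<in>stack_arcs d e. x \<in> a \<and> y \<in> a}\<^sup>+"

definition dcomp :: "diagram \<Rightarrow> diagram \<Rightarrow> diagram" where
  "dcomp d e =
     Diagram (dtop d) (dbot e) ((\<lambda>C. outer -` C) ` stack_components d e - {{}})"

definition loops :: "diagram \<Rightarrow> diagram \<Rightarrow> nat" where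
  "loops d e = card {C \<in> stack_components d e. outer -` C = {}}"

fun shift :: "nat \<Rightarrow> nat \<Rightarrow> point \<Rightarrow> point" where
  "shift m n (Top i) = Top (m + i)"
| "shift m n (Bot j) = Bot (n + j)"

definition dtensor :: "diagram \<Rightarrow> diagram \<Rightarrow> diagram" where
  "dtensor d e =
     Diagram (dtop d + dtop e) (dbot d + dbot e)
       (arcs d \<union> image (shift (dtop d) (dbot d)) ` arcs e)"

definition did :: "nat \<Rightarrow> diagram" where
  "did n = Diagram n n {{Top i, Bot i} | i. i < n}"

definition dcup :: "nat \<Rightarrow> diagram" where
  "dcup n = Diagram 0 (2 * n) {{Bot i, Bot (2 * n - 1 - i)} | i. i < n}"

definition dcap :: "nat \<Rightarrow> diagram" where
  "dcap n = Diagram (2 * n) 0 {{Top i, Top (2 * n - 1 - i)} | i. i < n}"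

section \<open>The Temperley--Lieb category\<close>

type_synonym tl = "diagram \<Rightarrow>\<^sub>0 complex"

definition scale :: "complex \<Rightarrow> ('a \<Rightarrow>\<^sub>0 complex) \<Rightarrow> ('a \<Rightarrow>\<^sub>0 complex)" where
  "scale c f = Poly_Mapping.map ((*) c) f"

definition dg :: "diagram \<Rightarrow> tl" where
  "dg d = Poly_Mapping.single d 1"

definition tl_hom :: "nat \<Rightarrow> nat \<Rightarrow> tl set" where
  "tl_hom m n = {f. Poly_Mapping.keys f \<subseteq> tl_diagrams m n}"

definition loop_value :: "complex \<Rightarrow> complex" where
  "loop_value A = - (A ^ 2) - inverse A ^ 2"

text \<open>Composition is written in diagrammatic order: \<open>f\<close> on top of \<open>g\<close>, that is, first \<open>f\<close>,
  then \<open>g\<close>.\<close>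

definition tl_comp :: "complex \<Rightarrow> tl \<Rightarrow> tl \<Rightarrow> tl" where
  "tl_comp A f g =
     (\<Sum>d\<in>Poly_Mapping.keys f. \<Sum>e\<in>Poly_Mapping.keys g.
        Poly_Mapping.single (dcomp d e) (Poly_Mapping.lookup f d * Poly_Mapping.lookup g e * loop_value A ^ loops d e))"

definition tl_tensor :: "tl \<Rightarrow> tl \<Rightarrow> tl" (infixr "\<otimes>" 72) where
  "f \<otimes> g =
     (\<Sum>d\<in>Poly_Mapping.keys f. \<Sum>e\<in>Poly_Mapping.keys g. Poly_Mapping.single (dtensor d e) (Poly_Mapping.lookup f d * Poly_Mapping.lookup g e))"

definition is_jones_wenzl :: "complex \<Rightarrow> nat \<Rightarrow> tl \<Rightarrow> bool" where
  "is_jones_wenzl A n f \<longleftrightarrow>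
     f \<in> tl_hom n n \<and> f \<noteq> 0 \<and> tl_comp A f f = f \<and>
     (\<forall>i j. i + 2 + j = n \<longrightarrow>
        tl_comp A f (dg (did i) \<otimes> dg (dcap 1) \<otimes> dg (did j)) = 0 \<and>
        tl_comp A (dg (did i) \<otimes> dg (dcup 1) \<otimes> dg (did j)) f = 0)"

definition jw :: "complex \<Rightarrow> nat \<Rightarrow> tl" where
  "jw A n = (THE f. is_jones_wenzl A n f)"

definition jws :: "complex \<Rightarrow> nat list \<Rightarrow> tl" where
  "jws A as = foldr (\<lambda>a f. jw A a \<otimes> f) as (dg (did 0))"

text \<open>Morphisms \<open>V\<^bsub>y\<^sub>1\<^esub> \<otimes> \<dots> \<otimes> V\<^bsub>y\<^sub>k\<^esub> \<rightarrow> V\<^bsub>x\<^sub>1\<^esub> \<otimes> \<dots> \<otimes> V\<^bsub>x\<^sub>l\<^esub>\<close> in the idempotent completion.\<close>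

definition kar_hom :: "complex \<Rightarrow> nat list \<Rightarrow> nat list \<Rightarrow> tl set" where
  "kar_hom A ys xs =
     {f \<in> tl_hom (sum_list ys) (sum_list xs). tl_comp A (jws A ys) (tl_comp A f (jws A xs)) = f}"

section \<open>Loops, 3-vertices and theta graphs\<close>

definition Delta :: "complex \<Rightarrow> nat \<Rightarrow> complex" where
  "Delta A n = (-1) ^ n * (\<Sum>s=0..n. A powi (2 * int n - 4 * int s))"

definition admissible :: "nat \<Rightarrow> nat \<Rightarrow> nat \<Rightarrow> bool" where
  "admissible a b c \<longleftrightarrow> even (a + b + c) \<and> a \<le> b + c \<and> b \<le> a + c \<and> c \<le> a + b"

text \<open>The Kauffman--Lins 3-vertex, drawn with \<open>a\<close> on top and \<open>b\<close>, \<open>c\<close> at the bottom, and its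
  reflection with \<open>b\<close>, \<open>c\<close> on top and \<open>a\<close> at the bottom.\<close>

definition split_vertex :: "complex \<Rightarrow> nat \<Rightarrow> nat \<Rightarrow> nat \<Rightarrow> tl" where
  "split_vertex A a b c =
     (if admissible a b c then
        tl_comp A (jw A a)
          (tl_comp A
            (dg (did ((a + b - c) div 2)) \<otimes> dg (dcup ((b + c - a) div 2)) \<otimes>
               dg (did ((a + c - b) div 2)))
            (jw A b \<otimes> jw A c))
      else 0)"

definition merge_vertex :: "complex \<Rightarrow> nat \<Rightarrow> nat \<Rightarrow> nat \<Rightarrow> tl" where
  "merge_vertex A b c a =
     (if admissible a b c then
        tl_comp A (jw A b \<otimes> jw A c)
          (tl_comp A
            (dg (did ((a + b - c) div 2)) \<otimes> dg (dcap ((b + c - a) div 2)) \<otimes>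
               dg (did ((a + c - b) div 2)))
            (jw A a))
      else 0)"

text \<open>A closed diagram is a multiple of the empty diagram; its value is the coefficient.\<close>

definition closed_value :: "tl \<Rightarrow> complex" where
  "closed_value f = Poly_Mapping.lookup f (did 0)"

text \<open>The edges \<open>b\<close> and \<open>c\<close> run side by side between the two vertices; the edge \<open>a\<close> closes up
  around the right.\<close>

definition theta :: "complex \<Rightarrow> nat \<Rightarrow> nat \<Rightarrow> nat \<Rightarrow> complex" where
  "theta A a b c =
     closed_value
       (tl_comp A (dg (dcup a))
         (tl_comp A (tl_comp A (split_vertex A a b c) (merge_vertex A b c a) \<otimes> jw A a)
           (dg (dcap a))))"

section \<open>Planar trivalent trees\<close>

text \<open>
  A planar trivalent tree whose external edges end on the boundary of a disc is determined up to
  isotopy by the plane binary tree obtained by declaring one fixed external edge to be the root.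
  The boundary of the strip is traversed counterclockwise, from the leftmost bottom endpoint: the
  bottom edges \<open>x\<^sub>1, \<dots>, x\<^sub>l\<close> come first, followed by the top edges \<open>y\<^sub>k, \<dots>, y\<^sub>1\<close>. The last
  external edge in this order is the root, the others are the leaves from left to right. Every node
  carries the label of the edge joining it to its parent; at the top node this is the root edge.
  Unlabelled trees are trees with labels in \<^typ>\<open>unit\<close>.
\<close>

datatype 'l ptree = Ext (rootl: 'l) | Vtx (rootl: 'l) "'l ptree" "'l ptree"

fun leaf_labels :: "'l ptree \<Rightarrow> 'l list" where
  "leaf_labels (Ext a) = [a]"
| "leaf_labels (Vtx a l r) = leaf_labels l @ leaf_labels r"

definition external_labels :: "'l ptree \<Rightarrow> 'l list" where
  "external_labels t = leaf_labels t @ [rootl t]"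

definition planar_trees :: "nat \<Rightarrow> unit ptree set" where
  "planar_trees n = {T. length (external_labels T) = n}"

text \<open>Labels of the edges above trivalent vertices. The first of them is the root edge, which is
  external; the remaining ones are the internal edges.\<close>

fun vertex_labels :: "'l ptree \<Rightarrow> 'l list" where
  "vertex_labels (Ext a) = []"
| "vertex_labels (Vtx a l r) = a # vertex_labels l @ vertex_labels r"

definition internal_labels :: "'l ptree \<Rightarrow> 'l list" where
  "internal_labels t = tl (vertex_labels t)"

fun all_admissible :: "nat ptree \<Rightarrow> bool" where
  "all_admissible (Ext a) \<longleftrightarrow> True"
| "all_admissible (Vtx a l r) \<longleftrightarrow>
     admissible a (rootl l) (rootl r) \<and> all_admissible l \<and> all_admissible r"

definition labellings :: "unit ptree \<Rightarrow> nat list \<Rightarrow> nat list \<Rightarrow> nat ptree set" where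
  "labellings T xs ys =
     {t. map_ptree (\<lambda>_. ()) t = T \<and> external_labels t = xs @ rev ys \<and> all_admissible t}"

fun theta_product :: "complex \<Rightarrow> nat ptree \<Rightarrow> complex" where
  "theta_product A (Ext a) = 1"
| "theta_product A (Vtx a l r) =
     theta A a (rootl l) (rootl r) * theta_product A l * theta_product A r"

text \<open>The tree drawn with its root edge on top and its leaves at the bottom.\<close>

fun tree_map :: "complex \<Rightarrow> nat ptree \<Rightarrow> tl" where
  "tree_map A (Ext a) = jw A a"
| "tree_map A (Vtx a l r) =
     tl_comp A (split_vertex A a (rootl l) (rootl r)) (tree_map A l \<otimes> tree_map A r)"

text \<open>
  The tree drawn in the strip: the root edge is bent over to the right so that all external edges
  end at the bottom, in the order \<open>xs @ rev ys\<close>; then the edges \<open>rev ys\<close> are bent up to the top.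
\<close>

definition strip_map :: "complex \<Rightarrow> nat list \<Rightarrow> nat list \<Rightarrow> nat ptree \<Rightarrow> tl" where
  "strip_map A xs ys t =
     tl_comp A
       (tl_comp A (dg (dcup (rootl t))) (tree_map A t \<otimes> jw A (rootl t)) \<otimes> jws A ys)
       (dg (did (sum_list xs)) \<otimes> dg (dcap (sum_list ys)))"

lemma labels_le_leaf_sum:
  "all_admissible t \<Longrightarrow> set_ptree t \<subseteq> {..sum_list (leaf_labels t)}"
proof (induction t)
  case (Vtx a l r)
  have "rootl l \<in> set_ptree l" "rootl r \<in> set_ptree r"
    by (cases l; simp) (cases r; simp)
  moreover have l: "set_ptree l \<subseteq> {..sum_list (leaf_labels l)}"
    and r: "set_ptree r \<subseteq> {..sum_list (leaf_labels r)}"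
    and a: "a \<le> rootl l + rootl r"
    using Vtx by (simp_all add: admissible_def)
  ultimately have "rootl l \<le> sum_list (leaf_labels l)" "rootl r \<le> sum_list (leaf_labels r)"
    by blast+
  with a have "a \<le> sum_list (leaf_labels l) + sum_list (leaf_labels r)" by linarith
  moreover have "x \<le> sum_list (leaf_labels l) + sum_list (leaf_labels r)"
    if "x \<in> set_ptree l \<union> set_ptree r" for x
    using that l r by (meson UnE atMost_iff subsetD trans_le_add1 trans_le_add2)
  ultimately show ?case by auto
qed simp

lemma finite_bounded_labellings:
  fixes T :: "unit ptree"
  assumes "finite B"
  shows "finite {t. map_ptree (\<lambda>_. ()) t = T \<and> set_ptree t \<subseteq> B}" (is "finite (?S T)")
proof (induction T)
  case (Ext u)
  have "?S (Ext u) \<subseteq> Ext ` B"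
  proof
    fix t assume "t \<in> ?S (Ext u)" then show "t \<in> Ext ` B" by (cases t) auto
  qed
  then show ?case by (rule finite_surj[OF assms])
next
  case (Vtx u l r)
  have "?S (Vtx u l r) \<subseteq> (\<lambda>(a, s, t). Vtx a s t) ` (B \<times> ?S l \<times> ?S r)"
  proof
    fix t assume "t \<in> ?S (Vtx u l r)"
    then show "t \<in> (\<lambda>(a, s, t). Vtx a s t) ` (B \<times> ?S l \<times> ?S r)"
      by (cases t) (auto simp: image_iff)
  qed
  moreover have "finite (B \<times> ?S l \<times> ?S r)"
    by (intro finite_cartesian_product assms Vtx)
  ultimately show ?case by (rule finite_surj[rotated])
qed

lemma finite_labellings: "finite (labellings T xs ys)"
proof (rule finite_subset)
  show "labellings T xs ys \<subseteq>
      {t. map_ptree (\<lambda>_. ()) t = T \<and> set_ptree t \<subseteq> {..sum_list (xs @ rev ys)}}"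
  proof
    fix t assume t: "t \<in> labellings T xs ys"
    have "sum_list (leaf_labels t) \<le> sum_list (external_labels t)"
      by (simp add: external_labels_def)
    then have "sum_list (leaf_labels t) \<le> sum_list (xs @ rev ys)"
      using t by (simp add: labellings_def)
    moreover have "set_ptree t \<subseteq> {..sum_list (leaf_labels t)}"
      using t labels_le_leaf_sum by (simp add: labellings_def)
    ultimately have "set_ptree t \<subseteq> {..sum_list (xs @ rev ys)}"
      by (meson atMost_subset_iff order_trans)
    then show "t \<in> {t. map_ptree (\<lambda>_. ()) t = T \<and> set_ptree t \<subseteq> {..sum_list (xs @ rev ys)}}"
      using t by (simp add: labellings_def)
  qed
qed (simp add: finite_bounded_labellings)

section \<open>Balanced theory\<close>

text \<open>
  Morphism spaces of the product category are tensor products of a morphism space at parameter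
  \<open>A\<close> and one at parameter \<open>inverse A\<close>, so they have pairs of diagrams as a basis before passing to
  the idempotent completion.
\<close>

type_synonym tl2 = "diagram \<times> diagram \<Rightarrow>\<^sub>0 complex"

definition tl_boxtimes :: "tl \<Rightarrow> tl \<Rightarrow> tl2" (infix "\<boxtimes>" 71) where
  "f \<boxtimes> g =
     (\<Sum>d\<in>Poly_Mapping.keys f. \<Sum>e\<in>Poly_Mapping.keys g. Poly_Mapping.single (d, e) (Poly_Mapping.lookup f d * Poly_Mapping.lookup g e))"

text \<open>Morphisms \<open>V\<^bsub>y\<^sub>1\<^esub> \<otimes> \<dots> \<otimes> V\<^bsub>y\<^sub>k\<^esub> \<rightarrow> V\<^bsub>x\<^sub>1\<^esub> \<otimes> \<dots> \<otimes> V\<^bsub>x\<^sub>l\<^esub>\<close> for pairs \<open>y\<^sub>i\<close>, \<open>x\<^sub>i\<close>.\<close>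

definition bal_hom :: "complex \<Rightarrow> (nat \<times> nat) list \<Rightarrow> (nat \<times> nat) list \<Rightarrow> tl2 set" where
  "bal_hom A ys xs =
     {\<Sum>(f, g)\<in>S. f \<boxtimes> g | S. finite S \<and>
        S \<subseteq> kar_hom A (map fst ys) (map fst xs) \<times> kar_hom (inverse A) (map snd ys) (map snd xs)}"

definition pair_strip_map ::
    "complex \<Rightarrow> (nat \<times> nat) list \<Rightarrow> (nat \<times> nat) list \<Rightarrow> (nat \<times> nat) ptree \<Rightarrow> tl2" where
  "pair_strip_map A xs ys t =
     strip_map A (map fst xs) (map fst ys) (map_ptree fst t) \<boxtimes>
     strip_map (inverse A) (map snd xs) (map snd ys) (map_ptree snd t)"

definition bal :: "nat \<Rightarrow> nat \<times> nat" where
  "bal j = (j, j)"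

text \<open>The tree with every trivalent vertex replaced by a normalized 3-vertex.\<close>

definition normalized_map :: "complex \<Rightarrow> nat list \<Rightarrow> nat list \<Rightarrow> nat ptree \<Rightarrow> tl2" where
  "normalized_map A xs ys t =
     scale (1 / theta_product A t)
       (pair_strip_map A (map bal xs) (map bal ys) (map_ptree bal t))"

definition nvertex :: "complex \<Rightarrow> nat list \<Rightarrow> nat list \<Rightarrow> unit ptree \<Rightarrow> tl2" where
  "nvertex A xs ys T =
     (\<Sum>t\<in>labellings T xs ys.
        scale (\<Prod>j\<leftarrow>internal_labels t. Delta A j) (normalized_map A xs ys t))"

end

theory Submission
  imports Defs
begin

text \<open>
  The loop value is invariant under \<open>A \<mapsto> inverse A\<close>, so both factors of \<open>\<boxtimes>\<close> are computed in
  the same Temperley--Lieb category, and the \<open>n\<close>-vertex is a sum of terms \<open>c\<^sub>t u\<^sub>t \<boxtimes> u\<^sub>t\<close>, where \<open>u\<^sub>t\<close> is the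
  labelled tree \<open>t\<close>. Composing with the reflection of a diagram gives a symmetric bilinear form on the
  space of morphisms with prescribed ends. Iterating the fusion rule along the tree, \<open>f = \<Sum>\<^sub>t c\<^sub>t \<langle>f, u\<^sub>t\<rangle> u\<^sub>t\<close>
  for all \<open>f\<close> in this space. Hence \<open>\<Sum>\<^sub>t c\<^sub>t u\<^sub>t \<boxtimes> u\<^sub>t\<close> is the canonical element of the form, which does not
  depend on the tree; no 6j-symbols are needed.
\<close>

section \<open>Connected components of set systems\<close>

text \<open>Why the canonical element is independent of the tree: if every \<open>f\<close> expands
  along two tree shapes, one tensor factor of the first sum can be expanded along the second shape,
  and symmetry of the form allows the other factor to be collected. Symmetry holds because
  Jones-Wenzl idempotents equal their own mirror images. The c_t are products of fusion coefficients
  Delta/theta, one per vertex; this counts the root edge as well, whose Delta is common to all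
  labellings and is divided out at the end. The fusion rule rests on two facts: morphisms from two
  idempotents to one are multiples of the 3-vertex, and the identity on n strands is a sum of
  morphisms through single idempotents. Both come from one observation: a crossingless diagram other
  than an identity has an innermost turn-back on its top or bottom line, and idempotents kill
  turn-backs. The obstacle is the encoding: diagrams are matchings and stacking is defined by
  connected components, so associativity, loop counts and planarity of composites must first be
  derived for families of sets. Reflection of diagrams supplies the mirror half of these arguments
  and later the form itself.\<close>

definition conn :: "'a set set \<Rightarrow> ('a \<times> 'a) set" where
  "conn S = {(x, y). \<exists>a\<in>S. x \<in> a \<and> y \<in> a}\<^sup>+"

definition comps :: "'a set set \<Rightarrow> 'a set set" where
  "comps S = \<Union>S // conn S"

lemma stack_components_eq: "stack_components d e = comps (stack_arcs d e)"
  by (simp add: stack_components_def comps_def conn_def)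

lemma conn_arc: "a \<in> S \<Longrightarrow> x \<in> a \<Longrightarrow> y \<in> a \<Longrightarrow> (x, y) \<in> conn S"
  unfolding conn_def by blast

lemma conn_trans: "(x, y) \<in> conn S \<Longrightarrow> (y, z) \<in> conn S \<Longrightarrow> (x, z) \<in> conn S"
  unfolding conn_def by simp

lemma conn_induct [consumes 1, case_names arc step]:
  assumes "(x, y) \<in> conn S"
    and "\<And>a y. a \<in> S \<Longrightarrow> x \<in> a \<Longrightarrow> y \<in> a \<Longrightarrow> P y"
    and "\<And>a y z. (x, y) \<in> conn S \<Longrightarrow> P y \<Longrightarrow> a \<in> S \<Longrightarrow> y \<in> a \<Longrightarrow> z \<in> a \<Longrightarrow> P z"
  shows "P y"
  using assms(1) unfolding conn_def
proof (induction rule: trancl_induct)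
  case (base y)
  then show ?case using assms(2) by blast
next
  case (step y z)
  then show ?case using assms(3)[of y] unfolding conn_def by blast
qed

lemma conn_sym: "(x, y) \<in> conn S \<Longrightarrow> (y, x) \<in> conn S"
  unfolding conn_def by (rule symD[OF sym_trancl]) (auto simp: sym_def)

lemma conn_Union: "(x, y) \<in> conn S \<Longrightarrow> x \<in> \<Union>S \<and> y \<in> \<Union>S"
  by (induction rule: conn_induct) blast+

lemma conn_refl: "x \<in> \<Union>S \<Longrightarrow> (x, x) \<in> conn S"
  using conn_arc by fastforce

lemma conn_mono: "S \<subseteq> T \<Longrightarrow> conn S \<subseteq> conn T"
  unfolding conn_def by (rule trancl_mono_subset) blast

lemma equiv_conn: "equiv (\<Union>S) (conn S)"
  by (auto intro!: equivI refl_onI symI transI intro: conn_refl conn_sym conn_trans dest: conn_Union)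

lemma comps_ex: "x \<in> \<Union>S \<Longrightarrow> \<exists>C\<in>comps S. x \<in> C"
  unfolding comps_def by (meson equiv_class_self equiv_conn quotientI)

lemma comps_disjoint: "C \<in> comps S \<Longrightarrow> D \<in> comps S \<Longrightarrow> x \<in> C \<Longrightarrow> x \<in> D \<Longrightarrow> C = D"
  unfolding comps_def using quotient_disj[OF equiv_conn] by blast

lemma comps_conn: "C \<in> comps S \<Longrightarrow> x \<in> C \<Longrightarrow> y \<in> C \<longleftrightarrow> (x, y) \<in> conn S"
  unfolding comps_def by (elim quotientE) (metis Image_singleton_iff conn_sym conn_trans)

lemma comps_connD: "C \<in> comps S \<Longrightarrow> x \<in> C \<Longrightarrow> y \<in> C \<Longrightarrow> (x, y) \<in> conn S"
  using comps_conn by metis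

lemma comps_connI: "C \<in> comps S \<Longrightarrow> x \<in> C \<Longrightarrow> (x, y) \<in> conn S \<Longrightarrow> y \<in> C"
  using comps_conn by metis

lemma comps_nonempty: "C \<in> comps S \<Longrightarrow> C \<noteq> {}"
  unfolding comps_def using equiv_conn in_quotient_imp_non_empty by blast

lemma comps_subset: "C \<in> comps S \<Longrightarrow> C \<subseteq> \<Union>S"
  unfolding comps_def using equiv_conn in_quotient_imp_subset by blast

lemma comps_arc: "C \<in> comps S \<Longrightarrow> a \<in> S \<Longrightarrow> x \<in> a \<Longrightarrow> x \<in> C \<Longrightarrow> a \<subseteq> C"
  using comps_conn conn_arc by fastforce

lemma arc_in_comp: "a \<in> S \<Longrightarrow> a \<noteq> {} \<Longrightarrow> \<exists>C\<in>comps S. a \<subseteq> C"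
  by (metis UnionI comps_arc comps_ex ex_in_conv)

lemma comp_in_comp: "S \<subseteq> T \<Longrightarrow> C \<in> comps S \<Longrightarrow> \<exists>D\<in>comps T. C \<subseteq> D"
proof -
  assume ST: "S \<subseteq> T" and C: "C \<in> comps S"
  then obtain x where x: "x \<in> C" using comps_nonempty by (metis ex_in_conv)
  then have "x \<in> \<Union>T" using ST comps_subset[OF C] by blast
  then obtain D where D: "D \<in> comps T" "x \<in> D" using comps_ex by metis
  have "C \<subseteq> D"
    using comps_connI[OF D] comps_connD[OF C x] conn_mono[OF ST] by (meson subsetD subsetI)
  then show ?thesis using D by blast
qed

text \<open>A member of \<open>Q\<close> that meets a block contains it, because some member
  contains the block and members are disjoint. So members are closed under \<open>conn S\<close>,
  and being connected they are whole classes. Explicit computations of components go through this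
  criterion.\<close>

lemma comps_eqI:
  assumes disj: "\<And>C D x. C \<in> Q \<Longrightarrow> D \<in> Q \<Longrightarrow> x \<in> C \<Longrightarrow> x \<in> D \<Longrightarrow> C = D"
    and arc: "\<And>a. a \<in> S \<Longrightarrow> a \<noteq> {} \<Longrightarrow> \<exists>C\<in>Q. a \<subseteq> C"
    and ne: "{} \<notin> Q"
    and conn: "\<And>C x y. C \<in> Q \<Longrightarrow> x \<in> C \<Longrightarrow> y \<in> C \<Longrightarrow> (x, y) \<in> conn S"
  shows "comps S = Q"
proof -
  have closed: "y \<in> C" if "(x, y) \<in> conn S" "C \<in> Q" "x \<in> C" for x y C
    using that(1)
  proof (induction rule: conn_induct)
    case (arc a y)
    then obtain D where "D \<in> Q" "a \<subseteq> D" using assms(2) by blast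
    then show ?case using disj that arc by blast
  next
    case (step a y z)
    then obtain D where "D \<in> Q" "a \<subseteq> D" using assms(2) by blast
    then show ?case using disj that step by blast
  qed
  have cls: "conn S `` {x} = C" if "C \<in> Q" "x \<in> C" for x C
    using closed conn that by blast
  show ?thesis
  proof (intro equalityI subsetI)
    fix C assume "C \<in> comps S"
    then obtain x where x: "x \<in> \<Union>S" "C = conn S `` {x}"
      unfolding comps_def by (metis quotientE)
    then obtain D where "D \<in> Q" "x \<in> D" using arc by blast
    then show "C \<in> Q" using x cls by simp
  next
    fix C assume C: "C \<in> Q"
    then obtain x where x: "x \<in> C" using ne by (metis ex_in_conv)
    then have "x \<in> \<Union>S" using conn C conn_Union by fast
    then show "C \<in> comps S" unfolding comps_def using cls[OF C x] quotientI[of x "\<Union>S" "conn S"] by simp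
  qed
qed

lemma conn_image: "(x, y) \<in> conn S \<Longrightarrow> (f x, f y) \<in> conn (image f ` S)"
proof (induction rule: conn_induct)
  case (arc a y)
  then show ?case by (intro conn_arc[of "f ` a"]) auto
next
  case (step a y z)
  then have "(f y, f z) \<in> conn (image f ` S)" by (intro conn_arc[of "f ` a"]) auto
  then show ?case using step conn_trans by fast
qed

lemma comps_image:
  assumes "inj_on f (\<Union>S)"
  shows "comps (image f ` S) = image f ` comps S"
proof (rule comps_eqI)
  fix C D x assume "C \<in> image f ` comps S" "D \<in> image f ` comps S" "x \<in> C" "x \<in> D"
  then obtain C' D' u v where *: "C' \<in> comps S" "D' \<in> comps S" "u \<in> C'" "v \<in> D'" "f u = f v"
    "C = f ` C'" "D = f ` D'" by blast
  then have "u = v" using inj_onD[OF assms] comps_subset by (metis subsetD)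
  then show "C = D" using * comps_disjoint[of C' S D' u] by simp
next
  fix a assume "a \<in> image f ` S" "a \<noteq> {}"
  then obtain b x where "b \<in> S" "x \<in> b" "a = f ` b" by blast
  moreover from this obtain C where "C \<in> comps S" "x \<in> C" using comps_ex[of x S] by blast
  ultimately have "b \<subseteq> C" "C \<in> comps S" using comps_arc[of C S b x] by auto
  then show "\<exists>C\<in>image f ` comps S. a \<subseteq> C" using \<open>a = f ` b\<close> by blast
next
  show "{} \<notin> image f ` comps S" using comps_nonempty by auto
next
  fix C x y assume "C \<in> image f ` comps S" "x \<in> C" "y \<in> C"
  then show "(x, y) \<in> conn (image f ` S)" by (auto intro!: conn_image intro: comps_connD)
qed

lemma comps_Un:
  assumes "\<Union>S \<inter> \<Union>T = {}"
  shows "comps (S \<union> T) = comps S \<union> comps T"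
proof (rule comps_eqI)
  fix C D x assume "C \<in> comps S \<union> comps T" "D \<in> comps S \<union> comps T" "x \<in> C" "x \<in> D"
  then show "C = D"
    using comps_disjoint[of C _ D x] comps_subset[of C] comps_subset[of D] assms by blast
next
  fix a assume "a \<in> S \<union> T" "a \<noteq> {}"
  then show "\<exists>C\<in>comps S \<union> comps T. a \<subseteq> C" using arc_in_comp by blast
next
  show "{} \<notin> comps S \<union> comps T" using comps_nonempty by auto
next
  fix C x y assume "C \<in> comps S \<union> comps T" "x \<in> C" "y \<in> C"
  then show "(x, y) \<in> conn (S \<union> T)"
    using comps_connD conn_mono[of S "S \<union> T"] conn_mono[of T "S \<union> T"] by (metis UnE Un_upper1 Un_upper2 subsetD)
qed

lemma finite_comps: "finite S \<Longrightarrow> finite (comps S)"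
proof -
  assume "finite S"
  \<comment> \<open>Any block inside a component determines it, so the blocks enumerate the
    components; the union over a one-element family recovers the component.\<close>
  moreover have "comps S \<subseteq> (\<lambda>a. \<Union>{C\<in>comps S. a \<subseteq> C}) ` S"
  proof
    fix C assume C: "C \<in> comps S"
    then obtain x where "x \<in> C" using comps_nonempty by (metis ex_in_conv)
    moreover then obtain a where "a \<in> S" "x \<in> a" using C comps_subset by blast
    ultimately have "{D\<in>comps S. a \<subseteq> D} = {C}"
      using C comps_arc[of C S a x] comps_disjoint[of C S _ x] by blast
    then show "C \<in> (\<lambda>a. \<Union>{C\<in>comps S. a \<subseteq> C}) ` S" using \<open>a \<in> S\<close> by (intro image_eqI[of _ _ a]) simp_all
  qed
  ultimately show ?thesis using finite_surj by blast
qed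

text \<open>\<open>V\<close> is an interface containing all points shared by \<open>S\<close> and
  \<open>T\<close>, and \<open>K\<close> keeps only the traces on \<open>V\<close> of the components
  of \<open>S\<close>. A path in \<open>S \<union> T\<close> breaks into steps in \<open>T\<close>
  and runs inside \<open>S\<close>; a run between two distinct visible points has its ends in
  \<open>V\<close> and becomes a single step of \<open>K\<close>.\<close>

lemma conn_contract:
  assumes ST: "\<Union>S \<inter> \<Union>T \<subseteq> V" and K: "K = (\<lambda>C. C \<inter> V) ` comps S - {{}}"
    and xy: "(x, y) \<in> conn (S \<union> T)" and x: "x \<in> V \<union> \<Union>T" and y: "y \<in> V \<union> \<Union>T"
  shows "(x, y) \<in> conn (K \<union> T)"
proof -
  let ?W = "(V \<union> \<Union>T) \<inter> \<Union>(S \<union> T)"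
  have inW: "(w, w) \<in> conn (K \<union> T)" if w: "w \<in> ?W" for w
  proof (cases "w \<in> \<Union>T")
    case True then show ?thesis by (intro conn_refl) auto
  next
    case False
    then obtain C where "C \<in> comps S" "w \<in> C" using w comps_ex[of w S] by blast
    then have "C \<inter> V \<in> K" "w \<in> C \<inter> V" using False w unfolding K by auto
    then show ?thesis by (intro conn_refl) auto
  qed
  have jump: "(w, z) \<in> conn (K \<union> T)" if "w \<in> ?W" "z \<in> ?W" "w = z \<or> (w, z) \<in> conn S" for w z
  proof (cases "w = z")
    case True then show ?thesis using inW that by blast
  next
    case False
    then have wz: "(w, z) \<in> conn S" using that by blast
    then have V: "w \<in> V" "z \<in> V" using ST that conn_Union[OF wz] by blast+
    obtain C where "C \<in> comps S" "w \<in> C" using comps_ex conn_Union[OF wz] by metis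
    moreover have "z \<in> C" using calculation comps_connI wz by metis
    ultimately show ?thesis using V unfolding K by (intro conn_arc[of "C \<inter> V"]) auto
  qed
  have xS: "x \<in> ?W" using conn_Union[OF xy] x by blast
  \<comment> \<open>Invariant along a path: \<open>w\<close> is a visible point already reached
    after contraction, and the remaining stretch from \<open>w\<close> to \<open>z\<close> stays
    inside \<open>S\<close>.\<close>
  have "\<exists>w\<in>?W. (x, w) \<in> conn (K \<union> T) \<and> (w = z \<or> (w, z) \<in> conn S)"
    if "(x, z) \<in> conn (S \<union> T)" for z
    using that
  proof (induction rule: conn_induct)
    case (arc a z)
    show ?case
    proof (cases "a \<in> S")
      case True
      then show ?thesis using arc conn_arc xS inW by metis
    next
      case False
      then have "a \<in> T" using arc by blast
      then have "(x, z) \<in> conn (K \<union> T)" "z \<in> ?W" using arc by (auto intro: conn_arc)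
      then show ?thesis by blast
    qed
  next
    case (step a z v)
    then obtain w where w: "w \<in> ?W" "(x, w) \<in> conn (K \<union> T)" "w = z \<or> (w, z) \<in> conn S" by blast
    show ?case
    proof (cases "a \<in> S")
      case True
      then have "(z, v) \<in> conn S" using step conn_arc by metis
      then show ?thesis using w conn_trans by metis
    next
      case False
      then have T: "a \<in> T" using step by blast
      then have "z \<in> ?W" "v \<in> ?W" using step by auto
      moreover have "(z, v) \<in> conn (K \<union> T)" using T step by (auto intro: conn_arc)
      ultimately show ?thesis using w jump conn_trans by metis
    qed
  qed
  then obtain w where "w \<in> ?W" "(x, w) \<in> conn (K \<union> T)" "w = y \<or> (w, y) \<in> conn S"
    using xy by blast
  moreover have "y \<in> ?W" using conn_Union[OF xy] y by blast
  ultimately show ?thesis using jump conn_trans by metis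
qed

text \<open>Seen from \<open>V \<union> \<Union>T\<close>, gluing in two stages has the same outcome
  as gluing at once. This is the combinatorial core of associativity.\<close>

lemma comps_contract:
  assumes ST: "\<Union>S \<inter> \<Union>T \<subseteq> V" and K: "K = (\<lambda>C. C \<inter> V) ` comps S - {{}}"
  shows "comps (K \<union> T) = (\<lambda>D. D \<inter> (V \<union> \<Union>T)) ` comps (S \<union> T) - {{}}" (is "_ = ?Q")
proof (rule comps_eqI)
  fix C D x
  assume "C \<in> ?Q"
    "D \<in> ?Q" "x \<in> C" "x \<in> D"
  then show "C = D" using comps_disjoint[of _ "S \<union> T" _ x] by (auto simp del: Union_Un_distrib)
next
  fix a assume a: "a \<in> K \<union> T" "a \<noteq> {}"
  show "\<exists>C\<in>?Q. a \<subseteq> C"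
  proof (cases "a \<in> T")
    case True
    then obtain D where D: "D \<in> comps (S \<union> T)" "a \<subseteq> D" using arc_in_comp[of a "S \<union> T"] a by blast
    then have "a \<subseteq> D \<inter> (V \<union> \<Union>T)" using True by blast
    then show ?thesis using D a(2) by (intro bexI[of _ "D \<inter> (V \<union> \<Union>T)"]) blast+
  next
    case False
    then obtain C where C: "C \<in> comps S" "a = C \<inter> V" using a K by blast
    then obtain D where D: "D \<in> comps (S \<union> T)" "C \<subseteq> D" using comp_in_comp[of S "S \<union> T" C] by blast
    then have "a \<subseteq> D \<inter> (V \<union> \<Union>T)" using C by blast
    then show ?thesis using D a(2) by (intro bexI[of _ "D \<inter> (V \<union> \<Union>T)"]) blast+
  qed
next
  fix C x y assume "C \<in> ?Q" and xy: "x \<in> C" "y \<in> C"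
  then obtain D where D: "D \<in> comps (S \<union> T)" and C: "C = D \<inter> (V \<union> \<Union>T)" by auto
  show "(x, y) \<in> conn (K \<union> T)"
    using xy unfolding C by (intro conn_contract[OF ST K] comps_connD[OF D]) simp_all
qed simp

text \<open>A component of \<open>S\<close> that avoids the interface cannot be entered from
  \<open>T\<close>, so it survives unchanged. These are the loops closed in the first stage of a
  gluing.\<close>

lemma comps_away:
  assumes ST: "\<Union>S \<inter> \<Union>T \<subseteq> V"
  shows "{D \<in> comps (S \<union> T). D \<inter> (V \<union> \<Union>T) = {}} = {C \<in> comps S. C \<inter> V = {}}"
proof -
  have up: "\<exists>D\<in>comps (S \<union> T). C \<subseteq> D" if C: "C \<in> comps S" for C
    using comp_in_comp[OF _ C] by blast
  have away: "(x, y) \<in> conn S" if "(x, y) \<in> conn (S \<union> T)" "C \<in> comps S" "C \<inter> V = {}" "x \<in> C" for x y C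
    using that(1)
  proof (induction rule: conn_induct)
    case (arc a y)
    then have "a \<notin> T" using that ST comps_subset[of C S] by blast
    then show ?case using arc conn_arc by fast
  next
    case (step a y z)
    then have "y \<in> C" using that comps_connI by metis
    then have "a \<notin> T" using step that ST comps_subset[of C S] by blast
    then have "(y, z) \<in> conn S" using step conn_arc by fast
    then show ?case using step conn_trans by fast
  qed
  show ?thesis
  proof (intro equalityI subsetI)
    fix D assume "D \<in> {D \<in> comps (S \<union> T). D \<inter> (V \<union> \<Union>T) = {}}"
    then have D: "D \<in> comps (S \<union> T)" "D \<inter> (V \<union> \<Union>T) = {}" by auto
    then obtain x where x: "x \<in> D" using comps_nonempty by (metis ex_in_conv)
    then have "x \<in> \<Union>S" using D comps_subset[OF D(1)] by blast
    then obtain C where C: "C \<in> comps S" "x \<in> C" using comps_ex by metis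
    then have CD: "C \<subseteq> D" using up[OF C(1)] comps_disjoint[OF D(1)] x by blast
    then have CV: "C \<inter> V = {}" using D by blast
    have "D \<subseteq> C"
    proof
      fix y assume "y \<in> D"
      then show "y \<in> C" by (intro comps_connI[OF C] away[OF _ C(1) CV C(2)] comps_connD[OF D(1) x])
    qed
    then have "D = C" using CD by (rule subset_antisym)
    then show "D \<in> {C \<in> comps S. C \<inter> V = {}}" using C CV by simp
  next
    fix C assume "C \<in> {C \<in> comps S. C \<inter> V = {}}"
    then have C: "C \<in> comps S" "C \<inter> V = {}" by auto
    obtain x where x: "x \<in> C" using comps_nonempty C by (metis ex_in_conv)
    obtain D where D: "D \<in> comps (S \<union> T)" "C \<subseteq> D" using up C by blast
    have "D \<subseteq> C"
    proof
      fix y assume "y \<in> D"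
      then show "y \<in> C" using x D(2)
        by (intro comps_connI[OF C(1) x] away[OF _ C x] comps_connD[OF D(1)]) blast+
    qed
    then have "C \<in> comps (S \<union> T)" using D by (metis subset_antisym)
    moreover have "C \<inter> \<Union>T = {}" using C ST comps_subset[of C S] by blast
    ultimately show "C \<in> {D \<in> comps (S \<union> T). D \<inter> (V \<union> \<Union>T) = {}}" using C by (simp add: Int_Un_distrib del: Union_Un_distrib)
  qed
qed

text \<open>Here \<open>X\<close> is the outer boundary. A loop of the full gluing either avoids the
  visible part, and is closed in the first stage, or leaves a nonempty trace, which determines it
  and is a loop of the second stage.\<close>

lemma card_contract:
  assumes ST: "\<Union>S \<inter> \<Union>T \<subseteq> V" and K: "K = (\<lambda>C. C \<inter> V) ` comps S - {{}}"
    and out: "X \<inter> \<Union>(S \<union> T) \<subseteq> V \<union> \<Union>T" and fin: "finite S" "finite T"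
  shows "card {C \<in> comps S. C \<inter> V = {}} + card {E \<in> comps (K \<union> T). E \<inter> X = {}}
    = card {D \<in> comps (S \<union> T). D \<inter> X = {}}"
proof -
  let ?W = "V \<union> \<Union>T"
  let ?A = "{D \<in> comps (S \<union> T). D \<inter> ?W = {}}"
  let ?B = "{D \<in> comps (S \<union> T). D \<inter> ?W \<noteq> {} \<and> D \<inter> X = {}}"
  have out': "D \<inter> X \<subseteq> ?W" if "D \<in> comps (S \<union> T)" for D
    using comps_subset[OF that] out by blast
  then have "{E \<in> comps (K \<union> T). E \<inter> X = {}} = (\<lambda>D. D \<inter> ?W) ` ?B"
    unfolding comps_contract[OF ST K] by fast
  moreover have "inj_on (\<lambda>D. D \<inter> ?W) ?B"
  proof (rule inj_onI)
    fix C D assume CD: "C \<in> ?B" "D \<in> ?B" "C \<inter> ?W = D \<inter> ?W"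
    then obtain x where "x \<in> C \<inter> ?W" by blast
    then have "x \<in> C" "x \<in> D" using CD(3) by auto
    then show "C = D" using CD comps_disjoint[of C "S \<union> T" D x] by simp
  qed
  ultimately have "card {E \<in> comps (K \<union> T). E \<inter> X = {}} = card ?B" by (simp add: card_image)
  moreover have "finite (comps (S \<union> T))" using fin finite_comps by blast
  moreover have "{D \<in> comps (S \<union> T). D \<inter> X = {}} = ?A \<union> ?B" "?A \<inter> ?B = {}"
    using out' by fast+
  ultimately show ?thesis using comps_away[OF ST] finite_comps[OF fin(1)] by (simp add: card_Un_disjoint)
qed

section \<open>Associativity, interchange and reflection\<close>

fun flip :: "point \<Rightarrow> point" where
  "flip (Top i) = Bot i"
| "flip (Bot j) = Top j"

definition dflip :: "diagram \<Rightarrow> diagram" where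
  "dflip d = Diagram (dbot d) (dtop d) (image flip ` arcs d)"

lemma dtop_dcomp [simp]: "dtop (dcomp d e) = dtop d"
  and dbot_dcomp [simp]: "dbot (dcomp d e) = dbot e"
  and dtop_dtensor [simp]: "dtop (dtensor d e) = dtop d + dtop e"
  and dbot_dtensor [simp]: "dbot (dtensor d e) = dbot d + dbot e"
  and dtop_did [simp]: "dtop (did n) = n"
  and dbot_did [simp]: "dbot (did n) = n"
  and dtop_dcup [simp]: "dtop (dcup n) = 0"
  and dbot_dcup [simp]: "dbot (dcup n) = 2 * n"
  and dtop_dcap [simp]: "dtop (dcap n) = 2 * n"
  and dbot_dcap [simp]: "dbot (dcap n) = 0"
  and dtop_dflip [simp]: "dtop (dflip d) = dbot d"
  and dbot_dflip [simp]: "dbot (dflip d) = dtop d"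
  by (simp_all add: dcomp_def dtensor_def did_def dcup_def dcap_def dflip_def)

lemma finite_stack_arcs: "finite (arcs d) \<Longrightarrow> finite (arcs e) \<Longrightarrow> finite (stack_arcs d e)"
  by (simp add: stack_arcs_def)

lemma finite_arcs_dcomp: "finite (arcs d) \<Longrightarrow> finite (arcs e) \<Longrightarrow> finite (arcs (dcomp d e))"
  by (simp add: dcomp_def stack_components_eq finite_comps finite_stack_arcs)

lemma finite_arcs_dtensor: "finite (arcs d) \<Longrightarrow> finite (arcs e) \<Longrightarrow> finite (arcs (dtensor d e))"
  by (simp add: dtensor_def)

lemma flip_flip [simp]: "flip (flip p) = p"
  by (cases p) auto

lemma inj_flip: "inj_on flip X"
  by (metis flip_flip inj_onI)

lemma mem_flip_image: "p \<in> flip ` X \<longleftrightarrow> flip p \<in> X"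
  by (metis flip_flip image_iff)

lemma dflip_dflip [simp]: "dflip (dflip d) = d"
  by (cases d) (simp add: dflip_def image_image)

text \<open>The endpoints of a stack of three diagrams, on the levels 0 to 3.\<close>

fun lower3 :: "point \<Rightarrow> nat \<times> nat" where
  "lower3 (Top i) = (2, i)"
| "lower3 (Bot j) = (3, j)"

fun outer3 :: "point \<Rightarrow> nat \<times> nat" where
  "outer3 (Top i) = (0, i)"
| "outer3 (Bot j) = (3, j)"

definition stack3_arcs :: "diagram \<Rightarrow> diagram \<Rightarrow> diagram \<Rightarrow> (nat \<times> nat) set set" where
  "stack3_arcs d e f = image upper ` arcs d \<union> image lower ` arcs e \<union> image lower3 ` arcs f"

lemma range_outer: "range outer = {x. fst x = 0 \<or> fst x = 2}"
proof (intro equalityI subsetI)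
  fix x assume "x \<in> range outer"
  then obtain p where "x = outer p" by blast
  then show "x \<in> {x. fst x = 0 \<or> fst x = 2}" by (cases p) auto
next
  fix x :: "nat \<times> nat" assume "x \<in> {x. fst x = 0 \<or> fst x = 2}"
  then have "x = outer (Top (snd x)) \<or> x = outer (Bot (snd x))" by (cases x) auto
  then show "x \<in> range outer" by (metis rangeI)
qed

lemma inj_on_image_comps: "inj_on f (\<Union>S) \<Longrightarrow> inj_on (image f) (comps S)"
  by (rule inj_on_image, erule inj_on_subset) (rule Union_least, rule comps_subset)

lemma Collect_less_image: "{f i | i. i < (n :: nat)} = f ` {..<n}"
  by auto

lemma image_filter: "{y \<in> f ` Q. P y} = f ` {x \<in> Q. P (f x)}"
  by auto

lemma image_image_nonempty: "image f ` Q - {{}} = image f ` (Q - {{}})"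
  by auto

lemma stack_levels: "\<Union>(stack_arcs d e) \<subseteq> {x. fst x \<le> 2}"
proof -
  have "fst (upper p) \<le> 2" "fst (lower p) \<le> 2" for p by (cases p; simp)+
  then show ?thesis unfolding stack_arcs_def by blast
qed

lemma vimage_empty_iff_range: "f -` C = {} \<longleftrightarrow> C \<inter> range f = {}"
  by auto

lemma vimage_Int_range: "C \<inter> range f \<subseteq> W \<Longrightarrow> f -` (C \<inter> W) = f -` C"
  by auto

lemma fst_lower3: "fst (lower3 p) = 2 \<or> fst (lower3 p) = 3"
  and fst_outer3: "fst (outer3 p) = 0 \<or> fst (outer3 p) = 3"
  by (cases p; simp)+

text \<open>Once the first glued line has been contracted, a stack of three diagrams occupies the
  levels 0, 2, 3, whereas an ordinary stack uses 0, 1, 2. The map \<open>g\<close> renumbers;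
  injectivity on the occupied set \<open>W\<close> transports components and loops.\<close>

lemma relabel_comps:
  assumes inj: "inj_on g W" and sub: "\<Union>R \<subseteq> W"
    and out: "\<And>p. outer3 p \<in> W" "\<And>p. g (outer3 p) = outer p"
    and arcs: "stack_arcs d e = image g ` R"
  shows "(\<lambda>C. outer -` C) ` stack_components d e = (\<lambda>C. outer3 -` C) ` comps R"
    and "loops d e = card {E \<in> comps R. E \<inter> range outer3 = {}}"
proof -
  have inj': "inj_on g (\<Union>R)" using inj sub inj_on_subset by blast
  then have comps: "stack_components d e = image g ` comps R"
    unfolding stack_components_eq arcs by (rule comps_image)
  have out': "outer -` (g ` C) = outer3 -` C" if "C \<in> comps R" for C
  proof -
    have "p \<in> outer -` (g ` C) \<longleftrightarrow> p \<in> outer3 -` C" for p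
      using that comps_subset[of C R] sub out inj_on_eq_iff[OF inj, of "outer3 p"]
      by (simp add: image_iff) (metis subsetD)
    then show ?thesis by blast
  qed
  show "(\<lambda>C. outer -` C) ` stack_components d e = (\<lambda>C. outer3 -` C) ` comps R"
    unfolding comps image_image using out' by simp
  have "{C \<in> stack_components d e. outer -` C = {}} = image g ` {E \<in> comps R. E \<inter> range outer3 = {}}"
    unfolding comps image_filter vimage_empty_iff_range[of outer3, symmetric]
    by (intro arg_cong[of _ _ "image (image g)"] Collect_cong conj_cong refl) (simp only: out')
  moreover have "inj_on (image g) {E \<in> comps R. E \<inter> range outer3 = {}}"
    by (rule inj_on_subset[OF inj_on_image_comps[OF inj']]) simp
  ultimately show "loops d e = card {E \<in> comps R. E \<inter> range outer3 = {}}"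
    unfolding loops_def by (simp add: card_image)
qed

lemma image_trace_dcomp:
  assumes "\<And>p. h (outer p) = k p"
  shows "image h ` ((\<lambda>C. C \<inter> range outer) ` stack_components d e - {{}}) = image k ` arcs (dcomp d e)"
proof -
  have "h ` (C \<inter> range outer) = k ` (outer -` C)" for C
    unfolding assms[symmetric] by blast
  then show ?thesis
    unfolding dcomp_def diagram.sel image_image_nonempty[symmetric] image_image by (simp only:)
qed

text \<open>The left bracketing is read off from the stack of all three diagrams, which favours
  neither bracketing; the right one is then obtained by reflection.\<close>

lemma dcomp_stack3:
  "arcs (dcomp (dcomp d e) f) = (\<lambda>C. outer3 -` C) ` comps (stack3_arcs d e f) - {{}}"
  "finite (arcs d) \<Longrightarrow> finite (arcs e) \<Longrightarrow> finite (arcs f) \<Longrightarrow>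
    loops d e + loops (dcomp d e) f = card {D \<in> comps (stack3_arcs d e f). D \<inter> range outer3 = {}}"
proof -
  \<comment> \<open>The line glued first disappears by contraction, so the levels 2 and 3 become 1
    and 2.\<close>
  define g :: "nat \<times> nat \<Rightarrow> nat \<times> nat" where "g = (\<lambda>(l, i). (if l = 2 then 1 else if l = 3 then 2 else l, i))"
  let ?S = "stack_arcs d e" and ?T = "image lower3 ` arcs f" and ?V = "range outer"
  let ?K = "(\<lambda>C. C \<inter> ?V) ` comps ?S - {{}}"
  let ?W = "{x. fst x = 0 \<or> fst x = 2 \<or> fst x = (3::nat)}"
  have S: "\<Union>?S \<subseteq> {x. fst x \<le> 2}"
    by (rule stack_levels)
  have T: "\<Union>?T \<subseteq> {x. fst x = 2 \<or> fst x = 3}" by clarsimp (metis fst_conv fst_lower3)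
  have ST: "\<Union>?S \<inter> \<Union>?T \<subseteq> ?V"
  proof
    fix x assume x: "x \<in> \<Union>?S \<inter> \<Union>?T"
    have "fst x \<le> 2" "fst x = 2 \<or> fst x = 3"
      using subsetD[OF S IntD1[OF x]] subsetD[OF T IntD2[OF x]] by simp_all
    then show "x \<in> ?V" unfolding range_outer by auto
  qed
  have un: "?S \<union> ?T = stack3_arcs d e f" by (simp add: stack_arcs_def stack3_arcs_def)
  have inj: "inj_on g ?W" by (auto simp: g_def inj_on_def)
  have "\<Union>?K \<subseteq> ?V" by (rule Union_least) blast
  also have "?V \<subseteq> ?W" unfolding range_outer by auto
  finally have "\<Union>?K \<subseteq> ?W" .
  moreover have "\<Union>?T \<subseteq> ?W" by (rule subset_trans[OF T]) auto
  ultimately have sub: "\<Union>(?K \<union> ?T) \<subseteq> ?W" unfolding Union_Un_distrib by (rule Un_least)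
  have "g (outer p) = upper p" "g (lower3 p) = lower p" for p
    by (cases p; simp add: g_def)+
  then have arcs: "stack_arcs (dcomp d e) f = image g ` (?K \<union> ?T)"
    unfolding image_Un using image_trace_dcomp[of g upper d e]
    by (simp add: stack_arcs_def[of "dcomp d e"] stack_components_eq image_image)
  have out: "outer3 p \<in> ?W" "g (outer3 p) = outer p" for p by (cases p; simp add: g_def)+
  have X: "range outer3 \<inter> \<Union>(?S \<union> ?T) \<subseteq> ?V \<union> \<Union>?T"
  proof
    fix x assume x: "x \<in> range outer3 \<inter> \<Union>(?S \<union> ?T)"
    then obtain p where "x = outer3 p" by blast
    then have "fst x = 0 \<or> fst x = 3" using fst_outer3 by simp
    moreover have "x \<in> \<Union>?S \<Longrightarrow> fst x \<le> 2" using subsetD[OF S] by simp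
    ultimately have "x \<in> \<Union>?S \<Longrightarrow> x \<in> ?V" unfolding range_outer by auto
    then show "x \<in> ?V \<union> \<Union>?T" using IntD2[OF x] by (simp only: Union_Un_distrib Un_iff) blast
  qed
  note relabel = relabel_comps[OF inj sub out arcs]
  have trace: "outer3 -` (D \<inter> (?V \<union> \<Union>?T)) = outer3 -` D" if "D \<in> comps (?S \<union> ?T)" for D
  proof (rule vimage_Int_range)
    have "D \<inter> range outer3 \<subseteq> \<Union>(?S \<union> ?T) \<inter> range outer3"
      by (rule Int_mono[OF comps_subset[OF that] order_refl])
    then show "D \<inter> range outer3 \<subseteq> ?V \<union> \<Union>?T" using X by (simp only: Int_commute subset_trans)
  qed
  have "(\<lambda>C. outer3 -` C) ` (Q - {{}}) - {{}} = (\<lambda>C. outer3 -` C) ` Q - {{}}" for Q by auto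
  then have "arcs (dcomp (dcomp d e) f) =
      (\<lambda>C. outer3 -` C) ` (\<lambda>D. D \<inter> (?V \<union> \<Union>?T)) ` comps (?S \<union> ?T) - {{}}"
    unfolding dcomp_def[of "dcomp d e"] using relabel(1) comps_contract[OF ST refl] by simp
  also have "\<dots> = (\<lambda>C. outer3 -` C) ` comps (?S \<union> ?T) - {{}}"
    unfolding image_image using trace by simp
  finally show "arcs (dcomp (dcomp d e) f) = (\<lambda>C. outer3 -` C) ` comps (stack3_arcs d e f) - {{}}"
    unfolding un .
  show "loops d e + loops (dcomp d e) f = card {D \<in> comps (stack3_arcs d e f). D \<inter> range outer3 = {}}"
    if "finite (arcs d)" "finite (arcs e)" "finite (arcs f)"
    using card_contract[OF ST refl X] relabel(2) that finite_stack_arcs un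
    by (simp add: loops_def[of d e] stack_components_eq vimage_empty_iff_range)
qed

text \<open>The map \<open>g\<close> is assumed to be an involution only on the points that occur:
  reflecting levels by truncated subtraction is one only up to the height of the stack.\<close>

lemma
  assumes g: "\<And>x. x \<in> \<Union>S \<Longrightarrow> g (g x) = x" "\<And>p. g (out p) = out (flip p)"
  shows flip_comps: "(\<lambda>C. out -` C) ` comps (image g ` S) - {{}} = image flip ` ((\<lambda>C. out -` C) ` comps S - {{}})"
    and card_flip_comps: "card {C \<in> comps (image g ` S). out -` C = {}} = card {C \<in> comps S. out -` C = {}}"
proof -
  have inj: "inj_on g (\<Union>S)" by (metis g(1) inj_onI)
  have flip: "out -` (g ` C) = flip ` (out -` C)" if C: "C \<in> comps S" for C
  proof (rule set_eqI)
    fix p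
    have "p \<in> out -` (g ` C) \<longleftrightarrow> out (flip p) \<in> C"
    proof
      assume "p \<in> out -` (g ` C)"
      then obtain x where x: "x \<in> C" "out p = g x" by auto
      then have "out (flip p) = x" using g comps_subset[OF C] by (metis subsetD)
      then show "out (flip p) \<in> C" using x by simp
    next
      assume "out (flip p) \<in> C"
      then show "p \<in> out -` (g ` C)" using g(2)[of "flip p"] by (metis flip_flip image_eqI vimageI)
    qed
    then show "p \<in> out -` (g ` C) \<longleftrightarrow> p \<in> flip ` (out -` C)" by (simp add: mem_flip_image)
  qed
  show "(\<lambda>C. out -` C) ` comps (image g ` S) - {{}} = image flip ` ((\<lambda>C. out -` C) ` comps S - {{}})"
    unfolding comps_image[OF inj] image_image_nonempty[symmetric] image_image using flip by simp
  have "{C \<in> comps S. out -` (g ` C) = {}} = {C \<in> comps S. out -` C = {}}"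
    by (intro Collect_cong conj_cong refl) (simp only: flip image_is_empty)
  moreover have "inj_on (image g) {C \<in> comps S. out -` C = {}}"
    by (rule inj_on_subset[OF inj_on_image_comps[OF inj]]) auto
  ultimately show "card {C \<in> comps (image g ` S). out -` C = {}} = card {C \<in> comps S. out -` C = {}}"
    unfolding comps_image[OF inj] image_filter by (simp add: card_image)
qed

definition flip_level :: "nat \<Rightarrow> nat \<times> nat \<Rightarrow> nat \<times> nat" where
  "flip_level N = (\<lambda>(l, i). (N - l, i))"

lemma flip_stack_arcs:
  shows "stack_arcs (dflip e) (dflip d) = image (flip_level 2) ` stack_arcs d e"
    and "x \<in> \<Union>(stack_arcs d e) \<Longrightarrow> flip_level 2 (flip_level 2 x) = x"
    and "flip_level 2 (outer p) = outer (flip p)"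
proof -
  have g: "flip_level 2 (upper p) = lower (flip p)" "flip_level 2 (lower p) = upper (flip p)" for p by (cases p; simp add: flip_level_def)+
  show "stack_arcs (dflip e) (dflip d) = image (flip_level 2) ` stack_arcs d e"
    by (simp only: stack_arcs_def dflip_def diagram.sel image_Un image_image g Un_commute)
  show "flip_level 2 (flip_level 2 x) = x" if "x \<in> \<Union>(stack_arcs d e)"
    using that subsetD[OF stack_levels, of x] by (cases x) (auto simp: flip_level_def)
  show "flip_level 2 (outer p) = outer (flip p)" by (cases p) (auto simp: flip_level_def)
qed

lemma dflip_dcomp: "dflip (dcomp d e) = dcomp (dflip e) (dflip d)"
  using flip_comps[where g = "flip_level 2" and out = outer and S = "stack_arcs d e", OF flip_stack_arcs(2,3)]
  by (simp add: dcomp_def dflip_def[of "Diagram _ _ _"] stack_components_eq flip_stack_arcs(1))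

lemma loops_dflip: "loops (dflip e) (dflip d) = loops d e"
  using card_flip_comps[where g = "flip_level 2" and out = outer and S = "stack_arcs d e", OF flip_stack_arcs(2,3)]
  by (simp add: loops_def stack_components_eq flip_stack_arcs(1))

lemma flip_stack3_arcs:
  shows "stack3_arcs (dflip f) (dflip e) (dflip d) = image (flip_level 3) ` stack3_arcs d e f"
    and "x \<in> \<Union>(stack3_arcs d e f) \<Longrightarrow> flip_level 3 (flip_level 3 x) = x"
    and "flip_level 3 (outer3 p) = outer3 (flip p)"
proof -
  have g: "flip_level 3 (upper p) = lower3 (flip p)" "flip_level 3 (lower p) = lower (flip p)" "flip_level 3 (lower3 p) = upper (flip p)" for p
    by (cases p; simp add: flip_level_def)+
  show "stack3_arcs (dflip f) (dflip e) (dflip d) = image (flip_level 3) ` stack3_arcs d e f"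
    by (simp only: stack3_arcs_def dflip_def diagram.sel image_Un image_image g Un_ac)
  have "fst (upper p) \<le> 3" "fst (lower p) \<le> 3" "fst (lower3 p) \<le> 3" for p by (cases p; simp)+
  then have "fst x \<le> 3" if "x \<in> \<Union>(stack3_arcs d e f)" using that unfolding stack3_arcs_def by blast
  then show "flip_level 3 (flip_level 3 x) = x" if "x \<in> \<Union>(stack3_arcs d e f)" using that by (cases x) (auto simp: flip_level_def)
  show "flip_level 3 (outer3 p) = outer3 (flip p)" by (cases p) (auto simp: flip_level_def)
qed

text \<open>Reflection reverses the order of composition and so turns the right bracketing into a
  left one; both are then computed from a stack of three diagrams and its mirror image.\<close>

lemma dcomp_assoc: "dcomp (dcomp d e) f = dcomp d (dcomp e f)"
proof -
  have "arcs (dflip (dcomp d (dcomp e f))) = image flip ` arcs (dcomp (dcomp d e) f)"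
    unfolding dflip_dcomp dcomp_stack3(1) flip_stack3_arcs(1)
    by (rule flip_comps[where g = "flip_level 3" and out = outer3, OF flip_stack3_arcs(2,3)])
  also have "\<dots> = arcs (dflip (dcomp (dcomp d e) f))" by (simp add: dflip_def)
  finally have "dflip (dcomp d (dcomp e f)) = dflip (dcomp (dcomp d e) f)"
    by (intro diagram.expand) simp
  then show ?thesis by (metis dflip_dflip)
qed

text \<open>Ensures that both bracketings carry the same power of the loop value. Finiteness enters
  because loops are counted with \<open>card\<close>.\<close>

lemma loops_assoc:
  assumes "finite (arcs d)" "finite (arcs e)" "finite (arcs f)"
  shows "loops d e + loops (dcomp d e) f = loops e f + loops d (dcomp e f)"
proof -
  have fin: "finite (arcs (dflip d))" "finite (arcs (dflip e))" "finite (arcs (dflip f))"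
    using assms by (simp_all add: dflip_def)
  have "loops e f + loops d (dcomp e f) = loops (dflip f) (dflip e) + loops (dcomp (dflip f) (dflip e)) (dflip d)"
    by (simp add: loops_dflip dflip_dcomp[symmetric])
  also have "\<dots> = loops d e + loops (dcomp d e) f"
    using card_flip_comps[where g = "flip_level 3" and out = outer3 and S = "stack3_arcs d e f", OF flip_stack3_arcs(2,3)] fin assms
    by (simp add: dcomp_stack3(2) flip_stack3_arcs(1) vimage_empty_iff_range)
  finally show ?thesis ..
qed

section \<open>Tensor products of diagrams and the interchange law\<close>

lemma dtensor_assoc: "dtensor (dtensor d e) f = dtensor d (dtensor e f)"
proof -
  have "shift m n (shift m' n' p) = shift (m + m') (n + n') p" for m n m' n' p
    by (cases p) auto
  then show ?thesis by (simp add: dtensor_def image_Un image_image Un_assoc add.assoc)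
qed

lemma dtensor_did0_left [simp]: "dtensor (did 0) d = d"
proof -
  have "shift 0 0 p = p" for p by (cases p) auto
  then show ?thesis by (cases d) (simp add: dtensor_def did_def)
qed

lemma dtensor_did0_right [simp]: "dtensor d (did 0) = d"
  by (cases d) (simp add: dtensor_def did_def)

lemma dflip_dtensor: "dflip (dtensor d e) = dtensor (dflip d) (dflip e)"
proof -
  have "flip (shift m n p) = shift n m (flip p)" for m n p by (cases p) auto
  then show ?thesis by (simp add: dtensor_def dflip_def image_Un image_image)
qed

lemma dflip_did [simp]: "dflip (did n) = did n"
  by (simp add: dflip_def did_def image_image Collect_less_image insert_commute)

lemma dflip_dcup [simp]: "dflip (dcup n) = dcap n"
  by (simp add: dflip_def dcup_def dcap_def image_image Collect_less_image)

lemma dflip_dcap [simp]: "dflip (dcap n) = dcup n"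
  by (metis dflip_dcup dflip_dflip)

text \<open>Keeps the endpoints of a left factor clear of those of the shifted right factor.\<close>

definition in_range :: "diagram \<Rightarrow> bool" where
  "in_range d \<longleftrightarrow> \<Union>(arcs d) \<subseteq> points (dtop d) (dbot d)"

text \<open>Two stacks drawn side by side do not touch, so their components are collected
  separately. The shift \<open>g\<close> depends on the level because the left stack may have a
  different width on each of its three lines.\<close>

lemma interchange_stack:
  assumes d1: "in_range d1" and e1: "in_range e1" and m: "dbot d1 = dtop e1"
  defines "g \<equiv> (\<lambda>(l, i). (l, (if l = 0 then dtop d1 else if l = 1 then dbot d1 else dbot e1) + i)) :: nat \<times> nat \<Rightarrow> nat \<times> nat"
  shows "stack_components (dtensor d1 d2) (dtensor e1 e2) = stack_components d1 e1 \<union> image g ` stack_components d2 e2"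
    and "stack_components d1 e1 \<inter> image g ` stack_components d2 e2 = {}"
    and "inj_on (image g) Q"
    and "outer -` (g ` C) = shift (dtop d1) (dbot e1) ` (outer -` C)"
proof -
  have g: "g (upper p) = upper (shift (dtop d1) (dbot d1) p)" "g (lower p) = lower (shift (dtop e1) (dbot e1) p)"
     "g (outer p) = outer (shift (dtop d1) (dbot e1) p)" for p
    using m by (cases p; simp add: g_def)+
  have inj: "inj_on g X" for X by (auto simp: g_def inj_on_def)
  then show "inj_on (image g) Q" using inj_on_image by (metis inj_on_subset subset_UNIV)
  let ?S = "stack_arcs d1 e1" and ?T = "image g ` stack_arcs d2 e2"
  have arcs: "stack_arcs (dtensor d1 d2) (dtensor e1 e2) = ?S \<union> ?T"
    by (simp add: stack_arcs_def dtensor_def image_Un image_image g Un_ac)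
  \<comment> \<open>On each level the points of the left stack stay below its width there, and
    shifted points do not.\<close>
  let ?small = "\<lambda>x. snd x < (if fst x = 0 then dtop d1 else if fst x = 1 then dbot d1 else dbot e1)"
  have "?small (upper p)" if "p \<in> \<Union>(arcs d1)" for p
    using that d1 by (auto simp: in_range_def points_def)
  moreover have "?small (lower p)" if "p \<in> \<Union>(arcs e1)" for p
    using that e1 m by (auto simp: in_range_def points_def)
  ultimately have "?small x" if "x \<in> \<Union>?S" for x
    using that unfolding stack_arcs_def by blast
  moreover have "\<not> ?small (g x)" for x by (cases x) (simp add: g_def)
  ultimately have disj: "\<Union>?S \<inter> \<Union>?T = {}" by blast
  show eq: "stack_components (dtensor d1 d2) (dtensor e1 e2) = stack_components d1 e1 \<union> image g ` stack_components d2 e2"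
    unfolding stack_components_eq arcs comps_Un[OF disj] comps_image[OF inj] ..
  have "C \<noteq> D" if "C \<in> comps ?S" "D \<in> comps ?T" for C D
    using comps_subset that disj comps_nonempty by (metis Int_absorb Int_mono subset_empty)
  then show "stack_components d1 e1 \<inter> image g ` stack_components d2 e2 = {}"
    unfolding stack_components_eq comps_image[OF inj, symmetric] by blast
  show "outer -` (g ` C) = shift (dtop d1) (dbot e1) ` (outer -` C)"
  proof (intro equalityI subsetI)
    fix p assume "p \<in> outer -` (g ` C)"
    then obtain x where x: "x \<in> C" "outer p = g x" by auto
    then obtain l i where li: "x = (l, i)" by (cases x)
    have "x \<in> range outer" unfolding range_outer using x(2) li by (cases p) (auto simp: g_def split: if_splits)
    then obtain q where "x = outer q" by blast
    moreover have "inj outer" by (rule injI, elim outer.elims) auto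
    ultimately show "p \<in> shift (dtop d1) (dbot e1) ` (outer -` C)" using x g(3) by (auto dest: injD)
  next
    fix p assume "p \<in> shift (dtop d1) (dbot e1) ` (outer -` C)"
    then show "p \<in> outer -` (g ` C)" using g(3) by (metis (no_types, lifting) imageE image_eqI vimageI2 vimageE)
  qed
qed

lemma dtensor_dcomp:
  assumes "in_range d1" "in_range e1" "dbot d1 = dtop e1"
  shows "dcomp (dtensor d1 d2) (dtensor e1 e2) = dtensor (dcomp d1 e1) (dcomp d2 e2)"
proof -
  note i = interchange_stack[OF assms]
  have "(\<lambda>C. outer -` C) ` stack_components (dtensor d1 d2) (dtensor e1 e2) - {{}} =
      arcs (dcomp d1 e1) \<union> image (shift (dtop d1) (dbot e1)) ` arcs (dcomp d2 e2)"
    unfolding i(1) image_Un Un_Diff image_image i(4)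
    by (simp add: dcomp_def image_image[symmetric] image_image_nonempty)
  then show ?thesis
    by (simp add: dcomp_def[of "dtensor d1 d2"] dtensor_def[of "dcomp d1 e1"])
qed

lemma loops_dtensor:
  assumes "in_range d1" "in_range e1" "dbot d1 = dtop e1"
    and fin: "finite (arcs d1)" "finite (arcs e1)" "finite (arcs d2)" "finite (arcs e2)"
  shows "loops (dtensor d1 d2) (dtensor e1 e2) = loops d1 e1 + loops d2 e2"
proof -
  note i = interchange_stack[OF assms(1-3)]
  let ?g = "\<lambda>(l, i). (l, (if l = 0 then dtop d1 else if l = 1 then dbot d1 else dbot e1) + i)"
  have "{C \<in> stack_components (dtensor d1 d2) (dtensor e1 e2). outer -` C = {}} =
    {C \<in> stack_components d1 e1. outer -` C = {}} \<union> image ?g ` {C \<in> stack_components d2 e2. outer -` C = {}}"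
    unfolding i(1) Un_iff conj_disj_distribR Collect_disj_eq image_filter
    by (simp only: i(4) image_is_empty)
  moreover have "finite (stack_components d1 e1)" "finite (stack_components d2 e2)"
    unfolding stack_components_eq using fin by (simp_all add: finite_comps finite_stack_arcs)
  moreover have "{C \<in> stack_components d1 e1. outer -` C = {}} \<inter> image ?g ` {C \<in> stack_components d2 e2. outer -` C = {}} = {}"
    using i(2)[of d2 e2] by auto
  ultimately show ?thesis
    unfolding loops_def using i(3) by (simp add: card_Un_disjoint card_image)
qed

section \<open>Innermost arcs\<close>

lemma partition_on_unique: "partition_on A P \<Longrightarrow> a \<in> P \<Longrightarrow> b \<in> P \<Longrightarrow> x \<in> a \<Longrightarrow> x \<in> b \<Longrightarrow> a = b"
  using partition_onD2[of A P] unfolding disjoint_def by blast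

lemma partition_on_subset: "partition_on A P \<Longrightarrow> a \<in> P \<Longrightarrow> a \<subseteq> A"
  using partition_onD1[of A P] by blast

lemma noncrossingD:
  "noncrossing m n P \<Longrightarrow> a \<in> P \<Longrightarrow> b \<in> P \<Longrightarrow> p \<in> a \<Longrightarrow> q \<in> a \<Longrightarrow> r \<in> b \<Longrightarrow> s \<in> b \<Longrightarrow>
    bpos m n p < bpos m n r \<Longrightarrow> bpos m n r < bpos m n q \<Longrightarrow> bpos m n q < bpos m n s \<Longrightarrow> False"
  unfolding noncrossing_def by blast

fun map_bot :: "(nat \<Rightarrow> nat) \<Rightarrow> point \<Rightarrow> point" where
  "map_bot h (Top i) = Top i"
| "map_bot h (Bot j) = Bot (h j)"

text \<open>The curve that an arc of the upper diagram becomes when strands from \<open>j\<close> to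
  \<open>h j\<close> are attached below: glued endpoints remain on level 1, their continuations lie
  on level 2.\<close>

definition extend_arc :: "(nat \<Rightarrow> nat) \<Rightarrow> point set \<Rightarrow> (nat \<times> nat) set" where
  "extend_arc h a = upper ` a \<union> {(2, h j) | j. Bot j \<in> a}"

lemma outer_extend_arc: "outer -` extend_arc h a = map_bot h ` a"
proof (rule set_eqI)
  fix p
  show "p \<in> outer -` extend_arc h a \<longleftrightarrow> p \<in> map_bot h ` a"
  proof (cases p)
    case (Top i)
    have "(0, i) = upper q \<longleftrightarrow> q = Top i" "Top i = map_bot h q \<longleftrightarrow> q = Top i" for q by (cases q; auto)+
    then show ?thesis using Top by (simp add: extend_arc_def image_iff)
  next
    case (Bot k)
    have "(2, k) \<noteq> upper q" for q by (cases q) auto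
    moreover have "Bot k = map_bot h q \<longleftrightarrow> (\<exists>j. q = Bot j \<and> k = h j)" for q by (cases q) auto
    ultimately show ?thesis using Bot by (auto simp add: extend_arc_def image_iff)
  qed
qed

text \<open>Each strand prolongs exactly one arc, and injectivity of \<open>h\<close> keeps
  different arcs from meeting on the bottom line.\<close>

lemma comps_through:
  assumes P: "partition_on (points m n) P" and h: "inj_on h {..<n}"
  shows "comps (image upper ` P \<union> (\<lambda>j. {(1, j), (2, h j)}) ` {..<n}) = extend_arc h ` P" (is "comps ?S = _")
proof (rule comps_eqI)
  fix C D x assume CD: "C \<in> extend_arc h ` P" "D \<in> extend_arc h ` P" and x: "x \<in> C" "x \<in> D"
  then obtain a b where a: "a \<in> P" "C = extend_arc h a" and b: "b \<in> P" "D = extend_arc h b" by blast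
  have up: "p = q" if "upper p = upper q" for p q using that by (cases p; cases q) auto
  have no: "upper p \<noteq> (2, k)" for p k by (cases p) auto
  have bot: "j < n" if "c \<in> P" "Bot j \<in> c" for c j
    using partition_on_subset[OF P that(1)] that(2) by (auto simp: points_def)
  show "C = D"
  proof (cases "fst x = 2")
    case True
    then obtain k where k: "x = (2, k)" by (cases x) auto
    obtain j where j: "Bot j \<in> a" "k = h j" using x a k no by (auto simp: extend_arc_def) metis
    obtain j' where j': "Bot j' \<in> b" "k = h j'" using x b k no by (auto simp: extend_arc_def) metis
    have "j = j'" using inj_onD[OF h, of j j'] bot a b j j' by simp
    then show ?thesis using partition_on_unique[OF P a(1) b(1)] j j' a b by metis
  next
    case False
    then have "x \<in> upper ` a" "x \<in> upper ` b" using x a(2) b(2) by (auto simp: extend_arc_def)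
    then obtain p q where "p \<in> a" "x = upper p" "q \<in> b" "x = upper q" by blast
    then show ?thesis using partition_on_unique[OF P a(1) b(1), of p] up a b by metis
  qed
next
  fix s assume s: "s \<in> ?S" "s \<noteq> {}"
  show "\<exists>C\<in>extend_arc h ` P. s \<subseteq> C"
  proof (cases "s \<in> image upper ` P")
    case True
    then show ?thesis by (auto simp: extend_arc_def)
  next
    case False
    then obtain j where j: "j < n" "s = {(1, j), (2, h j)}" using s by auto
    then have "Bot j \<in> points m n" by (simp add: points_def)
    then obtain a where a: "a \<in> P" "Bot j \<in> a" using partition_onD1[OF P] by blast
    have "upper (Bot j) \<in> upper ` a" using a by (rule_tac imageI)
    then have "s \<subseteq> extend_arc h a" using a j by (auto simp: extend_arc_def)
    then show ?thesis using a by blast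
  qed
next
  show "{} \<notin> extend_arc h ` P" using partition_onD3[OF P] by (auto simp: extend_arc_def)
next
  fix C x y assume "C \<in> extend_arc h ` P" and xy: "x \<in> C" "y \<in> C"
  then obtain a where a: "a \<in> P" "C = extend_arc h a" by blast
  have near: "\<exists>p\<in>a. (z, upper p) \<in> conn ?S" if z: "z \<in> C" for z
  proof (cases "z \<in> upper ` a")
    case True
    then obtain p where p: "p \<in> a" "z = upper p" by blast
    have "(z, upper p) \<in> conn ?S" by (rule conn_arc[of "upper ` a"]) (use a p in auto)
    then show ?thesis using p by blast
  next
    case False
    then obtain j where j: "Bot j \<in> a" "z = (2, h j)" using z a by (auto simp: extend_arc_def)
    then have "j < n" using partition_on_subset[OF P a(1)] by (auto simp: points_def)
    then have "(z, upper (Bot j)) \<in> conn ?S" by (intro conn_arc[of "{(1, j), (2, h j)}"]) (use j in auto)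
    then show ?thesis using j by blast
  qed
  obtain p q where pq: "p \<in> a" "q \<in> a" "(x, upper p) \<in> conn ?S" and y: "(y, upper q) \<in> conn ?S" using near[OF xy(1)] near[OF xy(2)] by blast
  have "(upper p, upper q) \<in> conn ?S" by (rule conn_arc[of "upper ` a"]) (use a pq in auto)
  then show "(x, y) \<in> conn ?S" by (rule conn_trans[OF pq(3) conn_trans[OF _ conn_sym[OF y]]])
qed

lemma comps_disjoint_family:
  assumes "disjoint U" "{} \<notin> U"
  shows "comps U = U"
proof (rule comps_eqI)
  fix C D x assume "C \<in> U" "D \<in> U" "x \<in> C" "x \<in> D"
  then show "C = D" using assms(1) unfolding disjoint_def by blast
next
  fix C x y assume "C \<in> U" "x \<in> C" "y \<in> C"
  then show "(x, y) \<in> conn U" by (rule conn_arc)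
qed (use assms in blast)+

text \<open>The lower diagram consists of strands and of arcs \<open>U\<close> along its bottom
  line, so no curve turns back upwards and no loop can close. With \<open>h\<close> the identity
  this gives the unit law, with \<open>skip2\<close> the insertion of a cup.\<close>

lemma
  assumes P: "partition_on (points m n) (arcs d)" and n: "dbot d = n"
    and e: "arcs e = (\<lambda>j. {Top j, Bot (h j)}) ` {..<n} \<union> U"
    and h: "inj_on h {..<n}"
    and U: "disjoint U" "{} \<notin> U" "\<Union>U \<subseteq> range Bot" "\<Union>U \<inter> (\<lambda>j. Bot (h j)) ` {..<n} = {}"
  shows dcomp_through: "dcomp d e = Diagram (dtop d) (dbot e) (image (map_bot h) ` arcs d \<union> U)"
    and loops_through: "loops d e = 0"
proof -
  let ?S = "image upper ` arcs d \<union> (\<lambda>j. {(1, j), (2, h j)}) ` {..<n}"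
  let ?T = "image lower ` U"
  have split: "stack_arcs d e = ?S \<union> ?T"
    unfolding stack_arcs_def e image_Un image_image by (simp add: Un_assoc)
  have "\<Union>?S \<subseteq> {x. fst x < 2} \<union> (\<lambda>j. (2, h j)) ` {..<n}"
  proof -
    have "fst (upper p) < 2" for p by (cases p) auto
    then show ?thesis by auto
  qed
  moreover have "x \<notin> {x. fst x < 2} \<union> (\<lambda>j. (2, h j)) ` {..<n}" if x: "x \<in> \<Union>?T" for x
  proof -
    obtain p where p: "p \<in> \<Union>U" "x = lower p" using x by blast
    then obtain k where "p = Bot k" using U(3) by blast
    then show ?thesis using U(4) p by auto
  qed
  ultimately have disj: "\<Union>?S \<inter> \<Union>?T = {}" by blast
  have inj: "inj_on lower X" for X
    by (rule inj_onI) (metis lower.simps point.exhaust prod.inject One_nat_def numeral_2_eq_2 n_not_Suc_n)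
  have "comps ?T = ?T"
    using comps_image[OF inj, of U] comps_disjoint_family[OF U(1,2)] by simp
  then have comps: "stack_components d e = extend_arc h ` arcs d \<union> image lower ` U"
    unfolding stack_components_eq split comps_Un[OF disj] comps_through[OF P h] by simp
  have out: "outer -` (lower ` u) = u" if "u \<in> U" for u
  proof (rule set_eqI)
    fix p
    show "p \<in> outer -` (lower ` u) \<longleftrightarrow> p \<in> u"
    proof (cases p)
      case (Top i)
      have "(0, i) \<noteq> lower q" for q by (cases q) auto
      moreover have "p \<notin> u" using Top U(3) that by blast
      ultimately show ?thesis using Top by auto
    next
      case (Bot k)
      have "(2, k) = lower q \<longleftrightarrow> q = Bot k" for q by (cases q) auto
      then show ?thesis using Bot by (simp add: image_iff)
    qed
  qed
  have ne: "{} \<notin> image (map_bot h) ` arcs d" "{} \<notin> U" using partition_onD3[OF P] U(2) by auto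
  have img: "(\<lambda>C. outer -` C) ` stack_components d e = image (map_bot h) ` arcs d \<union> U"
    unfolding comps image_Un image_image using out by (simp add: outer_extend_arc)
  then show "dcomp d e = Diagram (dtop d) (dbot e) (image (map_bot h) ` arcs d \<union> U)"
    unfolding dcomp_def using ne by simp
  have "outer -` C \<noteq> {}" if "C \<in> stack_components d e" for C
    using that img ne by (metis UnE imageI)
  then show "loops d e = 0" unfolding loops_def by (simp add: card_eq_0_iff)
qed

section \<open>Noncrossing matchings and their reflections\<close>

lemma tl_diagrams_iff: "d \<in> tl_diagrams m n \<longleftrightarrow> dtop d = m \<and> dbot d = n \<and>
    partition_on (points m n) (arcs d) \<and> (\<forall>a\<in>arcs d. card a = 2) \<and> noncrossing m n (arcs d)"
  by (cases d) (auto simp: tl_diagrams_def)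

lemma finite_points: "finite (points m n)"
  by (simp add: points_def)

lemma tl_diagrams_finite: "d \<in> tl_diagrams m n \<Longrightarrow> finite (arcs d)"
  using finite_elements[OF finite_points] by (auto simp: tl_diagrams_iff)

lemma tl_diagrams_in_range: "d \<in> tl_diagrams m n \<Longrightarrow> in_range d"
  using partition_onD1 by (fastforce simp: tl_diagrams_iff in_range_def)

lemma tl_diagrams_dtop: "d \<in> tl_diagrams m n \<Longrightarrow> dtop d = m"
  and tl_diagrams_dbot: "d \<in> tl_diagrams m n \<Longrightarrow> dbot d = n"
  by (simp_all add: tl_diagrams_iff)

lemma points_flip: "flip ` points m n = points n m"
  by (auto simp: points_def image_Un image_image)

lemma bpos_flip: "p \<in> points m n \<Longrightarrow> bpos n m (flip p) = m + n - 1 - bpos m n p"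
  by (auto simp: points_def)

lemma bpos_less: "p \<in> points m n \<Longrightarrow> bpos m n p < m + n"
  by (auto simp: points_def)

lemma dflip_tl: "d \<in> tl_diagrams m n \<Longrightarrow> dflip d \<in> tl_diagrams n m"
proof -
  assume d: "d \<in> tl_diagrams m n"
  then have P: "partition_on (points m n) (arcs d)" and nc: "noncrossing m n (arcs d)"
    by (simp_all add: tl_diagrams_iff)
  have ne: "{} \<notin> image flip ` arcs d" using partition_onD3[OF P] by auto
  have "partition_on (points n m) (image flip ` arcs d)"
    using partition_on_inj_image[OF P inj_flip] ne by (simp add: points_flip)
  moreover have "noncrossing n m (image flip ` arcs d)"
    unfolding noncrossing_def
  proof (intro ballI notI)
    fix a b p q r s
    assume ab: "a \<in> image flip ` arcs d" "b \<in> image flip ` arcs d" and pts: "p \<in> a" "q \<in> a" "r \<in> b" "s \<in> b"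
      and less: "bpos n m p < bpos n m r \<and> bpos n m r < bpos n m q \<and> bpos n m q < bpos n m s"
    obtain a' where a': "a' \<in> arcs d" "a = flip ` a'" using ab by blast
    obtain b' where b': "b' \<in> arcs d" "b = flip ` b'" using ab by blast
    obtain p' q' r' s' where p': "p' \<in> a'" "q' \<in> a'" "r' \<in> b'" "s' \<in> b'" "p = flip p'" "q = flip q'" "r = flip r'" "s = flip s'"
      using pts a' b' by blast
    have "p' \<in> points m n" "q' \<in> points m n" "r' \<in> points m n" "s' \<in> points m n"
      using p' partition_on_subset[OF P a'(1)] partition_on_subset[OF P b'(1)] by auto
    then have "bpos m n s' < bpos m n q'" "bpos m n q' < bpos m n r'" "bpos m n r' < bpos m n p'"
      using less p' bpos_flip bpos_less[of _ m n] by fastforce+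
    \<comment> \<open>Reflection reverses the order of traversal, so the four points alternate again
      with the roles of the two arcs exchanged.\<close>
    then show False by (rule noncrossingD[OF nc b'(1) a'(1) p'(4,3,2,1)])
  qed
  ultimately show ?thesis
    using d by (auto simp: tl_diagrams_iff dflip_def card_image inj_flip)
qed

lemma did_tl: "did n \<in> tl_diagrams n n"
proof -
  have "partition_on (points n n) (arcs (did n))"
    by (rule partition_onI) (auto simp: points_def did_def disjnt_def)
  moreover have "noncrossing n n (arcs (did n))"
    by (auto simp: noncrossing_def did_def)
  ultimately show ?thesis by (auto simp: tl_diagrams_iff) (auto simp: did_def)
qed

lemma dcomp_did_right:
  assumes "d \<in> tl_diagrams m n"
  shows "dcomp d (did n) = d" and "loops d (did n) = 0"
proof -
  have P: "partition_on (points m n) (arcs d)" "dbot d = n" using assms by (simp_all add: tl_diagrams_iff)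
  have e: "arcs (did n) = (\<lambda>j. {Top j, Bot (id j)}) ` {..<n} \<union> {}" by (auto simp: did_def)
  have "map_bot (\<lambda>j. j) p = p" for p by (cases p) auto
  then have "map_bot (\<lambda>j. j) = (\<lambda>p. p)" by blast
  then show "dcomp d (did n) = d"
    using dcomp_through[OF P e] P by (cases d) simp
  show "loops d (did n) = 0" using loops_through[OF P e] by simp
qed

lemma dcomp_did_left:
  assumes "d \<in> tl_diagrams m n"
  shows "dcomp (did m) d = d" and "loops (did m) d = 0"
proof -
  have "dflip (dcomp (did m) d) = dflip d"
    using dcomp_did_right[OF dflip_tl[OF assms]] by (simp add: dflip_dcomp)
  then show "dcomp (did m) d = d" by (metis dflip_dflip)
  show "loops (did m) d = 0"
    using dcomp_did_right(2)[OF dflip_tl[OF assms]] loops_dflip[of d "did m"] by simp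
qed

section \<open>Inserting and removing a single turn-back\<close>

definition cupd :: "nat \<Rightarrow> nat \<Rightarrow> diagram" where
  "cupd i j = dtensor (did i) (dtensor (dcup 1) (did j))"

definition capd :: "nat \<Rightarrow> nat \<Rightarrow> diagram" where
  "capd i j = dtensor (did i) (dtensor (dcap 1) (did j))"

text \<open>The increasing enumeration of the naturals other than \<open>i\<close> and
  \<open>i + 1\<close>, the places taken by a new cup.\<close>

definition skip2 :: "nat \<Rightarrow> nat \<Rightarrow> nat" where
  "skip2 i k = (if k < i then k else k + 2)"

lemma dflip_cupd [simp]: "dflip (cupd i j) = capd i j"
  and dflip_capd [simp]: "dflip (capd i j) = cupd i j"
  by (simp_all add: cupd_def capd_def dflip_dtensor del: One_nat_def)

lemma dtop_cupd [simp]: "dtop (cupd i j) = i + j"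
  and dbot_cupd [simp]: "dbot (cupd i j) = i + 2 + j"
  and dtop_capd [simp]: "dtop (capd i j) = i + 2 + j"
  and dbot_capd [simp]: "dbot (capd i j) = i + j"
  by (simp_all add: cupd_def capd_def)

lemma arcs_cupd: "arcs (cupd i j) = (\<lambda>k. {Top k, Bot (skip2 i k)}) ` {..<i + j} \<union> {{Bot i, Bot (Suc i)}}"
proof -
  have split: "{..<i + j} = {..<i} \<union> (\<lambda>k. i + k) ` {..<j}"
  proof (intro equalityI subsetI)
    fix k assume "k \<in> {..<i + j}"
    then have "k < i \<or> k = i + (k - i) \<and> k - i < j" by auto
    then show "k \<in> {..<i} \<union> (\<lambda>k. i + k) ` {..<j}" by blast
  qed auto
  have "arcs (cupd i j) = (\<lambda>k. {Top k, Bot k}) ` {..<i} \<union> {{Bot i, Bot (Suc i)}} \<union> (\<lambda>k. {Top (i + k), Bot (i + 2 + k)}) ` {..<j}"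
    by (auto simp: cupd_def dtensor_def did_def dcup_def Collect_less_image image_image image_Un)
  moreover have "(\<lambda>k. {Top k, Bot (skip2 i k)}) ` {..<i} = (\<lambda>k. {Top k, Bot k}) ` {..<i}"
    by (simp add: skip2_def)
  ultimately show ?thesis
    unfolding split image_Un image_image by (auto simp: skip2_def)
qed

lemma inj_skip2: "inj (skip2 i)"
  by (rule injI) (auto simp: skip2_def split: if_splits)

lemma inj_map_bot: "inj h \<Longrightarrow> inj (map_bot h)"
  by (rule injI, elim map_bot.elims) (auto dest: injD)

lemma skip2_ne: "skip2 i k \<noteq> i" "skip2 i k \<noteq> Suc i"
  by (auto simp: skip2_def)

lemma dcomp_cupd:
  assumes "partition_on (points m (i + j)) (arcs d)" "dbot d = i + j"
  shows "dcomp d (cupd i j) = Diagram (dtop d) (i + 2 + j) (image (map_bot (skip2 i)) ` arcs d \<union> {{Bot i, Bot (Suc i)}})"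
    and "loops d (cupd i j) = 0"
proof -
  have "inj_on (skip2 i) {..<i + j}" using inj_skip2 by (rule inj_on_subset) simp
  moreover have "\<Union>{{Bot i, Bot (Suc i)}} \<inter> (\<lambda>k. Bot (skip2 i k)) ` {..<i + j} = {}"
    using skip2_ne[of i] by fastforce
  ultimately show "dcomp d (cupd i j) = Diagram (dtop d) (i + 2 + j) (image (map_bot (skip2 i)) ` arcs d \<union> {{Bot i, Bot (Suc i)}})"
    "loops d (cupd i j) = 0"
    using dcomp_through[OF assms arcs_cupd] loops_through[OF assms arcs_cupd] by (auto simp: disjoint_def)
qed

lemma points_skip2: "points m (i + 2 + j) = map_bot (skip2 i) ` points m (i + j) \<union> {Bot i, Bot (Suc i)}"
proof -
  have "skip2 i ` {..<i + j} \<union> {i, Suc i} = {..<i + 2 + j}"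
  proof (intro equalityI subsetI)
    fix k assume "k \<in> {..<i + 2 + j}"
    then have "k = skip2 i k \<and> k < i + j \<or> k = i \<or> k = Suc i \<or> k = skip2 i (k - 2) \<and> k - 2 < i + j"
      by (auto simp: skip2_def)
    then show "k \<in> skip2 i ` {..<i + j} \<union> {i, Suc i}"
      by blast
  qed (auto simp: skip2_def split: if_splits)
  then have "Bot ` {..<i + 2 + j} = Bot ` (skip2 i ` {..<i + j} \<union> {i, Suc i})" by simp
  also have "\<dots> = (\<lambda>k. Bot (skip2 i k)) ` {..<i + j} \<union> {Bot i, Bot (Suc i)}"
    by (simp only: image_Un image_image image_insert image_empty)
  finally have "Bot ` {..<i + 2 + j} = (\<lambda>k. Bot (skip2 i k)) ` {..<i + j} \<union> {Bot i, Bot (Suc i)}" .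
  then show ?thesis by (simp add: points_def image_Un image_image Un_assoc)
qed

lemma bpos_skip2:
  assumes "p \<in> points m (i + j)" "q \<in> points m (i + j)"
  shows "bpos m (i + 2 + j) (map_bot (skip2 i) p) < bpos m (i + 2 + j) (map_bot (skip2 i) q) \<longleftrightarrow>
    bpos m (i + j) p < bpos m (i + j) q"
  using assms by (auto simp: points_def skip2_def split: if_splits; linarith)

lemma noncrossing_image:
  assumes "\<And>p q. p \<in> \<Union>P \<Longrightarrow> q \<in> \<Union>P \<Longrightarrow> bpos m' n' (f p) < bpos m' n' (f q) \<longleftrightarrow> bpos m n p < bpos m n q"
  shows "noncrossing m' n' (image f ` P) \<longleftrightarrow> noncrossing m n P"
proof -
  have "bpos m' n' (f p) < bpos m' n' (f q) \<longleftrightarrow> bpos m n p < bpos m n q"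
    if "a \<in> P" "b \<in> P" "p \<in> a" "q \<in> b" for a b p q
    using assms that by blast
  then show ?thesis
    unfolding noncrossing_def ball_simps(9) by (intro ball_cong refl arg_cong[of _ _ Not] conj_cong) blast+
qed

text \<open>In a crossing, the ends of each arc are separated by an end of the other; no boundary
  position separates two neighbouring ones.\<close>

lemma noncrossing_adjacent:
  assumes adj: "bpos m n x = Suc (bpos m n y)"
  shows "noncrossing m n (P \<union> {{x, y}}) \<longleftrightarrow> noncrossing m n P"
proof
  assume nc: "noncrossing m n P"
  show "noncrossing m n (P \<union> {{x, y}})"
    unfolding noncrossing_def
  proof (intro ballI notI)
    fix a b p q r s
    assume ab: "a \<in> P \<union> {{x, y}}" "b \<in> P \<union> {{x, y}}" and pts: "p \<in> a" "q \<in> a" "r \<in> b" "s \<in> b"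
      and less: "bpos m n p < bpos m n r \<and> bpos m n r < bpos m n q \<and> bpos m n q < bpos m n s"
    have "a \<noteq> {x, y}" using less adj pts(1,2) by auto
    moreover have "b \<noteq> {x, y}" using less adj pts(3,4) by auto
    ultimately show False using ab less noncrossingD[OF nc _ _ pts] by blast
  qed
next
  assume nc: "noncrossing m n (P \<union> {{x, y}})"
  show "noncrossing m n P"
    unfolding noncrossing_def by (intro ballI notI) (use noncrossingD[OF nc UnI1 UnI1] in blast)
qed

text \<open>An equivalence, so that it serves both for adding a cup to a diagram and for stripping
  an innermost arc off one in \<open>remove_cup\<close>.\<close>

lemma insert_cup_tl:
  assumes PP: "P' = image (map_bot (skip2 i)) ` P \<union> {{Bot i, Bot (Suc i)}}"
    and sub: "\<Union>P \<subseteq> points m (i + j)"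
  shows "Diagram m (i + 2 + j) P' \<in> tl_diagrams m (i + 2 + j) \<longleftrightarrow> Diagram m (i + j) P \<in> tl_diagrams m (i + j)"
proof -
  let ?f = "map_bot (skip2 i)" and ?c = "{Bot i, Bot (Suc i)}" and ?n = "i + 2 + j"
  have inj: "inj_on ?f X" for X using inj_map_bot[OF inj_skip2] by (rule inj_on_subset) simp
  have f_new: "?f p \<notin> ?c" for p using skip2_ne[of i] by (cases p) auto
  have disj: "?c \<inter> ?f ` X = {}" for X
  proof (rule equals0I)
    fix x assume x: "x \<in> ?c \<inter> ?f ` X"
    then obtain p where "x = ?f p" by blast
    then show False using f_new[of p] x by (metis IntD1)
  qed
  then have disj': "?c \<inter> \<Union>(image ?f ` P) = {}" by (metis image_Union)
  have Q: "points m ?n - ?c = ?f ` points m (i + j)"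
    unfolding points_skip2 using disj[of "points m (i + j)"] by blast
  have "partition_on (points m ?n) P' \<longleftrightarrow> partition_on (?f ` points m (i + j)) (image ?f ` P)"
  proof -
    have "disjnt ?c (\<Union>(image ?f ` P))" unfolding disjnt_def by (rule disj')
    moreover have "?c \<subseteq> points m ?n" unfolding points_skip2 by (rule Un_upper2)
    ultimately show ?thesis
      unfolding PP Un_insert_right Un_empty_right using Q by (simp only: partition_on_insert) simp
  qed
  also have "\<dots> \<longleftrightarrow> partition_on (points m (i + j)) P"
  proof
    assume *: "partition_on (points m (i + j)) P"
    then have "{} \<notin> image ?f ` P" using partition_onD3 by auto
    then show "partition_on (?f ` points m (i + j)) (image ?f ` P)"
      using partition_on_inj_image[OF * inj] by simp
  next
    assume *: "partition_on (?f ` points m (i + j)) (image ?f ` P)"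
    have "?f ` \<Union>P = ?f ` points m (i + j)" using partition_onD1[OF *] by (simp only: image_Union)
    then have "\<Union>P = points m (i + j)" by (simp only: inj_image_eq_iff[OF inj])
    moreover have "disjnt a b" if "a \<in> P" "b \<in> P" "a \<noteq> b" for a b
    proof -
      have "?f ` a \<noteq> ?f ` b" using that by (simp only: inj_image_eq_iff[OF inj] not_False_eq_True)
      then have "disjnt (?f ` a) (?f ` b)" using partition_onD2[OF *] that unfolding disjoint_def disjnt_def by blast
      then show ?thesis unfolding disjnt_def by blast
    qed
    moreover have "{} \<notin> P" using partition_onD3[OF *] by blast
    ultimately show "partition_on (points m (i + j)) P" by (intro partition_onI)
  qed
  finally have part: "partition_on (points m ?n) P' \<longleftrightarrow> partition_on (points m (i + j)) P" .
  have card: "(\<forall>a\<in>P'. card a = 2) \<longleftrightarrow> (\<forall>a\<in>P. card a = 2)"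
    unfolding PP by (auto simp: card_image[OF inj])
  have "bpos m ?n (?f p) < bpos m ?n (?f q) \<longleftrightarrow> bpos m (i + j) p < bpos m (i + j) q"
    if "p \<in> \<Union>P" "q \<in> \<Union>P" for p q
    using bpos_skip2 sub that by blast
  then have "noncrossing m ?n (image ?f ` P) \<longleftrightarrow> noncrossing m (i + j) P" by (rule noncrossing_image)
  \<comment> \<open>The bottom line is traversed from right to left, so the left end of the cup
    comes directly after its right end.\<close>
  moreover have "bpos m ?n (Bot i) = Suc (bpos m ?n (Bot (Suc i)))" by simp
  ultimately have nc: "noncrossing m ?n P' \<longleftrightarrow> noncrossing m (i + j) P"
    unfolding PP by (simp only: noncrossing_adjacent)
  show ?thesis unfolding tl_diagrams_iff diagram.sel part card nc by simp
qed

lemma dcomp_cupd_tl: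
  assumes "d \<in> tl_diagrams m (i + j)"
  shows "dcomp d (cupd i j) \<in> tl_diagrams m (i + 2 + j)" and "loops d (cupd i j) = 0"
proof -
  have P: "partition_on (points m (i + j)) (arcs d)" "dbot d = i + j" "dtop d = m"
    using assms by (simp_all add: tl_diagrams_iff)
  have "Diagram m (i + j) (arcs d) \<in> tl_diagrams m (i + j)" using assms P by (cases d) simp
  then show "dcomp d (cupd i j) \<in> tl_diagrams m (i + 2 + j)"
    unfolding dcomp_cupd[OF P(1,2)] P(3)
    by (subst insert_cup_tl[OF refl]) (use partition_onD1[OF P(1)] in auto)
  show "loops d (cupd i j) = 0" by (rule dcomp_cupd(2)[OF P(1,2)])
qed

lemma dcomp_capd_tl:
  assumes "d \<in> tl_diagrams (i + j) n"
  shows "dcomp (capd i j) d \<in> tl_diagrams (i + 2 + j) n" and "loops (capd i j) d = 0"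
proof -
  have "dflip (dcomp (dflip d) (cupd i j)) \<in> tl_diagrams (i + 2 + j) n"
    using dcomp_cupd_tl dflip_tl assms by blast
  then show "dcomp (capd i j) d \<in> tl_diagrams (i + 2 + j) n" by (simp add: dflip_dcomp)
  show "loops (capd i j) d = 0"
    using dcomp_cupd_tl(2)[OF dflip_tl[OF assms]] loops_dflip[of d "capd i j"] by simp
qed

lemma remove_cup:
  assumes d: "d \<in> tl_diagrams m n" and c: "{Bot i, Bot (Suc i)} \<in> arcs d"
  obtains j d' where "n = i + 2 + j" "d' \<in> tl_diagrams m (i + j)" "d = dcomp d' (cupd i j)"
proof -
  let ?f = "map_bot (skip2 i)" and ?c = "{Bot i, Bot (Suc i)}"
  have P: "partition_on (points m n) (arcs d)" and dims: "dtop d = m" "dbot d = n" using d by (simp_all add: tl_diagrams_iff)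
  have "Bot (Suc i) \<in> points m n" using partition_on_subset[OF P c] by simp
  then have "Suc i < n" by (auto simp: points_def)
  then obtain j where n: "n = i + 2 + j" by (metis Suc_leI add_2_eq_Suc' le_Suc_ex)
  \<comment> \<open>Preimages under the renumbering close the gap; nothing is lost, since the other
    arcs avoid the ends of the removed one.\<close>
  define Q where "Q = (\<lambda>a. ?f -` a) ` (arcs d - {?c})"
  have inj: "inj ?f" by (rule inj_map_bot[OF inj_skip2])
  have sub: "a \<subseteq> ?f ` points m (i + j)" if "a \<in> arcs d" "a \<noteq> ?c" for a
  proof
    fix x assume x: "x \<in> a"
    then have "x \<notin> ?c" using partition_on_unique[OF P c that(1)] that(2) by metis
    moreover have "x \<in> points m (i + 2 + j)" using partition_on_subset[OF P that(1)] x n by auto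
    ultimately show "x \<in> ?f ` points m (i + j)" unfolding points_skip2 by blast
  qed
  then have "?f ` (?f -` a) = a" if "a \<in> arcs d" "a \<noteq> ?c" for a
    using that by (intro image_vimage_eq[THEN trans]) blast
  then have "image ?f ` Q = arcs d - {?c}" unfolding Q_def image_image by auto
  then have arcs: "arcs d = image ?f ` Q \<union> {?c}" using c by blast
  have Qsub: "\<Union>Q \<subseteq> points m (i + j)"
  proof
    fix x assume "x \<in> \<Union>Q"
    then obtain a where "a \<in> arcs d" "a \<noteq> ?c" "?f x \<in> a" unfolding Q_def by blast
    then have "?f x \<in> ?f ` points m (i + j)" using sub by blast
    then show "x \<in> points m (i + j)" using inj_image_mem_iff[OF inj] by simp
  qed
  have "Diagram m (i + 2 + j) (arcs d) \<in> tl_diagrams m (i + 2 + j)" using d dims n by (cases d) simp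
  then have d': "Diagram m (i + j) Q \<in> tl_diagrams m (i + j)" using insert_cup_tl[OF arcs Qsub] by simp
  then have "partition_on (points m (i + j)) (arcs (Diagram m (i + j) Q))" by (simp add: tl_diagrams_iff)
  then have "d = dcomp (Diagram m (i + j) Q) (cupd i j)"
    using dcomp_cupd(1)[of m i j "Diagram m (i + j) Q"] arcs dims n by (cases d) simp
  then show ?thesis using that n d' by blast
qed

lemma remove_cap:
  assumes d: "d \<in> tl_diagrams m n" and c: "{Top i, Top (Suc i)} \<in> arcs d"
  obtains j d' where "m = i + 2 + j" "d' \<in> tl_diagrams (i + j) n" "d = dcomp (capd i j) d'"
proof -
  have "flip ` {Top i, Top (Suc i)} \<in> arcs (dflip d)" unfolding dflip_def diagram.sel by (intro imageI c)
  then have "{Bot i, Bot (Suc i)} \<in> arcs (dflip d)" by simp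
  then obtain j d' where "m = i + 2 + j" and d': "d' \<in> tl_diagrams n (i + j)" "dflip d = dcomp d' (cupd i j)"
    using remove_cup[OF dflip_tl[OF d]] by metis
  moreover have "d = dcomp (capd i j) (dflip d')" using d'(2) by (metis dflip_cupd dflip_dcomp dflip_dflip)
  ultimately show ?thesis using that dflip_tl by blast
qed

text \<open>Descent on the width: the arc from the point next to \<open>i\<close> cannot cross the
  given one, so its other end lies strictly between \<open>i\<close> and \<open>k\<close> and it is
  narrower.\<close>

lemma adjacent_cap:
  assumes d: "d \<in> tl_diagrams m n"
  shows "{Top i, Top k} \<in> arcs d \<Longrightarrow> i < k \<Longrightarrow> \<exists>i. {Top i, Top (Suc i)} \<in> arcs d"
proof (induction "k - i" arbitrary: i k rule: less_induct)
  case less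
  have P: "partition_on (points m n) (arcs d)" and nc: "noncrossing m n (arcs d)"
    and two: "\<forall>a\<in>arcs d. card a = 2"
    using d by (simp_all add: tl_diagrams_iff)
  let ?a = "{Top i, Top k}"
  have km: "k < m" using partition_on_subset[OF P less.prems(1)] by (auto simp: points_def)
  show ?case
  proof (cases "k = Suc i")
    case True
    then show ?thesis using less.prems by blast
  next
    case False
    then have k: "Suc i < k" using less.prems(2) by simp
    have "Top (Suc i) \<in> points m n" using k km by (auto simp: points_def)
    then obtain b where b: "b \<in> arcs d" "Top (Suc i) \<in> b" using partition_onD1[OF P] by blast
    have "card b = 2" using two b by blast
    then obtain s where s: "b = {Top (Suc i), s}" "s \<noteq> Top (Suc i)"
      using b(2) by (metis card_2_iff doubleton_eq_iff insertE singletonD)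
    have "Top (Suc i) \<notin> ?a" using k by auto
    then have "s \<notin> ?a" using partition_on_unique[OF P b(1) less.prems(1), of s] s b(2) by blast
    moreover have "s \<in> points m n" using partition_on_subset[OF P b(1)] s by auto
    moreover have "\<not> bpos m n s < i"
      using noncrossingD[OF nc b(1) less.prems(1), of s "Top (Suc i)" "Top i" "Top k"] s k by auto
    moreover have "\<not> k < bpos m n s"
      using noncrossingD[OF nc less.prems(1) b(1), of "Top i" "Top k" "Top (Suc i)" s] s k by auto
    ultimately obtain k' where k': "s = Top k'" "Suc i < k'" "k' < k"
      using s(2) km by (cases s) (auto simp: points_def)
    have "{Top (Suc i), Top k'} \<in> arcs d" using b(1) s(1) k' by simp
    moreover have "k' - Suc i < k - i" using k' by simp
    ultimately show ?thesis using less.hyps k'(2) by blast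
  qed
qed

lemma adjacent_cup:
  assumes d: "d \<in> tl_diagrams m n" and c: "{Bot i, Bot k} \<in> arcs d" "i < k"
  shows "\<exists>i. {Bot i, Bot (Suc i)} \<in> arcs d"
proof -
  have "flip ` {Bot i, Bot k} \<in> arcs (dflip d)" unfolding dflip_def diagram.sel by (intro imageI c)
  then have "{Top i, Top k} \<in> arcs (dflip d)" by simp
  then obtain i' where "{Top i', Top (Suc i')} \<in> arcs (dflip d)" using adjacent_cap[OF dflip_tl[OF d]] c(2) by blast
  then have "flip ` {Top i', Top (Suc i')} \<in> arcs (dflip (dflip d))"
    unfolding dflip_def[of "dflip d"] diagram.sel by (rule imageI)
  then show ?thesis by auto
qed

lemma bij_strict_mono_id:
  fixes \<sigma> :: "nat \<Rightarrow> nat"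
  assumes mono: "\<And>i k. i < k \<Longrightarrow> k < n \<Longrightarrow> \<sigma> i < \<sigma> k" and surj: "\<sigma> ` {..<n} = {..<n}"
  shows "i < n \<Longrightarrow> \<sigma> i = i"
proof (induction i rule: less_induct)
  case (less i)
  obtain k where k: "k < n" "\<sigma> k = i" using surj less.prems by (metis imageE lessThan_iff)
  have "\<not> k < i" using less.IH[of k] k by auto
  moreover have "\<not> i < k"
  proof
    assume "i < k"
    then have lt: "\<sigma> i < i" using mono[of i k] k by simp
    moreover have "\<sigma> i < n" using lt less.prems by simp
    ultimately have "\<sigma> (\<sigma> i) = \<sigma> i" using less.IH by blast
    then show False using mono[OF lt less.prems] by simp
  qed
  ultimately show ?case using k by auto
qed

text \<open>As the bottom line is traversed backwards, through strands that do not cross preserve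
  the left-to-right order, and an order-preserving bijection of initial segments is the
  identity.\<close>

lemma through_diagram_id:
  assumes d: "d \<in> tl_diagrams m n"
    and through: "\<And>a. a \<in> arcs d \<Longrightarrow> \<exists>i j. a = {Top i, Bot j}"
  shows "m = n \<and> d = did n"
proof -
  have P: "partition_on (points m n) (arcs d)" and nc: "noncrossing m n (arcs d)" and dims: "dtop d = m" "dbot d = n"
    using d by (simp_all add: tl_diagrams_iff)
  have bound: "i < m \<and> j < n" if "{Top i, Bot j} \<in> arcs d" for i j
    using partition_on_subset[OF P that] by (auto simp: points_def)
  have "\<exists>j. {Top i, Bot j} \<in> arcs d" if i: "i < m" for i
  proof -
    have "Top i \<in> points m n" using i by (simp add: points_def)
    then obtain a where a: "a \<in> arcs d" "Top i \<in> a" using partition_onD1[OF P] by blast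
    then show ?thesis using through[OF a(1)] by auto
  qed
  then obtain \<sigma> where \<sigma>: "{Top i, Bot (\<sigma> i)} \<in> arcs d" if "i < m" for i by metis
  have mono: "\<sigma> i < \<sigma> k" if ik: "i < k" "k < m" for i k
  proof (rule ccontr)
    assume "\<not> \<sigma> i < \<sigma> k"
    have arcs: "{Top i, Bot (\<sigma> i)} \<in> arcs d" "{Top k, Bot (\<sigma> k)} \<in> arcs d" using \<sigma> ik by auto
    have "\<sigma> i \<noteq> \<sigma> k"
    proof
      assume "\<sigma> i = \<sigma> k"
      then have "{Top i, Bot (\<sigma> i)} = {Top k, Bot (\<sigma> k)}"
        using partition_on_unique[OF P arcs, of "Bot (\<sigma> i)"] by simp
      then show False using ik by (auto simp: doubleton_eq_iff)
    qed
    then have "\<sigma> k < \<sigma> i" using \<open>\<not> \<sigma> i < \<sigma> k\<close> by simp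
    moreover have "\<sigma> i < n" using bound[OF arcs(1)] by simp
    ultimately have "bpos m n (Top i) < bpos m n (Top k)" "bpos m n (Top k) < bpos m n (Bot (\<sigma> i))"
      "bpos m n (Bot (\<sigma> i)) < bpos m n (Bot (\<sigma> k))"
      using ik by auto
    then show False
      using noncrossingD[OF nc arcs, of "Top i" "Bot (\<sigma> i)" "Top k" "Bot (\<sigma> k)"] by blast
  qed
  have inj: "inj_on \<sigma> {..<m}"
    by (rule inj_onI) (metis lessThan_iff linorder_neqE_nat mono nat_neq_iff)
  have img: "\<sigma> ` {..<m} = {..<n}"
  proof (intro equalityI subsetI)
    fix j assume "j \<in> \<sigma> ` {..<m}"
    then show "j \<in> {..<n}" using bound \<sigma> by fastforce
  next
    fix j assume "j \<in> {..<n}"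
    then have "Bot j \<in> points m n" by (simp add: points_def)
    then obtain a where a: "a \<in> arcs d" "Bot j \<in> a" using partition_onD1[OF P] by blast
    then obtain i where i: "{Top i, Bot j} \<in> arcs d" using through[OF a(1)] by auto
    then have im: "i < m" using bound by blast
    then have "{Top i, Bot j} = {Top i, Bot (\<sigma> i)}"
      using partition_on_unique[OF P i \<sigma>[OF im], of "Top i"] by simp
    then have "j = \<sigma> i" by (auto simp: doubleton_eq_iff)
    then show "j \<in> \<sigma> ` {..<m}" using im by blast
  qed
  have mn: "m = n" using card_image[OF inj] img by simp
  then have id: "\<sigma> i = i" if "i < n" for i using bij_strict_mono_id[of n \<sigma>] mono img that by simp
  have "arcs d = {{Top i, Bot i} | i. i < n}"
  proof (intro equalityI subsetI)
    fix a assume a: "a \<in> arcs d"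
    then obtain i j where ij: "a = {Top i, Bot j}" using through by blast
    then have i: "i < m" using bound a by blast
    then have "a = {Top i, Bot (\<sigma> i)}"
      using partition_on_unique[OF P a \<sigma>[OF i], of "Top i"] ij by simp
    then show "a \<in> {{Top i, Bot i} | i. i < n}" using id i mn by auto
  next
    fix a assume "a \<in> {{Top i, Bot i} | i. i < n}"
    then show "a \<in> arcs d" using \<sigma> id mn by force
  qed
  then show ?thesis using mn dims by (cases d) (simp add: did_def)
qed

text \<open>A noncrossing matching without an innermost arc on the top or the bottom line is the identity.\<close>

lemma tl_diagrams_induct [consumes 1, case_names id cap cup]:
  assumes "d \<in> tl_diagrams m n"
    and id: "\<And>n. Q n n (did n)"
    and cap: "\<And>i j n d. d \<in> tl_diagrams (i + j) n \<Longrightarrow> Q (i + j) n d \<Longrightarrow> Q (i + 2 + j) n (dcomp (capd i j) d)"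
    and cup: "\<And>m i j d. d \<in> tl_diagrams m (i + j) \<Longrightarrow> Q m (i + j) d \<Longrightarrow> Q m (i + 2 + j) (dcomp d (cupd i j))"
  shows "Q m n d"
  using assms(1)
proof (induction "m + n" arbitrary: m n d rule: less_induct)
  case less
  note d = \<open>d \<in> tl_diagrams m n\<close>
  consider (cap) i where "{Top i, Top (Suc i)} \<in> arcs d" | (cup) i where "{Bot i, Bot (Suc i)} \<in> arcs d"
    | (through) "\<And>a. a \<in> arcs d \<Longrightarrow> \<exists>i j. a = {Top i, Bot j}"
  proof -
    have "\<exists>i j. a = {Top i, Bot j}"
      if no: "\<nexists>i. {Top i, Top (Suc i)} \<in> arcs d" "\<nexists>i. {Bot i, Bot (Suc i)} \<in> arcs d" and a: "a \<in> arcs d" for a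
    proof -
      have "card a = 2" using d a by (simp add: tl_diagrams_iff)
      then obtain p q where pq: "a = {p, q}" "p \<noteq> q" by (metis card_2_iff)
      show ?thesis
      proof (cases p; cases q)
        fix i k assume ik: "p = Top i" "q = Top k"
        then have "i < k \<or> k < i" using pq by auto
        then have False using adjacent_cap[OF d] no a pq ik by (metis insert_commute)
        then show ?thesis ..
      next
        fix i k assume ik: "p = Bot i" "q = Bot k"
        then have "i < k \<or> k < i" using pq by auto
        then have False using adjacent_cup[OF d] no a pq ik by (metis insert_commute)
        then show ?thesis ..
      qed (use pq in auto)
    qed
    then show ?thesis using that by metis
  qed
  then show ?case
  proof cases
    case cap
    then obtain j d' where d': "m = i + 2 + j" "d' \<in> tl_diagrams (i + j) n" "d = dcomp (capd i j) d'"
      using remove_cap[OF d] by metis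
    then show ?thesis using assms(3)[OF d'(2) less.hyps[OF _ d'(2)]] by simp
  next
    case cup
    then obtain j d' where d': "n = i + 2 + j" "d' \<in> tl_diagrams m (i + j)" "d = dcomp d' (cupd i j)"
      using remove_cup[OF d] by metis
    then show ?thesis using assms(4)[OF d'(2) less.hyps[OF _ d'(2)]] by simp
  next
    case through
    then show ?thesis using through_diagram_id[OF d] id by simp
  qed
qed

section \<open>Closure of noncrossing diagrams under composition\<close>

lemma did_did [simp]: "dtensor (did a) (did b) = did (a + b)"
proof -
  have "{..<a + b} = {..<a} \<union> (\<lambda>k. a + k) ` {..<b}"
  proof (intro equalityI subsetI)
    fix k assume "k \<in> {..<a + b}"
    then have "k < a \<or> k = a + (k - a) \<and> k - a < b" by auto
    then show "k \<in> {..<a} \<union> (\<lambda>k. a + k) ` {..<b}" by blast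
  qed auto
  then show ?thesis
    by (simp add: dtensor_def did_def Collect_less_image image_Un image_image)
qed

lemma did_did_assoc: "dtensor (did a) (dtensor (did b) d) = dtensor (did (a + b)) d"
  by (simp add: dtensor_assoc[symmetric])

lemma cupd_tensor: "dtensor (did k) (cupd i j) = cupd (k + i) j" "dtensor (cupd i j) (did k) = cupd i (j + k)"
  by (simp_all add: cupd_def dtensor_assoc did_did_assoc)

lemma capd_tensor: "dtensor (did k) (capd i j) = capd (k + i) j" "dtensor (capd i j) (did k) = capd i (j + k)"
  by (simp_all add: capd_def dtensor_assoc did_did_assoc)

lemma dcup_1: "dcup 1 = cupd 0 0" and dcap_1: "dcap 1 = capd 0 0"
  by (simp_all add: cupd_def capd_def)

lemma cupd_tl: "cupd i j \<in> tl_diagrams (i + j) (i + 2 + j)"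
proof -
  have "dcomp (did (i + j)) (cupd i j) = cupd i j"
    using dcomp_cupd(1)[of "i + j" i j "did (i + j)"] did_tl[of "i + j"] arcs_cupd[of i j]
    by (intro diagram.expand) (simp add: tl_diagrams_iff, simp add: did_def Collect_less_image image_image)
  then show ?thesis using dcomp_cupd_tl(1)[OF did_tl] by metis
qed

lemma capd_tl: "capd i j \<in> tl_diagrams (i + 2 + j) (i + j)"
  using dflip_tl[OF cupd_tl] by simp

text \<open>A nest of arcs grows from the inside: the new arc goes into the middle, and
  \<open>skip2\<close> moves the right ends outwards by two places. Membership is proved alongside
  because the formula for composing with \<open>cupd\<close> presupposes a matching.\<close>

lemma dcup_Suc: "dcup n \<in> tl_diagrams 0 (2 * n) \<and> dcup (Suc n) = dcomp (dcup n) (cupd n n)"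
proof (induction n)
  case 0
  have "dcup 0 = did 0" by (simp add: dcup_def did_def)
  moreover have "dcomp (did 0) (cupd 0 0) = cupd 0 0"
    by (rule dcomp_did_left[OF cupd_tl[of 0 0, simplified]])
  ultimately show ?case using did_tl[of 0] dcup_1 by simp
next
  case (Suc n)
  then have tl: "dcup (Suc n) \<in> tl_diagrams 0 (2 * Suc n)"
    using dcomp_cupd_tl(1)[of "dcup n" 0 n n] by (simp add: mult_2)
  let ?n = "Suc n"
  have "image (map_bot (skip2 ?n)) ` {{Bot i, Bot (2 * ?n - 1 - i)} | i. i < ?n} \<union> {{Bot ?n, Bot (Suc ?n)}}
      = {{Bot i, Bot (2 * Suc ?n - 1 - i)} | i. i < Suc ?n}"
  proof -
    have "skip2 ?n i = i \<and> skip2 ?n (2 * ?n - 1 - i) = 2 * Suc ?n - 1 - i" if "i < ?n" for i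
      using that by (auto simp: skip2_def)
    then have "image (map_bot (skip2 ?n)) ` (\<lambda>i. {Bot i, Bot (2 * ?n - 1 - i)}) ` {..<?n} =
        (\<lambda>i. {Bot i, Bot (2 * Suc ?n - 1 - i)}) ` {..<?n}"
      unfolding image_image by (intro image_cong refl) (auto simp del: mult_Suc_right)
    then show ?thesis unfolding Collect_less_image lessThan_Suc[of "?n"] by auto
  qed
  moreover have "dcomp (dcup ?n) (cupd ?n ?n) = Diagram 0 (?n + 2 + ?n) (image (map_bot (skip2 ?n)) ` arcs (dcup ?n) \<union> {{Bot ?n, Bot (Suc ?n)}})"
    using dcomp_cupd(1)[of 0 ?n ?n "dcup ?n"] tl by (simp add: tl_diagrams_iff mult_2)
  ultimately have "dcomp (dcup ?n) (cupd ?n ?n) = dcup (Suc ?n)"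
    by (simp add: dcup_def)
  then show ?case using tl by simp
qed

lemma dcup_tl: "dcup n \<in> tl_diagrams 0 (2 * n)"
  using dcup_Suc by blast

lemma dcap_tl: "dcap n \<in> tl_diagrams (2 * n) 0"
  using dflip_tl[OF dcup_tl] by simp

section \<open>Relations between single turn-backs\<close>

lemma arcs_small:
  "arcs (cupd 0 (Suc 0)) = {{Bot 0, Bot (Suc 0)}, {Top 0, Bot 2}}"
  "arcs (capd (Suc 0) 0) = {{Top (Suc 0), Top 2}, {Top 0, Bot 0}}"
  "arcs (cupd 0 0) = {{Bot 0, Bot (Suc 0)}}"
  "arcs (capd 0 0) = {{Top 0, Top (Suc 0)}}"
proof -
  have s: "{..<Suc 0} = {0}" by auto
  show "arcs (cupd 0 (Suc 0)) = {{Bot 0, Bot (Suc 0)}, {Top 0, Bot 2}}" "arcs (cupd 0 0) = {{Bot 0, Bot (Suc 0)}}"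
    by (auto simp: arcs_cupd s skip2_def)
  have "arcs (dflip (cupd (Suc 0) 0)) = {{Top (Suc 0), Top 2}, {Top 0, Bot 0}}"
    unfolding dflip_def arcs_cupd diagram.sel by (auto simp: s skip2_def numeral_2_eq_2)
  then show "arcs (capd (Suc 0) 0) = {{Top (Suc 0), Top 2}, {Top 0, Bot 0}}" by simp
  have "arcs (dflip (cupd 0 0)) = {{Top 0, Top (Suc 0)}}"
    unfolding dflip_def arcs_cupd diagram.sel by (auto simp: skip2_def)
  then show "arcs (capd 0 0) = {{Top 0, Top (Suc 0)}}" by simp
qed

lemma conn_star:
  assumes "\<And>x. x \<in> C \<Longrightarrow> (c, x) \<in> conn S" "x \<in> C" "y \<in> C"
  shows "(x, y) \<in> conn S"
  by (rule conn_trans[OF conn_sym[OF assms(1)[OF assms(2)]] assms(1)[OF assms(3)]])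

lemma zigzag: "dcomp (cupd 0 1) (capd 1 0) = did 1" and loops_zigzag: "loops (cupd 0 1) (capd 1 0) = 0"
proof -
  \<comment> \<open>The bent strand passes through all five points, so it is the only component and
    it reaches both outer lines.\<close>
  let ?C = "{(0, 0), (1, 2), (1, Suc 0), (1, 0), (2, 0)} :: (nat \<times> nat) set"
  have arcs: "stack_arcs (cupd 0 1) (capd 1 0) =
      {{(1, 0), (1, Suc 0)}, {(0, 0), (1, 2)}, {(1, Suc 0), (1, 2)}, {(1, 0), (2, 0)}}" (is "_ = ?S")
    by (auto simp: stack_arcs_def arcs_small)
  have s1: "((1, 0), (1, Suc 0)) \<in> conn ?S" by (rule conn_arc[of "{(1, 0), (1, Suc 0)}"]) auto
  have s2: "((1, Suc 0), (1, 2)) \<in> conn ?S" by (rule conn_arc[of "{(1, Suc 0), (1, 2)}"]) auto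
  have s3: "((1, 2), (0, 0)) \<in> conn ?S" by (rule conn_arc[of "{(0, 0), (1, 2)}"]) auto
  have s4: "((1, 0), (2, 0)) \<in> conn ?S" by (rule conn_arc[of "{(1, 0), (2, 0)}"]) auto
  have s5: "((1, 0), (1, 0)) \<in> conn ?S" by (rule conn_arc[of "{(1, 0), (2, 0)}"]) auto
  have comps: "comps ?S = {?C}"
  proof (rule comps_eqI)
    fix D x y assume "D \<in> {?C}" "x \<in> D" "y \<in> D"
    then have xy: "x \<in> ?C" "y \<in> ?C" by auto
    show "(x, y) \<in> conn ?S"
    proof (rule conn_star[of ?C "(1, 0)"])
      fix x assume "x \<in> ?C"
      then show "((1, 0), x) \<in> conn ?S"
        using s5 s4 s1 conn_trans[OF s1 s2] conn_trans[OF s1 conn_trans[OF s2 s3]] by blast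
    qed (use xy in blast)+
  qed auto
  have "p \<in> outer -` ?C \<longleftrightarrow> p \<in> {Top 0, Bot 0}" for p by (cases p) auto
  then have out: "outer -` ?C = {Top 0, Bot 0}" by blast
  have one: "stack_components (cupd 0 1) (capd 1 0) = {?C}" unfolding stack_components_eq arcs comps ..
  show "dcomp (cupd 0 1) (capd 1 0) = did 1"
    unfolding dcomp_def one image_insert image_empty out by (simp add: did_def)
  have "outer -` ?C \<noteq> {}" unfolding out by simp
  then have "{C \<in> {?C}. outer -` C = {}} = {}" by blast
  then show "loops (cupd 0 1) (capd 1 0) = 0" unfolding loops_def one by (simp only: card.empty)
qed

lemma cup_cap: "dcomp (cupd 0 0) (capd 0 0) = did 0" and loops_cup_cap: "loops (cupd 0 0) (capd 0 0) = 1"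
proof -
  let ?C = "{(1, 0), (1, Suc 0)} :: (nat \<times> nat) set"
  have arcs: "stack_arcs (cupd 0 0) (capd 0 0) = {?C}"
    by (auto simp: stack_arcs_def arcs_small)
  have one: "stack_components (cupd 0 0) (capd 0 0) = {?C}"
    unfolding stack_components_eq arcs by (rule comps_disjoint_family) (auto simp: disjoint_def)
  have "p \<notin> outer -` ?C" for p by (cases p) auto
  then have out: "outer -` ?C = {}" by blast
  show "dcomp (cupd 0 0) (capd 0 0) = did 0"
    unfolding dcomp_def one image_insert image_empty out by (simp add: did_def)
  have "{C \<in> {?C}. outer -` C = {}} = {?C}" using out by blast
  then show "loops (cupd 0 0) (capd 0 0) = 1"
    unfolding loops_def one by simp
qed

lemma did_in_range [simp]: "in_range (did n)"
  and cupd_in_range [simp]: "in_range (cupd i j)"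
  and capd_in_range [simp]: "in_range (capd i j)"
  using tl_diagrams_in_range did_tl cupd_tl capd_tl by blast+

lemma dcomp_did_did [simp]: "dcomp (did n) (did n) = did n"
  by (rule dcomp_did_left[OF did_tl])

text \<open>This and the next two lemmas rewrite a cup followed by a cap: in the same place a loop
  is dropped, in neighbouring places the strand straightens, and further apart the turn-backs
  commute. Reflection gives the mirror cases.\<close>

lemma cup_cap_same: "dcomp (cupd i j) (capd i j) = did (i + j)"
proof -
  have "cupd i j = dtensor (did i) (dtensor (cupd 0 0) (did j))" "capd i j = dtensor (did i) (dtensor (capd 0 0) (did j))"
    by (simp_all add: cupd_tensor capd_tensor)
  then show ?thesis by (simp add: dtensor_dcomp cup_cap)
qed

lemma cup_cap_right: "dcomp (cupd i (Suc j)) (capd (Suc i) j) = did (Suc i + j)"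
proof -
  have "cupd i (Suc j) = dtensor (did i) (dtensor (cupd 0 1) (did j))" "capd (Suc i) j = dtensor (did i) (dtensor (capd 1 0) (did j))"
    by (simp_all add: cupd_tensor capd_tensor)
  then show ?thesis using zigzag by (simp add: dtensor_dcomp)
qed

lemma cup_cap_far: "dcomp (cupd k (s + 2 + j)) (capd (k + 2 + s) j) = dcomp (capd (k + s) j) (cupd k (s + j))"
proof -
  have l: "dcomp (cupd 0 0) (did 2) = cupd 0 0" "dcomp (did 0) (cupd 0 0) = cupd 0 0"
    using dcomp_did_right(1)[OF cupd_tl[of 0 0]] dcomp_did_left(1)[OF cupd_tl[of 0 0]]
    by (simp_all add: numeral_2_eq_2)
  have c: "dcomp (did (s + 2 + j)) (capd s j) = capd s j" "dcomp (capd s j) (did (s + j)) = capd s j"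
    using dcomp_did_right(1)[OF capd_tl[of s j]] dcomp_did_left(1)[OF capd_tl[of s j]] by simp_all
  have 1: "cupd k (s + 2 + j) = dtensor (did k) (dtensor (cupd 0 0) (did (s + 2 + j)))"
    "capd (k + 2 + s) j = dtensor (did k) (dtensor (did 2) (capd s j))"
    "capd (k + s) j = dtensor (did k) (dtensor (did 0) (capd s j))"
    "cupd k (s + j) = dtensor (did k) (dtensor (cupd 0 0) (did (s + j)))"
    by (simp_all add: cupd_tensor capd_tensor did_did_assoc add.assoc)
  show ?thesis unfolding 1 by (simp add: dtensor_dcomp l c c[simplified] del: dtensor_did0_left)
qed

text \<open>Pushing the cap through the cups of \<open>d\<close> reduces planarity of the composite to the insertion of innermost
  arcs.\<close>

lemma dcomp_d_capd_tl:
  assumes "d \<in> tl_diagrams m n" "n = i + 2 + j"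
  shows "dcomp d (capd i j) \<in> tl_diagrams m (i + j)"
  using assms
proof (induction m n d arbitrary: i j rule: tl_diagrams_induct)
  case (id n)
  then show ?case using capd_tl dcomp_did_left(1)[OF capd_tl] by simp
next
  case (cap k l n d)
  then show ?case using dcomp_capd_tl(1) by (simp add: dcomp_assoc)
next
  case (cup m k l d)
  then have kl: "k + l = i + j" by simp
  consider "k = i" | "Suc k = i" | "k = Suc i" | "k + 2 \<le> i" | "i + 2 \<le> k" by linarith
  then show ?case
  proof cases
    case 1
    then have "l = j" using kl by simp
    then show ?thesis using 1 cup dcomp_did_right(1)[OF cup(1)] by (simp add: dcomp_assoc cup_cap_same)
  next
    case 2
    then have "l = Suc j" using kl by simp
    then have "dcomp (cupd k l) (capd i j) = did (i + j)" using 2 cup_cap_right[of k j] by simp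
    then show ?thesis using kl cup dcomp_did_right(1)[OF cup(1)] by (simp add: dcomp_assoc)
  next
    case 3
    then have "j = Suc l" using kl by simp
    then have "dcomp (cupd k l) (capd i j) = did (i + j)"
      using 3 arg_cong[OF cup_cap_right[of i l], of dflip] by (simp add: dflip_dcomp)
    then show ?thesis using kl cup dcomp_did_right(1)[OF cup(1)] by (simp add: dcomp_assoc)
  next
    case 4
    then obtain s where s: "i = k + 2 + s" by (metis le_iff_add)
    then have l: "l = s + 2 + j" using kl by simp
    have "dcomp d (capd (k + s) j) \<in> tl_diagrams m (k + s + j)" using cup.IH[of "k + s" j] l by simp
    then have "dcomp (dcomp d (capd (k + s) j)) (cupd k (s + j)) \<in> tl_diagrams m (k + 2 + (s + j))"
      using dcomp_cupd_tl(1)[of _ m k "s + j"] by (simp add: add.assoc)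
    then show ?thesis unfolding s l dcomp_assoc cup_cap_far by (simp add: add_ac)
  next
    case 5
    then obtain s where s: "k = i + 2 + s" by (metis le_iff_add)
    then have l: "j = s + 2 + l" using kl by simp
    have rel: "dcomp (cupd (i + 2 + s) l) (capd i (s + 2 + l)) = dcomp (capd i (s + l)) (cupd (i + s) l)"
      using arg_cong[OF cup_cap_far[of i s l], of dflip] by (simp add: dflip_dcomp)
    have "dcomp d (capd i (s + l)) \<in> tl_diagrams m (i + (s + l))" using cup.IH[of i "s + l"] s by simp
    then have "dcomp (dcomp d (capd i (s + l))) (cupd (i + s) l) \<in> tl_diagrams m (i + s + 2 + l)"
      using dcomp_cupd_tl(1)[of _ m "i + s" l] by (simp add: add.assoc)
    then show ?thesis unfolding s l dcomp_assoc rel by (simp add: add_ac)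
  qed
qed

text \<open>The lower diagram is built up from single turn-backs, each of which is already known to
  preserve planarity when composed.\<close>

lemma dcomp_tl:
  assumes "e \<in> tl_diagrams l n" "d \<in> tl_diagrams m l"
  shows "dcomp d e \<in> tl_diagrams m n"
  using assms
proof (induction l n e arbitrary: m d rule: tl_diagrams_induct)
  case (id n)
  then show ?case using dcomp_did_right(1)[OF id] by simp
next
  case (cap i j n e)
  then show ?case using dcomp_d_capd_tl[OF cap.prems refl] by (simp add: dcomp_assoc[symmetric])
next
  case (cup l i j e)
  then show ?case using dcomp_cupd_tl(1) by (simp add: dcomp_assoc[symmetric])
qed

lemma dtensor_did_tl: "d \<in> tl_diagrams m n \<Longrightarrow> dtensor d (did k) \<in> tl_diagrams (m + k) (n + k)"
proof (induction m n d rule: tl_diagrams_induct)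
  case (id n)
  then show ?case using did_tl by simp
next
  case (cap i j n d)
  have "dtensor (dcomp (capd i j) d) (did k) = dcomp (capd i (j + k)) (dtensor d (did k))"
    using dtensor_dcomp[of "capd i j" d "did k" "did k"] tl_diagrams_in_range[OF cap(1)] tl_diagrams_dtop[OF cap(1)]
    by (simp add: capd_tensor)
  then show ?case using dcomp_capd_tl(1)[of "dtensor d (did k)" i "j + k" "n + k"] cap(2) by (simp add: add.assoc)
next
  case (cup m i j d)
  have "dtensor (dcomp d (cupd i j)) (did k) = dcomp (dtensor d (did k)) (cupd i (j + k))"
    using dtensor_dcomp[of d "cupd i j" "did k" "did k"] tl_diagrams_in_range[OF cup(1)] tl_diagrams_dbot[OF cup(1)]
    by (simp add: cupd_tensor)
  then show ?case using dcomp_cupd_tl(1)[of "dtensor d (did k)" "m + k" i "j + k"] cup(2) by (simp add: add.assoc)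
qed

lemma did_dtensor_tl: "d \<in> tl_diagrams m n \<Longrightarrow> dtensor (did k) d \<in> tl_diagrams (k + m) (k + n)"
proof (induction m n d rule: tl_diagrams_induct)
  case (id n)
  then show ?case using did_tl by simp
next
  case (cap i j n d)
  have "dtensor (did k) (dcomp (capd i j) d) = dcomp (capd (k + i) j) (dtensor (did k) d)"
    using dtensor_dcomp[of "did k" "did k" "capd i j" d] by (simp add: capd_tensor)
  then show ?case using dcomp_capd_tl(1)[of "dtensor (did k) d" "k + i" j "k + n"] cap(2) by (simp add: add.assoc)
next
  case (cup m i j d)
  have "dtensor (did k) (dcomp d (cupd i j)) = dcomp (dtensor (did k) d) (cupd (k + i) j)"
    using dtensor_dcomp[of "did k" "did k" d "cupd i j"] by (simp add: cupd_tensor)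
  then show ?case using dcomp_cupd_tl(1)[of "dtensor (did k) d" "k + m" "k + i" j] cup(2) by (simp add: add.assoc)
qed

text \<open>Drawing one factor above the other writes the juxtaposition as a composite of two
  diagrams padded with identity strands.\<close>

lemma dtensor_tl:
  assumes d: "d \<in> tl_diagrams m n" and e: "e \<in> tl_diagrams m' n'"
  shows "dtensor d e \<in> tl_diagrams (m + m') (n + n')"
proof -
  have "dtensor d e = dcomp (dtensor d (did m')) (dtensor (did n) e)"
    using dtensor_dcomp[of d "did n" "did m'" e] tl_diagrams_in_range[OF d] tl_diagrams_dbot[OF d]
    by (simp add: dcomp_did_left(1)[OF e] dcomp_did_right(1)[OF d])
  then show ?thesis using dcomp_tl[OF did_dtensor_tl[OF e] dtensor_did_tl[OF d]] by simp
qed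

section \<open>Linear extension\<close>

lemma lookup_scale [simp]: "Poly_Mapping.lookup (scale c f) k = c * Poly_Mapping.lookup f k"
  by (simp add: scale_def Poly_Mapping.map.rep_eq when_def)

global_interpretation lin: vector_space "scale :: complex \<Rightarrow> ('a \<Rightarrow>\<^sub>0 complex) \<Rightarrow> ('a \<Rightarrow>\<^sub>0 complex)"
  by unfold_locales (auto intro!: poly_mapping_eqI simp: lookup_add algebra_simps)

lemma keys_scale: "Poly_Mapping.keys (scale c f) \<subseteq> Poly_Mapping.keys f"
  by (auto simp: in_keys_iff)

lemma scale_single: "scale c (Poly_Mapping.single k v) = Poly_Mapping.single k (c * v)"
  by (rule poly_mapping_eqI) (simp add: lookup_single when_def)

text \<open>The common shape of composition, tensor product and external product, with structure map
  \<open>B\<close> and weight \<open>w\<close>; linearity is derived once and specialised to all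
  three.\<close>

definition bilin :: "('a \<Rightarrow> 'b \<Rightarrow> 'c) \<Rightarrow> ('a \<Rightarrow> 'b \<Rightarrow> complex) \<Rightarrow> ('a \<Rightarrow>\<^sub>0 complex) \<Rightarrow> ('b \<Rightarrow>\<^sub>0 complex) \<Rightarrow> ('c \<Rightarrow>\<^sub>0 complex)"
  where "bilin B w f g = (\<Sum>d\<in>Poly_Mapping.keys f. \<Sum>e\<in>Poly_Mapping.keys g.
    Poly_Mapping.single (B d e) (Poly_Mapping.lookup f d * Poly_Mapping.lookup g e * w d e))"

lemma tl_comp_bilin: "tl_comp A = bilin dcomp (\<lambda>d e. loop_value A ^ loops d e)"
  and tl_tensor_bilin: "tl_tensor = bilin dtensor (\<lambda>_ _. 1)"
  and tl_boxtimes_bilin: "tl_boxtimes = bilin Pair (\<lambda>_ _. 1)"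
  by (auto simp: fun_eq_iff tl_comp_def tl_tensor_def tl_boxtimes_def bilin_def)

lemma bilin_swap: "bilin B w f g = bilin (\<lambda>e d. B d e) (\<lambda>e d. w d e) g f"
  unfolding bilin_def by (subst sum.swap) (simp add: mult.commute)

text \<open>The support of a sum or of a multiple may shrink, so linearity is checked over a common
  larger index set.\<close>

lemma bilin_superset:
  assumes "finite X" "Poly_Mapping.keys f \<subseteq> X"
  shows "bilin B w f g = (\<Sum>d\<in>X. \<Sum>e\<in>Poly_Mapping.keys g.
    Poly_Mapping.single (B d e) (Poly_Mapping.lookup f d * Poly_Mapping.lookup g e * w d e))"
  unfolding bilin_def by (intro sum.mono_neutral_left assms) (simp add: in_keys_iff)

lemma bilin_add_left: "bilin B w (f + f') g = bilin B w f g + bilin B w f' g"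
proof -
  have "finite (Poly_Mapping.keys f \<union> Poly_Mapping.keys f')" by simp
  note s = bilin_superset[OF this, where g = g]
  show ?thesis
    by (subst (1 2 3) s)
      (auto simp: Poly_Mapping.keys_add lookup_add distrib_right single_add sum.distrib)
qed

lemma bilin_add_right: "bilin B w f (g + g') = bilin B w f g + bilin B w f g'"
  by (simp add: bilin_swap[of B w f] bilin_add_left)

lemma bilin_scale_left: "bilin B w (scale c f) g = scale c (bilin B w f g)"
  by (subst bilin_superset[OF finite_keys keys_scale])
    (simp add: bilin_def lin.scale_sum_right scale_single mult.assoc)

lemma bilin_scale_right: "bilin B w f (scale c g) = scale c (bilin B w f g)"
  by (simp add: bilin_swap[of B w f] bilin_scale_left)

lemma bilin_zero: "bilin B w 0 g = 0" "bilin B w f 0 = 0"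
  by (simp_all add: bilin_def)

lemma bilin_uminus: "bilin B w (- f) g = - bilin B w f g" "bilin B w f (- g) = - bilin B w f g"
  using bilin_scale_left[of B w "-1" f g] bilin_scale_right[of B w f "-1" g]
  by (simp_all add: lin.scale_minus_left)

lemma bilin_diff: "bilin B w (f - f') g = bilin B w f g - bilin B w f' g"
  "bilin B w f (g - g') = bilin B w f g - bilin B w f g'"
  using bilin_add_left[of B w f "- f'" g] bilin_add_right[of B w f g "- g'"]
  by (simp_all add: bilin_uminus)

lemma bilin_sum: "bilin B w (\<Sum>x\<in>X. F x) g = (\<Sum>x\<in>X. bilin B w (F x) g)"
  "bilin B w f (\<Sum>x\<in>X. F' x) = (\<Sum>x\<in>X. bilin B w f (F' x))"
  by (induction X rule: infinite_finite_induct) (simp_all add: bilin_zero bilin_add_left bilin_add_right)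

lemma bilin_single: "bilin B w (Poly_Mapping.single d 1) (Poly_Mapping.single e 1) = Poly_Mapping.single (B d e) (w d e)"
  by (simp add: bilin_def)

lemmas bilin_linear = bilin_add_left bilin_add_right bilin_scale_left bilin_scale_right bilin_zero
  bilin_uminus bilin_diff bilin_sum

lemmas comp_linear = bilin_linear[where B = dcomp and w = "\<lambda>d e. loop_value A ^ loops d e" for A, folded tl_comp_bilin]
lemmas tensor_linear = bilin_linear[where B = dtensor and w = "\<lambda>_ _. 1", folded tl_tensor_bilin]
lemmas boxtimes_linear = bilin_linear[where B = "Pair :: diagram \<Rightarrow> diagram \<Rightarrow> diagram \<times> diagram"
    and w = "\<lambda>_ _. 1", folded tl_boxtimes_bilin]

lemma single_dg: "Poly_Mapping.single d c = scale c (dg d)"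
  by (simp add: dg_def scale_single)

lemma comp_dg: "tl_comp A (dg d) (dg e) = scale (loop_value A ^ loops d e) (dg (dcomp d e))"
  unfolding tl_comp_bilin dg_def bilin_single by (simp add: scale_single)

lemma tensor_dg: "dg d \<otimes> dg e = dg (dtensor d e)"
  unfolding tl_tensor_bilin dg_def bilin_single ..

lemma keys_induct [consumes 1, case_names zero add scale dg]:
  assumes "Poly_Mapping.keys f \<subseteq> D"
    and zero: "P 0"
    and add: "\<And>f g. P f \<Longrightarrow> P g \<Longrightarrow> P (f + g)"
    and scale: "\<And>c f. P f \<Longrightarrow> P (scale c f)"
    and dg: "\<And>d. d \<in> D \<Longrightarrow> P (dg d)"
  shows "P f"
proof -
  have "P (\<Sum>d\<in>K. Poly_Mapping.single d (Poly_Mapping.lookup f d))" if "finite K" "K \<subseteq> D" for K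
    using that
  proof (induction K rule: finite_induct)
    case empty
    then show ?case using zero by simp
  next
    case (insert d K)
    then show ?case using add scale dg by (simp add: single_dg)
  qed
  then have "P (\<Sum>d\<in>Poly_Mapping.keys f. Poly_Mapping.single d (Poly_Mapping.lookup f d))"
    using assms(1) finite_keys by blast
  moreover have "(\<Sum>d\<in>Poly_Mapping.keys f. Poly_Mapping.single d (Poly_Mapping.lookup f d)) = f"
    by (rule poly_mapping_eqI) (simp add: lookup_sum lookup_single when_def in_keys_iff)
  ultimately show ?thesis by simp
qed

text \<open>Associativity and interchange involve loop counts by \<open>card\<close> and hence
  finite diagrams. This condition is weaker than membership in some \<open>tl_hom\<close> and
  mentions no boundaries, so simplification can discharge it.\<close>

definition fin :: "tl \<Rightarrow> bool" where
  "fin f \<longleftrightarrow> (\<forall>d\<in>Poly_Mapping.keys f. finite (arcs d))"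

lemma fin_iff: "fin f \<longleftrightarrow> Poly_Mapping.keys f \<subseteq> {d. finite (arcs d)}"
  by (auto simp: fin_def)

lemma keys_dg [simp]: "Poly_Mapping.keys (dg d) = {d}"
  by (simp add: dg_def)

lemma fin_closed [simp]: "fin 0" "fin f \<Longrightarrow> fin g \<Longrightarrow> fin (f + g)" "fin f \<Longrightarrow> fin (scale c f)"
  "fin f \<Longrightarrow> fin g \<Longrightarrow> fin (f - g)"
  using Poly_Mapping.keys_add[of f g] keys_scale[of c f] keys_diff[of f g] by (auto simp: fin_def)

lemma fin_dg: "fin (dg d) \<longleftrightarrow> finite (arcs d)"
  by (simp add: fin_def)

lemma fin_comp [simp]: "fin f \<Longrightarrow> fin g \<Longrightarrow> fin (tl_comp A f g)"
proof -
  assume f: "fin f" and g: "fin g"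
  show ?thesis
    using f[unfolded fin_iff]
  proof (induction f rule: keys_induct)
    case (dg d)
    show ?case
      using g[unfolded fin_iff]
      by (induction g rule: keys_induct)
        (use dg in \<open>simp_all add: comp_linear comp_dg fin_dg finite_arcs_dcomp\<close>)
  qed (simp_all add: comp_linear)
qed

lemma fin_tensor [simp]: "fin f \<Longrightarrow> fin g \<Longrightarrow> fin (f \<otimes> g)"
proof -
  assume f: "fin f" and g: "fin g"
  show ?thesis
    using f[unfolded fin_iff]
  proof (induction f rule: keys_induct)
    case (dg d)
    show ?case
      using g[unfolded fin_iff]
      by (induction g rule: keys_induct)
        (use dg in \<open>simp_all add: tensor_linear tensor_dg fin_dg finite_arcs_dtensor\<close>)
  qed (simp_all add: tensor_linear)
qed

lemma comp_assoc: "fin f \<Longrightarrow> fin g \<Longrightarrow> fin h \<Longrightarrow> tl_comp A (tl_comp A f g) h = tl_comp A f (tl_comp A g h)"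
proof -
  assume f: "fin f" and g: "fin g" and h: "fin h"
  show ?thesis
    using f[unfolded fin_iff]
  proof (induction f rule: keys_induct)
    case d: (dg d)
    show ?case
      using g[unfolded fin_iff]
    proof (induction g rule: keys_induct)
      case e: (dg e)
      show ?case
        using h[unfolded fin_iff]
      proof (induction h rule: keys_induct)
        case (dg k)
        show ?case
          using loops_assoc[of d e k] d e dg
          by (simp add: comp_dg comp_linear dcomp_assoc power_add[symmetric] add.commute)
      qed (simp_all add: comp_linear)
    qed (simp_all add: comp_linear)
  qed (simp_all add: comp_linear)
qed

lemma tensor_assoc: "(f \<otimes> g) \<otimes> h = f \<otimes> (g \<otimes> h)"
proof (induction f rule: keys_induct[OF subset_UNIV])
  case (4 d)
  show ?case
  proof (induction g rule: keys_induct[OF subset_UNIV])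
    case (4 e)
    show ?case
      by (induction h rule: keys_induct[OF subset_UNIV])
        (simp_all add: tensor_dg tensor_linear dtensor_assoc)
  qed (simp_all add: tensor_linear)
qed (simp_all add: tensor_linear)

abbreviation idt :: "nat \<Rightarrow> tl" where "idt n \<equiv> dg (did n)"
abbreviation cupm :: "nat \<Rightarrow> nat \<Rightarrow> tl" where "cupm i j \<equiv> dg (cupd i j)"
abbreviation capm :: "nat \<Rightarrow> nat \<Rightarrow> tl" where "capm i j \<equiv> dg (capd i j)"

lemma tensor_idt0 [simp]: "idt 0 \<otimes> f = f" "f \<otimes> idt 0 = f"
  by (induction f rule: keys_induct[OF subset_UNIV]) (simp_all add: tensor_dg tensor_linear)

lemma idt_idt [simp]: "idt a \<otimes> idt b = idt (a + b)"
  by (simp add: tensor_dg)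

lemma idt_idt_assoc [simp]: "idt a \<otimes> (idt b \<otimes> f) = idt (a + b) \<otimes> f"
  by (simp add: tensor_assoc[symmetric])

lemma cupm_def: "cupm i j = idt i \<otimes> dg (dcup 1) \<otimes> idt j"
  and capm_def: "capm i j = idt i \<otimes> dg (dcap 1) \<otimes> idt j"
  by (simp_all add: tensor_dg cupd_def capd_def)

lemma cupm_tensor [simp]: "idt k \<otimes> cupm i j = cupm (k + i) j" "cupm i j \<otimes> idt k = cupm i (j + k)"
  and capm_tensor [simp]: "idt k \<otimes> capm i j = capm (k + i) j" "capm i j \<otimes> idt k = capm i (j + k)"
  by (simp_all add: tensor_dg cupd_tensor capd_tensor)

lemma tl_hom_fin [simp]: "f \<in> tl_hom m n \<Longrightarrow> fin f"
  using tl_diagrams_finite by (auto simp: tl_hom_def fin_def)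

lemma tl_hom_induct [consumes 1, case_names zero add scale dg]:
  assumes "f \<in> tl_hom m n" "P 0" "\<And>f g. P f \<Longrightarrow> P g \<Longrightarrow> P (f + g)" "\<And>c f. P f \<Longrightarrow> P (scale c f)"
    and "\<And>d. d \<in> tl_diagrams m n \<Longrightarrow> P (dg d)"
  shows "P f"
  using assms(1)[unfolded tl_hom_def mem_Collect_eq] assms(2-5) by (rule keys_induct)

lemma tl_hom_ex_scale:
  assumes "f \<in> tl_hom m n" "\<And>f g. F (f + g) = F f + F g" "\<And>c f. F (scale c f) = scale c (F f)"
    and "\<And>d. d \<in> tl_diagrams m n \<Longrightarrow> \<exists>\<alpha>. F (dg d) = scale \<alpha> v"
  shows "\<exists>\<alpha>. F f = scale \<alpha> v"
  using assms(1)
proof (induction f rule: tl_hom_induct)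
  case zero
  show ?case using assms(3)[of 0 0] by (intro exI[of _ 0]) simp
next
  case (add f g)
  then show ?case by (metis assms(2) lin.scale_left_distrib)
next
  case (scale c f)
  then show ?case by (metis assms(3) lin.scale_scale)
qed (rule assms(4))

lemma tl_hom_dg: "d \<in> tl_diagrams m n \<Longrightarrow> dg d \<in> tl_hom m n"
  by (simp add: tl_hom_def)

lemma tl_hom_zero [simp]: "0 \<in> tl_hom m n"
  and tl_hom_add: "f \<in> tl_hom m n \<Longrightarrow> g \<in> tl_hom m n \<Longrightarrow> f + g \<in> tl_hom m n"
  and tl_hom_diff: "f \<in> tl_hom m n \<Longrightarrow> g \<in> tl_hom m n \<Longrightarrow> f - g \<in> tl_hom m n"
  and tl_hom_scale: "f \<in> tl_hom m n \<Longrightarrow> scale c f \<in> tl_hom m n"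
  using Poly_Mapping.keys_add[of f g] keys_scale[of c f] keys_diff[of f g] by (auto simp: tl_hom_def)

lemma tl_hom_idt [simp]: "idt n \<in> tl_hom n n"
  by (rule tl_hom_dg[OF did_tl])

lemma tl_hom_cupm: "k = i + j \<Longrightarrow> l = i + 2 + j \<Longrightarrow> cupm i j \<in> tl_hom k l"
  and tl_hom_capm: "k = i + j \<Longrightarrow> l = i + 2 + j \<Longrightarrow> capm i j \<in> tl_hom l k"
  using tl_hom_dg cupd_tl capd_tl by blast+

lemma tl_hom_dcup: "k = 2 * n \<Longrightarrow> dg (dcup n) \<in> tl_hom 0 k"
  and tl_hom_dcap: "k = 2 * n \<Longrightarrow> dg (dcap n) \<in> tl_hom k 0"
  using tl_hom_dg dcup_tl dcap_tl by blast+

lemma tl_hom_comp: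
  assumes f: "f \<in> tl_hom k l" and g: "g \<in> tl_hom l m"
  shows "tl_comp A f g \<in> tl_hom k m"
  using f
proof (induction f rule: tl_hom_induct)
  case (dg d)
  show ?case
    using g
    by (induction g rule: tl_hom_induct)
      (use dg in \<open>simp_all add: comp_linear comp_dg tl_hom_add tl_hom_scale tl_hom_dg dcomp_tl\<close>)
qed (simp_all add: comp_linear tl_hom_add tl_hom_scale)

lemma tl_hom_tensor:
  assumes f: "f \<in> tl_hom m n" and g: "g \<in> tl_hom m' n'" and "a = m + m'" "b = n + n'"
  shows "f \<otimes> g \<in> tl_hom a b"
  using f
proof (induction f rule: tl_hom_induct)
  case (dg d)
  show ?case
    using g
    by (induction g rule: tl_hom_induct)
      (use dg assms(3,4) in \<open>simp_all add: tensor_linear tensor_dg tl_hom_add tl_hom_scale tl_hom_dg dtensor_tl\<close>)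
qed (simp_all add: tensor_linear tl_hom_add tl_hom_scale)

lemma fin_idt [simp]: "fin (idt n)" and fin_cupm [simp]: "fin (cupm i j)" and fin_capm [simp]: "fin (capm i j)"
  and fin_dcup [simp]: "fin (dg (dcup n))" and fin_dcap [simp]: "fin (dg (dcap n))"
  by (rule tl_hom_fin, rule tl_hom_idt tl_hom_cupm[OF refl refl] tl_hom_capm[OF refl refl] tl_hom_dcup[OF refl]
      tl_hom_dcap[OF refl])+

lemma comp_idt_left: "f \<in> tl_hom m n \<Longrightarrow> tl_comp A (idt m) f = f"
  by (induction f rule: tl_hom_induct) (simp_all add: comp_linear comp_dg dcomp_did_left)

lemma comp_idt_right: "f \<in> tl_hom m n \<Longrightarrow> tl_comp A f (idt n) = f"
  by (induction f rule: tl_hom_induct) (simp_all add: comp_linear comp_dg dcomp_did_right)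

lemma comp_idt_idt [simp]: "tl_comp A (idt n) (idt n) = idt n"
  by (simp add: comp_idt_left[of _ n n])

text \<open>The left factors carry boundary conditions because their widths determine the shift of
  the right factors, for which finiteness suffices.\<close>

lemma interchange:
  assumes f1: "f1 \<in> tl_hom k l" and g1: "g1 \<in> tl_hom l m" and f2: "fin f2" and g2: "fin g2"
  shows "tl_comp A (f1 \<otimes> f2) (g1 \<otimes> g2) = tl_comp A f1 g1 \<otimes> tl_comp A f2 g2"
  using f1
proof (induction f1 rule: tl_hom_induct)
  case d1: (dg d1)
  show ?case
    using g1
  proof (induction g1 rule: tl_hom_induct)
    case e1: (dg e1)
    show ?case
      using f2[unfolded fin_iff]
    proof (induction f2 rule: keys_induct)
      case d2: (dg d2)
      show ?case
        using g2[unfolded fin_iff]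
      proof (induction g2 rule: keys_induct)
        case e2: (dg e2)
        have m: "dbot d1 = dtop e1" using d1 e1 by (simp add: tl_diagrams_iff)
        have r: "in_range d1" "in_range e1" using d1 e1 tl_diagrams_in_range by blast+
        have "finite (arcs d1)" "finite (arcs e1)" using d1 e1 tl_diagrams_finite by blast+
        then show ?case
          using d2 e2 dtensor_dcomp[OF r m, of d2 e2] loops_dtensor[OF r m, of d2 e2]
          by (simp add: comp_dg tensor_dg tensor_linear comp_linear power_add)
      qed (simp_all add: comp_linear tensor_linear)
    qed (simp_all add: comp_linear tensor_linear)
  qed (simp_all add: comp_linear tensor_linear)
qed (simp_all add: comp_linear tensor_linear)

lemma idt_tensor_comp:
  "fin f \<Longrightarrow> fin g \<Longrightarrow> tl_comp A (idt n \<otimes> f) (idt n \<otimes> g) = idt n \<otimes> tl_comp A f g"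
  using interchange[OF tl_hom_idt tl_hom_idt, of f g A n] by simp

lemma comp_tensor_idt:
  "f \<in> tl_hom k l \<Longrightarrow> g \<in> tl_hom l m \<Longrightarrow> tl_comp A (f \<otimes> idt n) (g \<otimes> idt n) = tl_comp A f g \<otimes> idt n"
  using interchange[of f k l g m "idt n" "idt n" A] by simp

lemma tensor_split:
  assumes f: "f \<in> tl_hom m n" and g: "g \<in> tl_hom m' n'"
  shows "tl_comp A (f \<otimes> idt m') (idt n \<otimes> g) = f \<otimes> g"
    and "tl_comp A (idt m \<otimes> g) (f \<otimes> idt n') = f \<otimes> g"
  using interchange[OF f tl_hom_idt fin_idt tl_hom_fin[OF g], where A = A]
    interchange[OF tl_hom_idt f tl_hom_fin[OF g] fin_idt, where A = A] comp_idt_left[OF f, of A] comp_idt_left[OF g, of A]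
    comp_idt_right[OF f, of A] comp_idt_right[OF g, of A] by simp_all

text \<open>Coefficients are not conjugated: this is a complex-linear transpose, which makes the
  later form bilinear. Precomposing with \<open>dflip\<close> moves the basis correctly because
  \<open>dflip\<close> is an involution.\<close>

definition tlflip :: "tl \<Rightarrow> tl" where
  "tlflip f = Poly_Mapping.map_key dflip f"

lemma inj_dflip: "inj dflip"
  by (metis dflip_dflip injI)

lemma lookup_tlflip [simp]: "Poly_Mapping.lookup (tlflip f) d = Poly_Mapping.lookup f (dflip d)"
  by (simp add: tlflip_def map_key.rep_eq[OF inj_dflip])

lemma tlflip_linear [simp]: "tlflip 0 = 0" "tlflip (f + g) = tlflip f + tlflip g" "tlflip (scale c f) = scale c (tlflip f)"
  "tlflip (f - g) = tlflip f - tlflip g" "tlflip (tlflip f) = f"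
  by (rule poly_mapping_eqI, simp add: lookup_add lookup_minus)+

lemma tlflip_dg [simp]: "tlflip (dg d) = dg (dflip d)"
  by (rule poly_mapping_eqI) (auto simp: dg_def lookup_single when_def)

lemma tlflip_comp: "tlflip (tl_comp A f g) = tl_comp A (tlflip g) (tlflip f)"
proof (induction f rule: keys_induct[OF subset_UNIV])
  case (4 d)
  show ?case
    by (induction g rule: keys_induct[OF subset_UNIV])
      (simp_all add: comp_dg comp_linear dflip_dcomp loops_dflip)
qed (simp_all add: comp_linear)

lemma tlflip_tensor: "tlflip (f \<otimes> g) = tlflip f \<otimes> tlflip g"
proof (induction f rule: keys_induct[OF subset_UNIV])
  case (4 d)
  show ?case
    by (induction g rule: keys_induct[OF subset_UNIV])
      (simp_all add: tensor_dg tensor_linear dflip_dtensor)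
qed (simp_all add: tensor_linear)

lemma tlflip_hom: "f \<in> tl_hom m n \<Longrightarrow> tlflip f \<in> tl_hom n m"
  by (induction f rule: tl_hom_induct) (simp_all add: tl_hom_add tl_hom_scale tl_hom_dg dflip_tl)

section \<open>Jones--Wenzl idempotents\<close>

locale temperley_lieb =
  fixes A :: complex
  assumes A_nonzero: "A \<noteq> 0" and Delta_nonzero: "\<And>n. Delta A n \<noteq> 0"
begin

abbreviation tl_compA (infixl "\<odot>" 70) where "f \<odot> g \<equiv> tl_comp A f g"
abbreviation \<delta> where "\<delta> \<equiv> loop_value A"
abbreviation \<Delta> where "\<Delta> \<equiv> Delta A"

lemma Delta_0: "\<Delta> 0 = 1"
  by (simp add: Delta_def)

lemma Delta_1: "\<Delta> (Suc 0) = \<delta>"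
  using A_nonzero by (simp add: Delta_def loop_value_def power_int_minus power2_eq_square numeral_2_eq_2)

text \<open>The Chebyshev recursion; it lets ratios of successive values appear as partial traces of
  Jones-Wenzl idempotents.\<close>

lemma Delta_Suc_Suc: "\<Delta> (Suc (Suc n)) = \<delta> * \<Delta> (Suc n) - \<Delta> n"
proof -
  define S where "S k = (\<Sum>s=0..k. A powi (2 * int k - 4 * int s))" for k
  have up: "A ^ 2 * A powi a = A powi (a + 2)" for a
    using power_int_add[of A a 2] A_nonzero by simp
  have down: "inverse A ^ 2 * A powi a = A powi (a - 2)" for a
    using power_int_diff[of A a 2] A_nonzero by (simp add: field_simps)
  \<comment> \<open>Multiplication by \<open>A ^ 2\<close> gives the sum for \<open>n + 2\<close>
    without its last term, and multiplication by \<open>inverse A ^ 2\<close> gives the sum for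
    \<open>n\<close> with one extra term. The missing and the extra term coincide.\<close>
  have "A ^ 2 * S (Suc n) = (\<Sum>s=0..Suc n. A powi (2 * int (Suc (Suc n)) - 4 * int s))"
    unfolding S_def sum_distrib_left up by (intro sum.cong refl arg_cong[of _ _ "\<lambda>k. A powi k"]) simp
  then have 1: "A ^ 2 * S (Suc n) = S (Suc (Suc n)) - A powi (2 * int (Suc (Suc n)) - 4 * int (Suc (Suc n)))"
    unfolding S_def sum.atLeast0_atMost_Suc[of _ "Suc n"] by (simp only: add_diff_cancel_right')
  have "inverse A ^ 2 * S (Suc n) = (\<Sum>s=0..Suc n. A powi (2 * int n - 4 * int s))"
    unfolding S_def sum_distrib_left down by (intro sum.cong refl arg_cong[of _ _ "\<lambda>k. A powi k"]) simp
  then have "inverse A ^ 2 * S (Suc n) = S n + A powi (2 * int n - 4 * int (Suc n))"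
    unfolding S_def sum.atLeast0_atMost_Suc[of _ n] .
  moreover have "2 * int (Suc (Suc n)) - 4 * int (Suc (Suc n)) = 2 * int n - 4 * int (Suc n)" by simp
  ultimately have 2: "inverse A ^ 2 * S (Suc n) = S n + A powi (2 * int (Suc (Suc n)) - 4 * int (Suc (Suc n)))"
    by (simp only:)
  have D: "\<Delta> k = (-1) ^ k * S k" for k by (simp add: Delta_def S_def)
  have "(A ^ 2 + inverse A ^ 2) * S (Suc n) = S (Suc (Suc n)) + S n"
    unfolding distrib_right 1 2 by simp
  then have "S (Suc (Suc n)) = (A ^ 2 + inverse A ^ 2) * S (Suc n) - S n" by simp
  then show ?thesis unfolding D loop_value_def by (simp only:) (simp add: algebra_simps)
qed

lemma comp_reassoc: "x \<odot> y = z \<Longrightarrow> fin x \<Longrightarrow> fin y \<Longrightarrow> fin w \<Longrightarrow> x \<odot> (y \<odot> w) = z \<odot> w"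
  by (metis comp_assoc)

lemma cup_cap_loop: "cupm i j \<odot> capm i j = scale \<delta> (idt (i + j))"
proof -
  have base: "cupm 0 0 \<odot> capm 0 0 = scale \<delta> (idt 0)" by (simp add: comp_dg cup_cap loops_cup_cap)
  have "cupm i j = idt i \<otimes> (cupm 0 0 \<otimes> idt j)" "capm i j = idt i \<otimes> (capm 0 0 \<otimes> idt j)" by simp_all
  then have "cupm i j \<odot> capm i j = idt i \<otimes> ((cupm 0 0 \<odot> capm 0 0) \<otimes> idt j)"
    using idt_tensor_comp[of "cupm 0 0 \<otimes> idt j" "capm 0 0 \<otimes> idt j" A i]
      comp_tensor_idt[OF tl_hom_cupm[OF refl refl] tl_hom_capm[OF refl refl], of A 0 0 j] by simp
  then show ?thesis by (simp add: base tensor_linear)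
qed

lemma cup_cap_right1: "cupm i (Suc j) \<odot> capm (Suc i) j = idt (Suc (i + j))"
proof -
  have base: "cupm 0 1 \<odot> capm 1 0 = idt 1" using zigzag loops_zigzag by (simp add: comp_dg)
  have "cupm i (Suc j) = idt i \<otimes> (cupm 0 1 \<otimes> idt j)" "capm (Suc i) j = idt i \<otimes> (capm 1 0 \<otimes> idt j)" by simp_all
  then have "cupm i (Suc j) \<odot> capm (Suc i) j = idt i \<otimes> ((cupm 0 1 \<odot> capm 1 0) \<otimes> idt j)"
    using idt_tensor_comp[of "cupm 0 1 \<otimes> idt j" "capm 1 0 \<otimes> idt j" A i]
      comp_tensor_idt[OF tl_hom_cupm[of 1 0 1 3] tl_hom_capm[of 1 1 0 3], of A j] by simp
  then show ?thesis unfolding base by simp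
qed

lemma cup_cap_left1: "cupm (Suc i) j \<odot> capm i (Suc j) = idt (Suc (i + j))"
  using arg_cong[OF cup_cap_right1[of i j], of tlflip] by (simp add: tlflip_comp)

text \<open>The right ideal generated by turn-backs on the top line. Scalars can be absorbed into
  \<open>y\<close>, so closure under addition is enough.\<close>

inductive cap_ideal :: "nat \<Rightarrow> nat \<Rightarrow> tl \<Rightarrow> bool" where
  zero: "cap_ideal n m 0"
| add: "cap_ideal n m f \<Longrightarrow> cap_ideal n m g \<Longrightarrow> cap_ideal n m (f + g)"
| cap: "y \<in> tl_hom (i + j) m \<Longrightarrow> n = i + 2 + j \<Longrightarrow> cap_ideal n m (capm i j \<odot> y)"

lemma cap_ideal_hom: "cap_ideal n m f \<Longrightarrow> f \<in> tl_hom n m"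
proof (induction rule: cap_ideal.induct)
  case (cap y i j m n)
  then show ?case using tl_hom_comp[OF tl_hom_capm[OF refl refl]] by blast
qed (simp_all add: tl_hom_add)

lemma cap_ideal_capm: "y \<in> tl_hom l m \<Longrightarrow> l = i + j \<Longrightarrow> n = i + 2 + j \<Longrightarrow> cap_ideal n m (capm i j \<odot> y)"
  using cap_ideal.cap by simp

lemma cap_ideal_scale: "cap_ideal n m f \<Longrightarrow> cap_ideal n m (scale c f)"
proof (induction rule: cap_ideal.induct)
  case (cap y i j m n)
  then show ?case using cap_ideal.cap[of "scale c y" i j m n] by (simp add: comp_linear tl_hom_scale)
qed (simp_all add: cap_ideal.zero cap_ideal.add lin.scale_right_distrib)

lemma cap_ideal_diff: "cap_ideal n m f \<Longrightarrow> cap_ideal n m g \<Longrightarrow> cap_ideal n m (f - g)"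
  using cap_ideal.add[of n m f "scale (-1) g"] cap_ideal_scale[of n m g "-1"] by simp

lemma cap_ideal_comp: "cap_ideal n m f \<Longrightarrow> g \<in> tl_hom m k \<Longrightarrow> cap_ideal n k (f \<odot> g)"
proof (induction rule: cap_ideal.induct)
  case (cap y i j m n)
  then show ?case
    using cap_ideal.cap[of "y \<odot> g" i j k n] by (simp add: comp_assoc tl_hom_comp)
qed (simp_all add: cap_ideal.zero cap_ideal.add comp_linear)

lemma cap_ideal_tensor: "cap_ideal n m f \<Longrightarrow> cap_ideal (n + k) (m + k) (f \<otimes> idt k)"
proof (induction rule: cap_ideal.induct)
  case (cap y i j m n)
  have "(capm i j \<odot> y) \<otimes> idt k = capm i (j + k) \<odot> (y \<otimes> idt k)"
    using comp_tensor_idt[OF tl_hom_capm[OF refl refl] cap(1), of A k] by simp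
  moreover have "cap_ideal (n + k) (m + k) (capm i (j + k) \<odot> (y \<otimes> idt k))"
    by (rule cap_ideal_capm[OF tl_hom_tensor[OF cap(1) tl_hom_idt refl refl]]) (simp_all add: cap(2))
  ultimately show ?case by simp
qed (simp_all add: cap_ideal.zero cap_ideal.add tensor_linear)

lemma cap_ideal_tensor': "cap_ideal n m f \<Longrightarrow> cap_ideal (k + n) (k + m) (idt k \<otimes> f)"
proof (induction rule: cap_ideal.induct)
  case (cap y i j m n)
  have "idt k \<otimes> (capm i j \<odot> y) = capm (k + i) j \<odot> (idt k \<otimes> y)"
    using idt_tensor_comp[of "capm i j" y A k] cap by simp
  moreover have "cap_ideal (k + n) (k + m) (capm (k + i) j \<odot> (idt k \<otimes> y))"
    by (rule cap_ideal_capm[OF tl_hom_tensor[OF tl_hom_idt cap(1) refl refl]]) (simp_all add: cap(2))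
  ultimately show ?case by simp
qed (simp_all add: cap_ideal.zero cap_ideal.add tensor_linear)

definition kills_caps :: "nat \<Rightarrow> tl \<Rightarrow> bool" where
  "kills_caps n f \<longleftrightarrow> fin f \<and> (\<forall>i j. i + 2 + j = n \<longrightarrow> f \<odot> capm i j = 0)"

lemma kills_capsD: "kills_caps n f \<Longrightarrow> cap_ideal n m g \<Longrightarrow> f \<odot> g = 0"
proof (rotate_tac, induction rule: cap_ideal.induct)
  case (cap y i j m n)
  then have "f \<odot> capm i j = 0" "fin f" by (auto simp: kills_caps_def)
  then show ?case using comp_reassoc[of f "capm i j" 0 y] cap by (simp add: comp_linear)
qed (simp_all add: comp_linear)

text \<open>Because \<open>f\<close> annihilates \<open>g - idt n\<close>. All absorption rules for
  idempotents follow this pattern: an element that kills turn-backs sees only the identity part of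
  \<open>g\<close>.\<close>

lemma kills_absorb:
  assumes "kills_caps n f" "cap_ideal n n (g - idt n)" "f \<in> tl_hom m n"
  shows "f \<odot> g = f"
  using kills_capsD[OF assms(1,2)] comp_idt_right[OF assms(3), of A] by (simp add: comp_linear)

text \<open>Wenzl's recursion. A cap followed by a cup is the Temperley-Lieb generator on the last
  two strands, and the coefficient is the one for which the last turn-back is killed.\<close>

fun wenzl :: "nat \<Rightarrow> tl" where
  "wenzl 0 = idt 0"
| "wenzl (Suc 0) = idt 1"
| "wenzl (Suc (Suc n)) = wenzl (Suc n) \<otimes> idt 1 -
    scale (\<Delta> n / \<Delta> (Suc n)) ((wenzl (Suc n) \<otimes> idt 1) \<odot> (capm n 0 \<odot> (cupm n 0 \<odot> (wenzl (Suc n) \<otimes> idt 1))))"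

declare wenzl.simps(3) [simp del]

lemma wenzl_hom [simp]: "wenzl n \<in> tl_hom n n"
proof (induction n rule: wenzl.induct)
  case (3 n)
  have w: "wenzl (Suc n) \<otimes> idt (Suc 0) \<in> tl_hom (Suc (Suc n)) (Suc (Suc n))"
    by (rule tl_hom_tensor[OF 3(1) tl_hom_idt[of "Suc 0"]]) simp_all
  have cap: "capm n 0 \<in> tl_hom (Suc (Suc n)) n" and cup: "cupm n 0 \<in> tl_hom n (Suc (Suc n))"
    by (auto intro: tl_hom_capm tl_hom_cupm)
  show ?case
    unfolding wenzl.simps One_nat_def
    by (rule tl_hom_diff[OF w tl_hom_scale[OF tl_hom_comp[OF w tl_hom_comp[OF cap tl_hom_comp[OF cup w]]]]])
qed simp_all

lemma wenzl_idt_hom: "a = n + k \<Longrightarrow> wenzl n \<otimes> idt k \<in> tl_hom a a"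
  by (rule tl_hom_tensor[OF wenzl_hom tl_hom_idt])

lemma fin_wenzl [simp]: "fin (wenzl n)"
  by (rule tl_hom_fin[OF wenzl_hom])

lemma wenzl_cap_ideal: "cap_ideal n n (wenzl n - idt n)"
proof (induction n rule: wenzl.induct)
  case (3 n)
  let ?p = "wenzl (Suc n) \<otimes> idt 1" and ?N = "Suc (Suc n)"
  have p: "?p \<in> tl_hom ?N ?N" by (rule tl_hom_tensor[OF wenzl_hom tl_hom_idt]) simp_all
  have c: "cap_ideal ?N ?N (?p - idt ?N)"
    using cap_ideal_tensor[OF 3(1), of 1] by (simp add: tensor_linear)
  let ?y = "cupm n 0 \<odot> ?p"
  have y: "?y \<in> tl_hom n ?N" by (rule tl_hom_comp[OF tl_hom_cupm[of n n 0] p]) simp_all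
  have cap: "cap_ideal ?N ?N (capm n 0 \<odot> ?y)"
    by (rule cap_ideal_capm[OF y]) simp_all
  \<comment> \<open>The factor \<open>?p\<close> in front of the cap is split into
    \<open>?p - idt ?N\<close>, which lies in the ideal, and the identity, which leaves the cap on
    top.\<close>
  have "cap_ideal ?N ?N ((?p - idt ?N) \<odot> (capm n 0 \<odot> ?y))"
    by (rule cap_ideal_comp[OF c cap_ideal_hom[OF cap]])
  then have "cap_ideal ?N ?N ((?p - idt ?N) \<odot> (capm n 0 \<odot> ?y) + capm n 0 \<odot> ?y)"
    using cap by (rule cap_ideal.add)
  then have "cap_ideal ?N ?N (?p \<odot> (capm n 0 \<odot> ?y))"
    using comp_idt_left[OF cap_ideal_hom[OF cap], of A] by (simp add: comp_linear)
  then have "cap_ideal ?N ?N ((?p - idt ?N) - scale (\<Delta> n / \<Delta> (Suc n)) (?p \<odot> (capm n 0 \<odot> ?y)))"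
    by (intro cap_ideal_diff c cap_ideal_scale)
  then show ?case unfolding wenzl.simps(3) by (simp add: algebra_simps)
qed (simp_all add: cap_ideal.zero)

lemma cupm_slide: "f \<in> tl_hom n n \<Longrightarrow> cupm n 0 \<odot> (f \<otimes> idt 2) = f \<odot> cupm n 0"
  using tensor_split[of f n n "cupm 0 0" 0 2 A] tl_hom_cupm[of 0 0 0 2] by simp

lemma capm_slide: "f \<in> tl_hom n n \<Longrightarrow> capm n 0 \<odot> f = (f \<otimes> idt 2) \<odot> capm n 0"
  using tensor_split[of f n n "capm 0 0" 2 0 A] tl_hom_capm[of 0 0 0 2] by simp

lemma wenzl_absorb_aux:
  "kills_caps n (wenzl n) \<Longrightarrow> i + k + j = n \<Longrightarrow> wenzl n \<odot> (idt i \<otimes> wenzl k \<otimes> idt j) = wenzl n"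
proof (rule kills_absorb[OF _ _ wenzl_hom])
  assume n: "i + k + j = n"
  have "cap_ideal (i + (k + j)) (i + (k + j)) (idt i \<otimes> (wenzl k - idt k) \<otimes> idt j)"
    by (intro cap_ideal_tensor' cap_ideal_tensor wenzl_cap_ideal)
  then show "cap_ideal n n (idt i \<otimes> wenzl k \<otimes> idt j - idt n)"
    using n by (simp add: tensor_linear add.assoc)
qed

text \<open>Turn-backs among the first \<open>n + 1\<close> strands are killed by the previous
  idempotent. At the last one, the partial trace \<open>tr\<close> contributes the inverse of the
  coefficient in the recursion, so the correction cancels the leading term.\<close>

lemma wenzl_Suc_kills:
  assumes k: "kills_caps (Suc n) (wenzl (Suc n))"
    and tr: "cupm n 0 \<odot> ((wenzl (Suc n) \<otimes> idt 1) \<odot> capm n 0) = scale (\<Delta> (Suc n) / \<Delta> n) (wenzl n)"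
  shows "kills_caps (Suc (Suc n)) (wenzl (Suc (Suc n)))"
proof -
  let ?P = "wenzl (Suc n)"
  let ?p = "?P \<otimes> idt 1" and ?c = "\<Delta> n / \<Delta> (Suc n)"
  have "wenzl (Suc (Suc n)) \<odot> capm i j = 0" if ij: "i + 2 + j = Suc (Suc n)" for i j
  proof (cases j)
    case 0
    then have i: "i = n" using ij by simp
    have "?p \<odot> (capm n 0 \<odot> wenzl n) = ?p \<odot> ((wenzl n \<otimes> idt 2) \<odot> capm n 0)"
      by (simp add: capm_slide)
    also have "\<dots> = (?p \<odot> (wenzl n \<otimes> idt 2)) \<odot> capm n 0" by (simp add: comp_assoc)
    also have "?p \<odot> (wenzl n \<otimes> idt 2) = ?p"
    proof -
      have "wenzl n \<otimes> idt 2 = (wenzl n \<otimes> idt 1) \<otimes> idt 1" by (simp add: tensor_assoc numeral_2_eq_2)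
      moreover have w1: "wenzl n \<otimes> idt 1 \<in> tl_hom (Suc n) (Suc n)"
        by (rule tl_hom_tensor[OF wenzl_hom tl_hom_idt]) simp_all
      ultimately show ?thesis
        using comp_tensor_idt[OF wenzl_hom w1, of A 1] wenzl_absorb_aux[OF k, of 0 n 1] by simp
    qed
    finally have absorb: "?p \<odot> (capm n 0 \<odot> wenzl n) = ?p \<odot> capm n 0" .
    have "wenzl (Suc (Suc n)) \<odot> capm n 0
        = ?p \<odot> capm n 0 - scale ?c (?p \<odot> (capm n 0 \<odot> (cupm n 0 \<odot> (?p \<odot> capm n 0))))"
      by (simp add: wenzl.simps(3) comp_linear comp_assoc)
    also have "\<dots> = 0"
      unfolding tr comp_linear absorb using Delta_nonzero by simp
    finally show ?thesis using i 0 by simp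
  next
    case (Suc j')
    have "capm i j = capm i j' \<otimes> idt 1" using Suc by simp
    moreover have "capm i j' \<in> tl_hom (Suc n) (i + j')" using ij Suc by (intro tl_hom_capm) simp_all
    ultimately have "?p \<odot> capm i j = (?P \<odot> capm i j') \<otimes> idt 1"
      using comp_tensor_idt[OF wenzl_hom, of "capm i j'" "Suc n" "i + j'" A 1] by simp
    moreover have "?P \<odot> capm i j' = 0" using k ij Suc by (simp add: kills_caps_def)
    ultimately have "?p \<odot> capm i j = 0" by (simp add: tensor_linear)
    then show ?thesis by (simp add: wenzl.simps(3) comp_linear comp_assoc)
  qed
  then show ?thesis by (simp add: kills_caps_def)
qed

lemma wenzl_idem_aux: "kills_caps n (wenzl n) \<Longrightarrow> wenzl n \<odot> wenzl n = wenzl n"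
  by (rule kills_absorb[OF _ wenzl_cap_ideal wenzl_hom])

text \<open>Closing the last strand gives a loop minus a curve that straightens by two zigzags, and
  the coefficients combine by the recursion for \<open>Delta\<close>. This argument uses the killing
  property at \<open>Suc n\<close>, while \<open>wenzl_Suc_kills\<close> uses the trace;
  \<open>wenzl_main\<close> advances both together.\<close>

lemma wenzl_Suc_trace:
  assumes k: "kills_caps (Suc n) (wenzl (Suc n))"
  shows "cupm (Suc n) 0 \<odot> ((wenzl (Suc (Suc n)) \<otimes> idt 1) \<odot> capm (Suc n) 0)
    = scale (\<Delta> (Suc (Suc n)) / \<Delta> (Suc n)) (wenzl (Suc n))"
proof -
  let ?P = "wenzl (Suc n)"
  let ?p = "?P \<otimes> idt 1" and ?p2 = "?P \<otimes> idt 2" and ?c = "\<Delta> n / \<Delta> (Suc n)"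
  let ?N = "Suc (Suc n)"
  have p: "?p \<in> tl_hom ?N ?N" by (rule tl_hom_tensor[OF wenzl_hom tl_hom_idt]) simp_all
  have p2: "?p \<otimes> idt 1 = ?p2" by (simp add: tensor_assoc numeral_2_eq_2)
  have cap: "capm n 0 \<in> tl_hom ?N n" and cup: "cupm n 0 \<in> tl_hom n ?N"
    by (auto intro: tl_hom_capm tl_hom_cupm)
  have cup': "cupm n 0 \<odot> ?p \<in> tl_hom n ?N" by (rule tl_hom_comp[OF cup p])
  have "(?p \<odot> (capm n 0 \<odot> (cupm n 0 \<odot> ?p))) \<otimes> idt 1 = ?p2 \<odot> (capm n 1 \<odot> (cupm n 1 \<odot> ?p2))"
    using comp_tensor_idt[OF p tl_hom_comp[OF cap cup'], of A 1] comp_tensor_idt[OF cap cup', of A 1]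
      comp_tensor_idt[OF cup p, of A 1] p2 by simp
  then have "wenzl ?N \<otimes> idt 1 = ?p2 - scale ?c (?p2 \<odot> (capm n 1 \<odot> (cupm n 1 \<odot> ?p2)))"
    unfolding wenzl.simps(3) by (simp add: tensor_linear p2[simplified])
  then have eq: "cupm (Suc n) 0 \<odot> ((wenzl ?N \<otimes> idt 1) \<odot> capm (Suc n) 0) =
     cupm (Suc n) 0 \<odot> (?p2 \<odot> capm (Suc n) 0) -
     scale ?c (cupm (Suc n) 0 \<odot> (?p2 \<odot> (capm n 1 \<odot> (cupm n 1 \<odot> (?p2 \<odot> capm (Suc n) 0)))))"
    by (simp add: comp_linear comp_assoc)
  have s1: "?p2 \<odot> capm (Suc n) 0 = capm (Suc n) 0 \<odot> ?P" by (simp add: capm_slide)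
  have "cupm (Suc n) 0 \<odot> (capm (Suc n) 0 \<odot> ?P) = scale \<delta> ?P"
    using comp_reassoc[OF cup_cap_loop[of "Suc n" 0], of ?P] comp_idt_left[OF wenzl_hom, of A "Suc n"]
    by (simp add: comp_linear)
  moreover have "cupm (Suc n) 0 \<odot> (?p2 \<odot> (capm n 1 \<odot> (cupm n 1 \<odot> (capm (Suc n) 0 \<odot> ?P)))) = ?P"
  proof -
    have "cupm n 1 \<odot> (capm (Suc n) 0 \<odot> ?P) = ?P"
      using comp_reassoc[OF cup_cap_right1[of n 0], of ?P] comp_idt_left[OF wenzl_hom, of A "Suc n"] by simp
    moreover have "cupm (Suc n) 0 \<odot> (?p2 \<odot> (capm n 1 \<odot> ?P)) = ?P \<odot> (cupm (Suc n) 0 \<odot> (capm n 1 \<odot> ?P))"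
      using comp_reassoc[OF cupm_slide[OF wenzl_hom, of "Suc n"], of "capm n 1 \<odot> ?P"]
      by (simp add: comp_assoc)
    moreover have "cupm (Suc n) 0 \<odot> (capm n 1 \<odot> ?P) = ?P"
      using comp_reassoc[OF cup_cap_left1[of n 0], of ?P] comp_idt_left[OF wenzl_hom, of A "Suc n"] by simp
    ultimately show ?thesis using wenzl_idem_aux[OF k] by simp
  qed
  ultimately have "cupm (Suc n) 0 \<odot> ((wenzl ?N \<otimes> idt 1) \<odot> capm (Suc n) 0) = scale \<delta> ?P - scale ?c ?P"
    unfolding eq s1 by simp
  also have "\<dots> = scale (\<Delta> ?N / \<Delta> (Suc n)) ?P"
    using Delta_nonzero[of "Suc n"]
    by (simp add: lin.scale_left_diff_distrib[symmetric] Delta_Suc_Suc diff_divide_distrib)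
  finally show ?thesis .
qed

lemma wenzl_main: "kills_caps n (wenzl n) \<and> kills_caps (Suc n) (wenzl (Suc n)) \<and>
  cupm n 0 \<odot> ((wenzl (Suc n) \<otimes> idt 1) \<odot> capm n 0) = scale (\<Delta> (Suc n) / \<Delta> n) (wenzl n)"
proof (induction n)
  case 0
  have "idt 2 \<odot> capm 0 0 = capm 0 0" by (rule comp_idt_left[OF tl_hom_capm[of 0]]) simp_all
  then show ?case
    using cup_cap_loop[of 0 0] by (simp add: kills_caps_def Delta_0 Delta_1 numeral_2_eq_2)
next
  case (Suc n)
  then show ?case using wenzl_Suc_kills wenzl_Suc_trace by blast
qed

lemma wenzl_kills: "kills_caps n (wenzl n)"
  using wenzl_main by blast

lemma wenzl_trace: "cupm n 0 \<odot> ((wenzl (Suc n) \<otimes> idt 1) \<odot> capm n 0) = scale (\<Delta> (Suc n) / \<Delta> n) (wenzl n)"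
  using wenzl_main by blast

lemma wenzl_idem: "wenzl n \<odot> wenzl n = wenzl n"
  using wenzl_idem_aux wenzl_kills by blast

lemma wenzl_flip [simp]: "tlflip (wenzl n) = wenzl n"
  by (induction n rule: wenzl.induct) (simp_all add: wenzl.simps(3) tlflip_comp tlflip_tensor comp_assoc)

lemma wenzl_absorb: "i + k + j = n \<Longrightarrow> wenzl n \<odot> (idt i \<otimes> wenzl k \<otimes> idt j) = wenzl n"
  using wenzl_absorb_aux wenzl_kills by blast

text \<open>Its partial trace is a nonzero multiple of the previous idempotent, since no
  \<open>Delta A n\<close> vanishes.\<close>

lemma wenzl_nonzero: "wenzl n \<noteq> 0"
proof (induction n)
  case 0
  have "Poly_Mapping.lookup (wenzl 0) (did 0) = 1" by (simp add: dg_def)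
  then show ?case by auto
next
  case (Suc n)
  show ?case
  proof
    assume "wenzl (Suc n) = 0"
    then have "scale (\<Delta> (Suc n) / \<Delta> n) (wenzl n) = 0"
      using wenzl_trace[of n] by (simp add: tensor_linear comp_linear)
    then show False using Suc Delta_nonzero by (simp add: lin.scale_eq_0_iff)
  qed
qed

lemma wenzl_capm: "i + 2 + j = n \<Longrightarrow> wenzl n \<odot> capm i j = 0"
  using wenzl_kills by (simp add: kills_caps_def)

lemma cupm_wenzl: "i + 2 + j = n \<Longrightarrow> cupm i j \<odot> wenzl n = 0"
  using arg_cong[OF wenzl_capm[of i j n], of tlflip] by (simp add: tlflip_comp)

text \<open>A diagram other than an identity has a turn-back that can be moved next to one of the
  idempotents, which kills it.\<close>

lemma schur_diagram:
  assumes "d \<in> tl_diagrams m n"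
  shows "\<exists>\<alpha>. wenzl m \<odot> (dg d \<odot> wenzl n) = scale \<alpha> (if m = n then wenzl n else 0)"
  using assms
proof (induction m n d rule: tl_diagrams_induct)
  case (id n)
  show ?case
    by (rule exI[of _ 1]) (simp add: comp_idt_left[OF wenzl_hom] wenzl_idem)
next
  case (cap i j n d)
  have "dg (dcomp (capd i j) d) = capm i j \<odot> dg d"
    using dcomp_capd_tl(2)[OF cap(1)] by (simp add: comp_dg)
  moreover have "fin (dg d)" using cap(1) tl_hom_dg tl_hom_fin by blast
  ultimately have "wenzl (i + 2 + j) \<odot> (dg (dcomp (capd i j) d) \<odot> wenzl n)
      = (wenzl (i + 2 + j) \<odot> capm i j) \<odot> (dg d \<odot> wenzl n)"
    by (simp add: comp_assoc)
  also have "\<dots> = 0" unfolding wenzl_capm[OF refl] by (simp add: comp_linear)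
  finally show ?case by (intro exI[of _ 0]) simp
next
  case (cup m i j d)
  have "dg (dcomp d (cupd i j)) = dg d \<odot> cupm i j"
    using dcomp_cupd_tl(2)[OF cup(1)] by (simp add: comp_dg)
  moreover have "fin (dg d)" using cup(1) tl_hom_dg tl_hom_fin by blast
  ultimately have "wenzl m \<odot> (dg (dcomp d (cupd i j)) \<odot> wenzl (i + 2 + j))
      = wenzl m \<odot> (dg d \<odot> (cupm i j \<odot> wenzl (i + 2 + j)))"
    by (simp add: comp_assoc)
  also have "\<dots> = 0" unfolding cupm_wenzl[OF refl] by (simp add: comp_linear)
  finally show ?case by (intro exI[of _ 0]) simp
qed

lemma schur:
  assumes "f \<in> tl_hom m n"
  shows "\<exists>\<alpha>. wenzl m \<odot> (f \<odot> wenzl n) = (if m = n then scale \<alpha> (wenzl n) else 0)"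
proof -
  have "\<exists>\<alpha>. wenzl m \<odot> (f \<odot> wenzl n) = scale \<alpha> (if m = n then wenzl n else 0)"
    by (rule tl_hom_ex_scale[OF assms, where F = "\<lambda>f. wenzl m \<odot> (f \<odot> wenzl n)"])
      (simp_all add: comp_linear schur_diagram)
  then show ?thesis by (cases "m = n") simp_all
qed

lemma is_jones_wenzl_wenzl: "is_jones_wenzl A n (wenzl n)"
  unfolding is_jones_wenzl_def cupm_def[symmetric] capm_def[symmetric]
  using wenzl_nonzero wenzl_idem wenzl_capm cupm_wenzl wenzl_hom by blast

text \<open>Absorption of \<open>wenzl n\<close> on the right, and by reflection on the left, makes
  \<open>f\<close> a multiple of \<open>wenzl n\<close> by Schur's lemma; idempotency and
  \<open>f \<noteq> 0\<close> force the factor 1.\<close>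

lemma is_jones_wenzl_unique: "is_jones_wenzl A n f \<Longrightarrow> f = wenzl n"
proof -
  assume "is_jones_wenzl A n f"
  then have hom: "f \<in> tl_hom n n" and ne: "f \<noteq> 0" and idem: "f \<odot> f = f"
    and kill: "\<And>i j. i + 2 + j = n \<Longrightarrow> f \<odot> capm i j = 0 \<and> cupm i j \<odot> f = 0"
    unfolding is_jones_wenzl_def cupm_def[symmetric] capm_def[symmetric] by auto
  have "kills_caps n f" using hom kill by (simp add: kills_caps_def)
  then have r: "f \<odot> wenzl n = f" by (rule kills_absorb[OF _ wenzl_cap_ideal hom])
  have "tlflip f \<odot> capm i j = 0" if "i + 2 + j = n" for i j
    using arg_cong[OF conjunct2[OF kill[OF that]], of tlflip] by (simp add: tlflip_comp)
  then have "kills_caps n (tlflip f)" using tlflip_hom[OF hom] by (simp add: kills_caps_def)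
  then have "tlflip f \<odot> wenzl n = tlflip f" by (rule kills_absorb[OF _ wenzl_cap_ideal tlflip_hom[OF hom]])
  from arg_cong[OF this, of tlflip] have "wenzl n \<odot> f = f" by (simp add: tlflip_comp)
  then obtain \<alpha> where \<alpha>: "f = scale \<alpha> (wenzl n)" using schur[OF hom] r by auto
  then have "scale (\<alpha> * \<alpha> - \<alpha>) (wenzl n) = 0"
    using idem by (simp add: comp_linear wenzl_idem lin.scale_left_diff_distrib)
  then have "\<alpha> * \<alpha> = \<alpha>" using wenzl_nonzero by (simp add: lin.scale_eq_0_iff)
  moreover have "\<alpha> \<noteq> 0" using ne \<alpha> by auto
  ultimately show ?thesis using \<alpha> by simp
qed

lemma jw_wenzl: "jw A n = wenzl n"
  unfolding jw_def using is_jones_wenzl_wenzl is_jones_wenzl_unique by (rule the_equality)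

end

section \<open>Fusion\<close>

lemma dcap_0 [simp]: "dcap 0 = did 0" and dcup_0 [simp]: "dcup 0 = did 0"
  by (simp_all add: dcap_def dcup_def did_def)

lemma dcup_Suc_comp: "dg (dcup (Suc n)) = tl_comp A (dg (dcup n)) (cupm n n)"
  using dcup_Suc[of n] dcomp_cupd_tl(2)[of "dcup n" 0 n n] by (simp add: comp_dg mult_2)

lemma dcap_Suc_comp: "dg (dcap (Suc n)) = tl_comp A (capm n n) (dg (dcap n))"
  using arg_cong[OF dcup_Suc_comp[of n A], of tlflip] by (simp add: tlflip_comp)

text \<open>\<open>x\<close>, \<open>y\<close>, \<open>z\<close> count the strands joining the legs
  pairwise. They replace halved and truncated differences in later computations with
  vertices.\<close>

lemma admissible_iff: "admissible a b c \<longleftrightarrow> (\<exists>x y z. a = x + z \<and> b = x + y \<and> c = y + z)"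
proof
  assume adm: "admissible a b c"
  then obtain s where s: "a + b + c = 2 * s" unfolding admissible_def by (metis evenE)
  then have "a = (s - c) + (s - b) \<and> b = (s - c) + (s - a) \<and> c = (s - a) + (s - b)"
    using adm unfolding admissible_def by linarith
  then show "\<exists>x y z. a = x + z \<and> b = x + y \<and> c = y + z" by blast
qed (auto simp: admissible_def)

lemma finite_admissible: "finite {a. admissible a b c}"
  by (rule finite_subset[of _ "{..b + c}"]) (auto simp: admissible_def)

definition Dcap :: "nat \<Rightarrow> nat \<Rightarrow> nat \<Rightarrow> tl" where
  "Dcap x y z = idt x \<otimes> dg (dcap y) \<otimes> idt z"

definition Dcup :: "nat \<Rightarrow> nat \<Rightarrow> nat \<Rightarrow> tl" where
  "Dcup x y z = idt x \<otimes> dg (dcup y) \<otimes> idt z"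

lemma Dcap_hom: "m = x + y + (y + z) \<Longrightarrow> n = x + z \<Longrightarrow> Dcap x y z \<in> tl_hom m n"
  unfolding Dcap_def
  by (rule tl_hom_tensor[OF tl_hom_idt tl_hom_tensor[OF tl_hom_dcap[OF refl] tl_hom_idt refl refl]]) simp_all

lemma Dcup_hom: "m = x + y + (y + z) \<Longrightarrow> n = x + z \<Longrightarrow> Dcup x y z \<in> tl_hom n m"
  unfolding Dcup_def
  by (rule tl_hom_tensor[OF tl_hom_idt tl_hom_tensor[OF tl_hom_dcup[OF refl] tl_hom_idt refl refl]]) simp_all

lemma fin_Dcap [simp]: "fin (Dcap x y z)" and fin_Dcup [simp]: "fin (Dcup x y z)"
  using tl_hom_fin Dcap_hom[OF refl refl] Dcup_hom[OF refl refl] by blast+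

lemma tlflip_Dcap [simp]: "tlflip (Dcap x y z) = Dcup x y z" and tlflip_Dcup [simp]: "tlflip (Dcup x y z) = Dcap x y z"
  by (simp_all add: Dcap_def Dcup_def tlflip_tensor)

lemma capm_Dcap: "tl_comp A (capm (x + y) (y + z)) (Dcap x y z) = Dcap x (Suc y) z"
proof -
  have cap: "capm (x + y) (y + z) = idt x \<otimes> (capm y y \<otimes> idt z)" by simp
  have "tl_comp A (capm y y \<otimes> idt z) (dg (dcap y) \<otimes> idt z) = dg (dcap (Suc y)) \<otimes> idt z"
    using comp_tensor_idt[OF tl_hom_capm[of "2 * y" y y] tl_hom_dcap[OF refl, of y], where A = A and n = z] dcap_Suc_comp[of y A]
    by simp
  then show ?thesis
    unfolding cap Dcap_def using idt_tensor_comp[of "capm y y \<otimes> idt z" "dg (dcap y) \<otimes> idt z" A x]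
    by (simp del: capm_tensor)
qed

text \<open>A nest of caps is cut into the \<open>m\<close> inner arcs, closed first, and the
  \<open>n\<close> arcs around them.\<close>

lemma dcap_add: "dg (dcap (m + n)) = tl_comp A (Dcap n m n) (dg (dcap n))"
proof (induction m)
  case 0
  then show ?case using comp_idt_left[OF tl_hom_dcap[of "n + n" n], of A] by (simp add: Dcap_def mult_2)
next
  case (Suc m)
  have "dg (dcap (Suc m + n)) = tl_comp A (capm (m + n) (m + n)) (dg (dcap (m + n)))"
    using dcap_Suc_comp[of "m + n" A] by simp
  then show ?case
    unfolding Suc using capm_Dcap[of A n m n] by (simp add: comp_assoc[symmetric] add.commute)
qed

context temperley_lieb
begin

section \<open>Trivalent vertices and the idempotents on their legs\<close>

lemma split_vertex_xyz: "split_vertex A (x + z) (x + y) (y + z) =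
    wenzl (x + z) \<odot> (Dcup x y z \<odot> (wenzl (x + y) \<otimes> wenzl (y + z)))"
proof -
  have "x + z + (x + y) - (y + z) = 2 * x" "x + y + (y + z) - (x + z) = 2 * y" "x + z + (y + z) - (x + y) = 2 * z"
    by simp_all
  moreover have "admissible (x + z) (x + y) (y + z)" using admissible_iff by blast
  ultimately show ?thesis by (simp add: split_vertex_def Dcup_def jw_wenzl del: add_diff_cancel_right add_diff_cancel_left)
qed

lemma merge_vertex_xyz: "merge_vertex A (x + y) (y + z) (x + z) =
    (wenzl (x + y) \<otimes> wenzl (y + z)) \<odot> (Dcap x y z \<odot> wenzl (x + z))"
proof -
  have "x + z + (x + y) - (y + z) = 2 * x" "x + y + (y + z) - (x + z) = 2 * y" "x + z + (y + z) - (x + y) = 2 * z"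
    by simp_all
  moreover have "admissible (x + z) (x + y) (y + z)" using admissible_iff by blast
  ultimately show ?thesis by (simp add: merge_vertex_def Dcap_def jw_wenzl del: add_diff_cancel_right add_diff_cancel_left)
qed

lemma merge_vertex_0: "\<not> admissible a b c \<Longrightarrow> merge_vertex A b c a = 0"
  and split_vertex_0: "\<not> admissible a b c \<Longrightarrow> split_vertex A a b c = 0"
  by (simp_all add: merge_vertex_def split_vertex_def)

lemma wenzl_tensor_hom: "k = b + c \<Longrightarrow> wenzl b \<otimes> wenzl c \<in> tl_hom k k"
  by (rule tl_hom_tensor[OF wenzl_hom wenzl_hom])

lemma wenzl_tensor_idem: "(wenzl b \<otimes> wenzl c) \<odot> (wenzl b \<otimes> wenzl c) = wenzl b \<otimes> wenzl c"
  by (simp add: interchange[OF wenzl_hom wenzl_hom] wenzl_idem)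

lemma merge_hom: "merge_vertex A b c a \<in> tl_hom (b + c) a"
proof (cases "admissible a b c")
  case True
  then obtain x y z where abc: "a = x + z" "b = x + y" "c = y + z" using admissible_iff by blast
  show ?thesis
    unfolding abc merge_vertex_xyz
    by (rule tl_hom_comp[OF wenzl_tensor_hom[OF refl] tl_hom_comp[OF Dcap_hom[OF refl refl] wenzl_hom]])
qed (simp add: merge_vertex_0)

lemma tlflip_merge: "tlflip (merge_vertex A b c a) = split_vertex A a b c"
proof (cases "admissible a b c")
  case True
  then obtain x y z where abc: "a = x + z" "b = x + y" "c = y + z" using admissible_iff by blast
  show ?thesis unfolding abc merge_vertex_xyz split_vertex_xyz by (simp add: tlflip_comp tlflip_tensor comp_assoc)
qed (simp add: merge_vertex_0 split_vertex_0)

lemma split_hom: "split_vertex A a b c \<in> tl_hom a (b + c)"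
  using tlflip_hom[OF merge_hom] by (simp add: tlflip_merge)

lemma fin_merge [simp]: "fin (merge_vertex A b c a)" and fin_split [simp]: "fin (split_vertex A a b c)"
  using tl_hom_fin merge_hom split_hom by blast+

lemma merge_absorb: "(wenzl b \<otimes> wenzl c) \<odot> merge_vertex A b c a = merge_vertex A b c a"
  "merge_vertex A b c a \<odot> wenzl a = merge_vertex A b c a"
proof -
  have "(wenzl b \<otimes> wenzl c) \<odot> merge_vertex A b c a = merge_vertex A b c a \<and> merge_vertex A b c a \<odot> wenzl a = merge_vertex A b c a"
  proof (cases "admissible a b c")
    case True
    then obtain x y z where abc: "a = x + z" "b = x + y" "c = y + z" using admissible_iff by blast
    show ?thesis
      unfolding abc merge_vertex_xyz
      using comp_reassoc[OF wenzl_tensor_idem[of "x + y" "y + z"], of "Dcap x y z \<odot> wenzl (x + z)"]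
      by (simp add: comp_assoc wenzl_idem)
  qed (simp add: merge_vertex_0 comp_linear)
  then show "(wenzl b \<otimes> wenzl c) \<odot> merge_vertex A b c a = merge_vertex A b c a"
    "merge_vertex A b c a \<odot> wenzl a = merge_vertex A b c a" by auto
qed

lemma split_absorb: "split_vertex A a b c \<odot> (wenzl b \<otimes> wenzl c) = split_vertex A a b c"
  "wenzl a \<odot> split_vertex A a b c = split_vertex A a b c"
  using arg_cong[OF merge_absorb(1)[of b c a], of tlflip] arg_cong[OF merge_absorb(2)[of b c a], of tlflip]
  by (simp_all add: tlflip_comp tlflip_tensor tlflip_merge)

text \<open>The cap joins the neighbouring strands of the two bundles, so the smaller idempotents
  slide up past it into the larger ones. This allows idempotents to be reinserted after one pair of
  strands has been joined, as the induction in \<open>merge_diagram\<close> requires.\<close>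

lemma wenzl_tensor_capm_absorb:
  "(wenzl (Suc i) \<otimes> wenzl (Suc j)) \<odot> (capm i j \<odot> (wenzl i \<otimes> wenzl j)) = (wenzl (Suc i) \<otimes> wenzl (Suc j)) \<odot> capm i j"
proof -
  let ?r = "idt 1 \<otimes> wenzl j"
  have wj: "capm 0 j \<odot> wenzl j = (idt 2 \<otimes> wenzl j) \<odot> capm 0 j"
    using tensor_split[OF tl_hom_capm[of 0 0 0 2] wenzl_hom[of j], of A] by simp
  have slide: "capm i j \<odot> (wenzl i \<otimes> wenzl j) = (wenzl i \<otimes> (idt 2 \<otimes> wenzl j)) \<odot> capm i j"
  proof -
    have cap: "capm i j = idt i \<otimes> capm 0 j" by simp
    have "capm i j \<odot> (wenzl i \<otimes> wenzl j) = (idt i \<odot> wenzl i) \<otimes> (capm 0 j \<odot> wenzl j)"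
      unfolding cap by (rule interchange[OF tl_hom_idt wenzl_hom]) simp_all
    also have "\<dots> = (wenzl i \<odot> idt i) \<otimes> ((idt 2 \<otimes> wenzl j) \<odot> capm 0 j)"
      unfolding wj by (simp add: comp_idt_left[OF wenzl_hom] comp_idt_right[OF wenzl_hom])
    also have "\<dots> = (wenzl i \<otimes> (idt 2 \<otimes> wenzl j)) \<odot> capm i j"
      unfolding cap by (rule interchange[OF wenzl_hom tl_hom_idt, symmetric]) simp_all
    finally show ?thesis .
  qed
  have "wenzl i \<otimes> (idt 2 \<otimes> wenzl j) = (wenzl i \<otimes> idt 1) \<otimes> ?r"
    by (simp add: tensor_assoc numeral_2_eq_2)
  moreover have "(wenzl (Suc i) \<otimes> wenzl (Suc j)) \<odot> ((wenzl i \<otimes> idt 1) \<otimes> ?r) =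
      (wenzl (Suc i) \<odot> (wenzl i \<otimes> idt 1)) \<otimes> (wenzl (Suc j) \<odot> ?r)"
    by (rule interchange[OF wenzl_hom wenzl_idt_hom]) simp_all
  moreover have "wenzl (Suc i) \<odot> (wenzl i \<otimes> idt 1) = wenzl (Suc i)" using wenzl_absorb[of 0 i 1] by simp
  moreover have "wenzl (Suc j) \<odot> ?r = wenzl (Suc j)" using wenzl_absorb[of 1 j 0] by simp
  ultimately show ?thesis unfolding slide by (simp add: comp_assoc[symmetric])
qed

text \<open>A cap that does not join the two bundles lies inside one of them and is killed
  there.\<close>

lemma wenzl_tensor_capm:
  assumes "b + c = i + 2 + j" "Suc i \<noteq> b"
  shows "(wenzl b \<otimes> wenzl c) \<odot> capm i j = 0"
proof (cases "i < b")
  case True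
  then obtain k where k: "b = i + 2 + k" using assms(2) by (metis Suc_leI add_2_eq_Suc' add_Suc_right le_neq_implies_less less_iff_Suc_add add_Suc)
  then have "capm i j = capm i k \<otimes> idt c" using assms(1) by simp
  moreover have "(wenzl b \<otimes> wenzl c) \<odot> (capm i k \<otimes> idt c) = (wenzl b \<odot> capm i k) \<otimes> (wenzl c \<odot> idt c)"
    by (rule interchange[OF wenzl_hom tl_hom_capm[OF refl k]]) simp_all
  ultimately show ?thesis using wenzl_capm[of i k b] k by (simp add: tensor_linear)
next
  case False
  then obtain k where k: "i = b + k" by (metis le_iff_add linorder_not_less)
  then have c: "c = k + 2 + j" using assms(1) by simp
  have "capm i j = idt b \<otimes> capm k j" using k by simp
  moreover have "(wenzl b \<otimes> wenzl c) \<odot> (idt b \<otimes> capm k j) = (wenzl b \<odot> idt b) \<otimes> (wenzl c \<odot> capm k j)"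
    by (rule interchange[OF wenzl_hom tl_hom_idt]) simp_all
  ultimately show ?thesis using wenzl_capm[of k j c] c by (simp add: tensor_linear)
qed

text \<open>Only caps between the two bundles survive, and each adds one strand to the
  \<open>y\<close> strands of the vertex obtained from the remaining diagram; a cup dies at
  \<open>wenzl a\<close>. Hence morphisms from two idempotents to one are multiples of the
  3-vertex.\<close>

lemma merge_diagram:
  assumes "d \<in> tl_diagrams m a" "m = b + c"
  shows "\<exists>\<mu>. (wenzl b \<otimes> wenzl c) \<odot> (dg d \<odot> wenzl a) = scale \<mu> (merge_vertex A b c a)"
  using assms
proof (induction m a d arbitrary: b c rule: tl_diagrams_induct)
  case (id n)
  have "merge_vertex A b c n = (wenzl b \<otimes> wenzl c) \<odot> (idt n \<odot> wenzl n)"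
    using merge_vertex_xyz[of b 0 c] id by (simp add: Dcap_def)
  then show ?case by (intro exI[of _ 1]) simp
next
  case (cap i j n d)
  have dec: "dg (dcomp (capd i j) d) = capm i j \<odot> dg d"
    using dcomp_capd_tl(2)[OF cap(1)] by (simp add: comp_dg)
  have fd [simp]: "fin (dg d)" using cap(1) tl_hom_dg tl_hom_fin by blast
  show ?case
  proof (cases "Suc i = b")
    case False
    have "(wenzl b \<otimes> wenzl c) \<odot> (capm i j \<odot> (dg d \<odot> wenzl n)) = 0 \<odot> (dg d \<odot> wenzl n)"
      by (rule comp_reassoc[OF wenzl_tensor_capm]) (use cap(3) False in simp_all)
    then show ?thesis unfolding dec by (intro exI[of _ 0]) (simp add: comp_linear comp_assoc)
  next
    case True
    then have bc: "b = Suc i" "c = Suc j" using cap(3) by simp_all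
    obtain \<mu> where \<mu>: "(wenzl i \<otimes> wenzl j) \<odot> (dg d \<odot> wenzl n) = scale \<mu> (merge_vertex A i j n)"
      using cap(2)[OF refl] by blast
    let ?P = "wenzl (Suc i) \<otimes> wenzl (Suc j)"
    have absorb: "?P \<odot> (capm i j \<odot> ((wenzl i \<otimes> wenzl j) \<odot> u)) = ?P \<odot> (capm i j \<odot> u)" if "fin u" for u
      using arg_cong[OF wenzl_tensor_capm_absorb[of i j], of "\<lambda>v. v \<odot> u"] that by (simp add: comp_assoc)
    have "?P \<odot> (dg (dcomp (capd i j) d) \<odot> wenzl n) = ?P \<odot> (capm i j \<odot> (dg d \<odot> wenzl n))"
      unfolding dec by (simp add: comp_assoc)
    also have "\<dots> = ?P \<odot> (capm i j \<odot> ((wenzl i \<otimes> wenzl j) \<odot> (dg d \<odot> wenzl n)))"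
      by (rule absorb[symmetric]) simp
    also have "\<dots> = scale \<mu> (?P \<odot> (capm i j \<odot> merge_vertex A i j n))"
      unfolding \<mu> by (simp add: comp_linear)
    finally have eq: "?P \<odot> (dg (dcomp (capd i j) d) \<odot> wenzl n) = scale \<mu> (?P \<odot> (capm i j \<odot> merge_vertex A i j n))" .
    show ?thesis
    proof (cases "admissible n i j")
      case False
      then show ?thesis unfolding bc eq by (intro exI[of _ 0]) (simp add: merge_vertex_0 comp_linear)
    next
      case True
      then obtain x y z where xyz: "n = x + z" "i = x + y" "j = y + z" using admissible_iff by blast
      have "?P \<odot> (capm i j \<odot> merge_vertex A i j n) = ?P \<odot> (capm i j \<odot> (Dcap x y z \<odot> wenzl n))"
        unfolding xyz merge_vertex_xyz by (rule absorb[unfolded xyz]) simp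
      also have "\<dots> = ?P \<odot> (Dcap x (Suc y) z \<odot> wenzl n)"
        unfolding xyz by (simp add: comp_reassoc[OF capm_Dcap])
      also have "\<dots> = merge_vertex A (Suc i) (Suc j) n"
        using merge_vertex_xyz[of x "Suc y" z] xyz by simp
      finally have merge: "?P \<odot> (capm i j \<odot> merge_vertex A i j n) = merge_vertex A (Suc i) (Suc j) n" .
      show ?thesis unfolding bc eq merge by blast
    qed
  qed
next
  case (cup m i j d)
  have dec: "dg (dcomp d (cupd i j)) = dg d \<odot> cupm i j"
    using dcomp_cupd_tl(2)[OF cup(1)] by (simp add: comp_dg)
  have fd [simp]: "fin (dg d)" using cup(1) tl_hom_dg tl_hom_fin by blast
  have "dg d \<odot> (cupm i j \<odot> wenzl (i + 2 + j)) = 0" unfolding cupm_wenzl[OF refl] by (simp add: comp_linear)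
  then show ?case unfolding dec by (intro exI[of _ 0]) (simp add: comp_assoc comp_linear)
qed

lemma merge_ex:
  assumes "f \<in> tl_hom (b + c) a"
  shows "\<exists>\<mu>. (wenzl b \<otimes> wenzl c) \<odot> (f \<odot> wenzl a) = scale \<mu> (merge_vertex A b c a)"
  by (rule tl_hom_ex_scale[OF assms, where F = "\<lambda>f. (wenzl b \<otimes> wenzl c) \<odot> (f \<odot> wenzl a)"])
    (simp_all add: comp_linear merge_diagram)

lemma split_ex:
  assumes "f \<in> tl_hom a (b + c)"
  shows "\<exists>\<mu>. wenzl a \<odot> (f \<odot> (wenzl b \<otimes> wenzl c)) = scale \<mu> (split_vertex A a b c)"
proof -
  have f: "fin f" "fin (tlflip f)" using assms tlflip_hom tl_hom_fin by blast+
  obtain \<mu> where "(wenzl b \<otimes> wenzl c) \<odot> (tlflip f \<odot> wenzl a) = scale \<mu> (merge_vertex A b c a)"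
    using merge_ex[OF tlflip_hom[OF assms]] by blast
  from arg_cong[OF this, of tlflip] show ?thesis
    using f by (auto simp: tlflip_comp tlflip_tensor tlflip_merge comp_assoc)
qed

text \<open>Morphisms passing through a single idempotent. That the identity lies in their span is
  the form of semisimplicity used for fusion.\<close>

definition factors :: "nat \<Rightarrow> nat \<Rightarrow> tl set" where
  "factors m n = {g \<odot> (wenzl k \<odot> h) | g k h. g \<in> tl_hom m k \<and> h \<in> tl_hom k n}"

lemma factors_comp:
  assumes "u \<in> lin.span (factors m n)" and g: "g \<in> tl_hom m' m" and h: "h \<in> tl_hom n n'"
  shows "g \<odot> (u \<odot> h) \<in> lin.span (factors m' n')"
  using assms(1)
proof (induction rule: lin.span_induct_alt)
  case base
  show ?case by (simp add: comp_linear lin.span_zero)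
next
  case (step c x y)
  obtain g' k h' where x: "x = g' \<odot> (wenzl k \<odot> h')" "g' \<in> tl_hom m k" "h' \<in> tl_hom k n"
    using step(1) unfolding factors_def by blast
  have "g \<odot> (x \<odot> h) = (g \<odot> g') \<odot> (wenzl k \<odot> (h' \<odot> h))"
    using x g h by (simp add: comp_assoc)
  moreover have "(g \<odot> g') \<odot> (wenzl k \<odot> (h' \<odot> h)) \<in> factors m' n'"
    unfolding factors_def using tl_hom_comp[OF g x(2)] tl_hom_comp[OF x(3) h] by blast
  ultimately show ?case
    using step(2) by (simp add: comp_linear lin.span_add lin.span_scale lin.span_base)
qed

text \<open>Each term of \<open>wenzl n - idt n\<close> begins with a cap and so passes through two
  strands fewer, where the claim is already known.\<close>

lemma idt_factors: "idt n \<in> lin.span (factors n n)"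
proof (induction n rule: less_induct)
  case (less n)
  have "f \<in> lin.span (factors n m)" if "cap_ideal n m f" for m f
    using that less
  proof (induction rule: cap_ideal.induct)
    case (cap y i j m n)
    have "capm i j \<odot> (idt (i + j) \<odot> y) \<in> lin.span (factors n m)"
      by (rule factors_comp[OF _ tl_hom_capm cap(1)]) (use cap in simp_all)
    then show ?case using comp_idt_left[OF cap(1)] by simp
  qed (simp_all add: lin.span_zero lin.span_add)
  then have "wenzl n - idt n \<in> lin.span (factors n n)" using wenzl_cap_ideal by blast
  moreover have "wenzl n \<in> lin.span (factors n n)"
  proof -
    have "idt n \<odot> (wenzl n \<odot> idt n) \<in> factors n n" unfolding factors_def using tl_hom_idt by blast
    then show ?thesis
      using comp_idt_left[OF wenzl_hom] comp_idt_right[OF wenzl_hom] by (simp add: lin.span_base)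
  qed
  ultimately have "wenzl n - (wenzl n - idt n) \<in> lin.span (factors n n)" by (metis lin.span_diff)
  then show ?case by simp
qed

text \<open>Sandwiched between copies of \<open>wenzl b \<otimes> wenzl c\<close>, both halves of
  each term in the decomposition of the identity become multiples of 3-vertices. The coefficients
  stay unknown here and are found in \<open>fusion\<close>.\<close>

lemma fusion_ex: "\<exists>l. wenzl b \<otimes> wenzl c =
    (\<Sum>a | admissible a b c. scale (l a) (merge_vertex A b c a \<odot> split_vertex A a b c))"
proof -
  let ?P = "wenzl b \<otimes> wenzl c" and ?K = "{a. admissible a b c}"
  let ?M = "\<lambda>a. merge_vertex A b c a \<odot> split_vertex A a b c"
  have P: "?P \<in> tl_hom (b + c) (b + c)" by (rule wenzl_tensor_hom[OF refl])
  have "\<exists>l. ?P \<odot> (u \<odot> ?P) = (\<Sum>a\<in>?K. scale (l a) (?M a))" if "u \<in> lin.span (factors (b + c) (b + c))" for u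
    using that
  proof (induction rule: lin.span_induct_alt)
    case base
    show ?case by (rule exI[of _ "\<lambda>_. 0"]) (simp add: comp_linear)
  next
    case (step r x y)
    obtain g k h where x: "x = g \<odot> (wenzl k \<odot> h)" "g \<in> tl_hom (b + c) k" "h \<in> tl_hom k (b + c)"
      using step(1) unfolding factors_def by blast
    obtain l where l: "?P \<odot> (y \<odot> ?P) = (\<Sum>a\<in>?K. scale (l a) (?M a))" using step(2) by blast
    obtain \<mu> where \<mu>: "?P \<odot> (g \<odot> wenzl k) = scale \<mu> (merge_vertex A b c k)" using merge_ex[OF x(2)] by blast
    obtain \<nu> where \<nu>: "wenzl k \<odot> (h \<odot> ?P) = scale \<nu> (split_vertex A k b c)" using split_ex[OF x(3)] by blast
    have fin: "fin g" "fin h" using x by auto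
    have "?P \<odot> (x \<odot> ?P) = ?P \<odot> (g \<odot> (wenzl k \<odot> (h \<odot> ?P)))"
      using fin x by (simp add: comp_assoc)
    \<comment> \<open>The idempotent in the middle is doubled so that each half keeps one and can be
      compared with a vertex.\<close>
    also have "\<dots> = ?P \<odot> (g \<odot> (wenzl k \<odot> (wenzl k \<odot> (h \<odot> ?P))))"
      using fin by (simp add: comp_reassoc[OF wenzl_idem])
    also have "\<dots> = (?P \<odot> (g \<odot> wenzl k)) \<odot> (wenzl k \<odot> (h \<odot> ?P))"
      using fin by (simp add: comp_assoc)
    also have "\<dots> = scale (\<mu> * \<nu>) (?M k)" unfolding \<mu> \<nu> by (simp add: comp_linear mult.commute)
    finally have eq: "?P \<odot> (x \<odot> ?P) = scale (\<mu> * \<nu>) (?M k)" .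
    have one: "scale (\<mu> * \<nu>) (?M k) = (\<Sum>a\<in>?K. scale (if a = k then \<mu> * \<nu> else 0) (?M a))"
    proof (cases "k \<in> ?K")
      case True
      have "(\<Sum>a\<in>?K. scale (if a = k then \<mu> * \<nu> else 0) (?M a)) = (\<Sum>a\<in>?K. if a = k then scale (\<mu> * \<nu>) (?M a) else 0)"
        by (intro sum.cong) auto
      then show ?thesis using True finite_admissible by simp
    next
      case False
      have "(\<Sum>a\<in>?K. scale (if a = k then \<mu> * \<nu> else 0) (?M a)) = 0"
        using False by (intro sum.neutral) auto
      then show ?thesis using False by (simp add: merge_vertex_0 comp_linear)
    qed
    show ?case
      by (rule exI[of _ "\<lambda>a. r * (if a = k then \<mu> * \<nu> else 0) + l a"])
        (simp add: comp_linear eq one l lin.scale_left_distrib sum.distrib lin.scale_sum_right)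
  qed
  then have "\<exists>l. ?P \<odot> (idt (b + c) \<odot> ?P) = (\<Sum>a\<in>?K. scale (l a) (?M a))" using idt_factors by blast
  then show ?thesis by (simp add: comp_idt_left[OF P] wenzl_tensor_idem)
qed

text \<open>The cup joins two consecutive arcs of the nest, with \<open>j\<close> arcs outside them
  and \<open>i\<close> inside. Together they form one arc whose ends are the mirror-image positions
  on the left, that is, a cap on top of the remaining nest.\<close>

lemma cup_slide: "cupm (i + 2 + j + i) j \<odot> dg (dcap (i + 2 + j)) = capm j (i + (i + j)) \<odot> dg (dcap (i + j))"
proof -
  let ?cap = "\<lambda>n. dg (dcap n)"
  \<comment> \<open>The nest is cut into the \<open>j\<close> outer arcs, the two arcs met by the
    cup, and the \<open>i\<close> inner arcs.\<close>
  have cap2: "?cap (2 + j) = capm (j + 1) (j + 1) \<odot> (capm j j \<odot> ?cap j)"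
    using dcap_Suc_comp[of "Suc j" A] dcap_Suc_comp[of j A] by simp
  have cap: "?cap (i + 2 + j) = Dcap (2 + j) i (2 + j) \<odot> (capm (j + 1) (j + 1) \<odot> (capm j j \<odot> ?cap j))"
    using dcap_add[of i "2 + j" A] cap2 by (simp add: add.assoc)
  let ?D = "idt (2 + j) \<otimes> (?cap i \<otimes> idt j)"
  have c: "?cap i \<otimes> idt j \<in> tl_hom (2 * i + j) j" by (rule tl_hom_tensor[OF tl_hom_dcap[OF refl] tl_hom_idt]) simp_all
  have "cupm (i + 2 + j + i) j \<odot> Dcap (2 + j) i (2 + j) = ?D \<odot> cupm (2 + j) j"
  proof -
    have "cupm (2 * i) j \<odot> (?cap i \<otimes> idt (2 + j)) = (?cap i \<otimes> idt j) \<odot> cupm 0 j"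
      using tensor_split[OF tl_hom_dcap[OF refl, of i] tl_hom_cupm[OF refl refl, of 0 j], of A] by simp
    then have "(idt (2 + j) \<otimes> cupm (2 * i) j) \<odot> (idt (2 + j) \<otimes> (?cap i \<otimes> idt (2 + j))) = ?D \<odot> (idt (2 + j) \<otimes> cupm 0 j)"
      by (simp add: idt_tensor_comp del: cupm_tensor)
    moreover have "i + 2 + j + i = 2 + j + 2 * i" by simp
    ultimately show ?thesis unfolding Dcap_def by (simp only: cupm_tensor) simp
  qed
  then have "cupm (i + 2 + j + i) j \<odot> ?cap (i + 2 + j) = ?D \<odot> (cupm (2 + j) j \<odot> (capm (j + 1) (j + 1) \<odot> (capm j j \<odot> ?cap j)))"
    unfolding cap using comp_reassoc[of "cupm (i + 2 + j + i) j" "Dcap (2 + j) i (2 + j)"] by (simp add: comp_assoc)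
  also have "cupm (2 + j) j \<odot> (capm (j + 1) (j + 1) \<odot> (capm j j \<odot> ?cap j)) = idt (Suc (j + 1 + j)) \<odot> (capm j j \<odot> ?cap j)"
    using comp_reassoc[OF cup_cap_left1[of "j + 1" j], of "capm j j \<odot> ?cap j"] by simp
  also have "\<dots> = capm j j \<odot> ?cap j"
    by (rule comp_idt_left[OF tl_hom_comp[OF tl_hom_capm tl_hom_dcap]]) simp_all
  finally have lhs: "cupm (i + 2 + j + i) j \<odot> ?cap (i + 2 + j) = ?D \<odot> (capm j j \<odot> ?cap j)" .
  have "capm j (i + (i + j)) \<odot> Dcap j i j = ?D \<odot> capm j j"
  proof -
    have "capm 0 (2 * i + j) \<odot> (?cap i \<otimes> idt j) = (idt 2 \<otimes> (?cap i \<otimes> idt j)) \<odot> capm 0 j"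
      using tensor_split[OF tl_hom_capm[of 0 0 0 2] c, of A] by simp
    then have "(idt j \<otimes> capm 0 (2 * i + j)) \<odot> (idt j \<otimes> (?cap i \<otimes> idt j)) = (idt j \<otimes> (idt 2 \<otimes> (?cap i \<otimes> idt j))) \<odot> (idt j \<otimes> capm 0 j)"
      by (simp add: idt_tensor_comp del: capm_tensor idt_idt_assoc)
    moreover have "i + (i + j) = 2 * i + j" by simp
    ultimately show ?thesis unfolding Dcap_def by (simp only: capm_tensor) (simp add: add.commute)
  qed
  then have "capm j (i + (i + j)) \<odot> ?cap (i + j) = ?D \<odot> (capm j j \<odot> ?cap j)"
    unfolding dcap_add[of i j A] using comp_reassoc[of "capm j (i + (i + j))" "Dcap j i j"] by (simp add: comp_assoc)
  then show ?thesis using lhs by simp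
qed

text \<open>A turn-back next to one idempotent slides along the nested caps to the other idempotent.\<close>

lemma wenzl_flip_dcap: "cap_ideal n m f \<Longrightarrow> (wenzl n \<otimes> tlflip f) \<odot> dg (dcap n) = 0"
proof (induction rule: cap_ideal.induct)
  case (cap y i j m n)
  let ?y = "tlflip y"
  have y: "?y \<in> tl_hom m (i + j)" by (rule tlflip_hom[OF cap(1)])
  have "wenzl n \<otimes> tlflip (capm i j \<odot> y) = (wenzl n \<odot> idt n) \<otimes> (?y \<odot> cupm i j)"
    by (simp add: tlflip_comp comp_idt_right[OF wenzl_hom])
  also have "\<dots> = (wenzl n \<otimes> ?y) \<odot> (idt n \<otimes> cupm i j)"
    by (rule interchange[symmetric, OF wenzl_hom tl_hom_idt]) (use y in simp_all)
  also have "idt n \<otimes> cupm i j = cupm (i + 2 + j + i) j" using cap(2) by simp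
  finally have "(wenzl n \<otimes> tlflip (capm i j \<odot> y)) \<odot> dg (dcap n) =
      (wenzl n \<otimes> ?y) \<odot> (cupm (i + 2 + j + i) j \<odot> dg (dcap (i + 2 + j)))"
    using y cap(2) by (simp add: comp_assoc)
  also have "\<dots> = ((wenzl n \<otimes> ?y) \<odot> capm j (i + (i + j))) \<odot> dg (dcap (i + j))"
    unfolding cup_slide using y by (simp add: comp_assoc)
  also have "(wenzl n \<otimes> ?y) \<odot> capm j (i + (i + j)) = 0"
  proof -
    have "capm j (i + (i + j)) = capm j i \<otimes> idt (i + j)" by simp
    moreover have "(wenzl n \<otimes> ?y) \<odot> (capm j i \<otimes> idt (i + j)) = (wenzl n \<odot> capm j i) \<otimes> (?y \<odot> idt (i + j))"
      by (rule interchange[OF wenzl_hom tl_hom_capm[OF refl]]) (use y cap(2) in simp_all)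
    ultimately show ?thesis using wenzl_capm[of j i n] cap(2) by (simp add: tensor_linear)
  qed
  finally show ?case by (simp add: comp_linear)
qed (simp_all add: tensor_linear comp_linear)

text \<open>Closing one strand at a time by \<open>wenzl_trace\<close> gives a telescoping product
  of ratios of successive \<open>Delta\<close> values.\<close>

lemma wenzl_loop: "dg (dcup n) \<odot> ((wenzl n \<otimes> idt n) \<odot> dg (dcap n)) = scale (\<Delta> n) (idt 0)"
proof (induction n)
  case 0
  then show ?case by (simp add: Delta_0)
next
  case (Suc n)
  let ?p = "wenzl (Suc n) \<otimes> idt 1"
  have p: "?p \<in> tl_hom (Suc (Suc n)) (Suc (Suc n))" by (rule wenzl_idt_hom) simp
  have cap: "capm n 0 \<in> tl_hom (Suc (Suc n)) n" and cup: "cupm n 0 \<in> tl_hom n (Suc (Suc n))"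
    by (auto intro: tl_hom_capm tl_hom_cupm)
  have "cupm n n \<odot> ((wenzl (Suc n) \<otimes> idt (Suc n)) \<odot> capm n n) = (cupm n 0 \<odot> (?p \<odot> capm n 0)) \<otimes> idt n"
  proof -
    have "wenzl (Suc n) \<otimes> idt (Suc n) = ?p \<otimes> idt n" by (simp add: tensor_assoc)
    then show ?thesis
      using comp_tensor_idt[OF cup tl_hom_comp[OF p cap], of A n] comp_tensor_idt[OF p cap, of A n] by simp
  qed
  also have "\<dots> = scale (\<Delta> (Suc n) / \<Delta> n) (wenzl n \<otimes> idt n)"
    unfolding wenzl_trace by (simp add: tensor_linear)
  finally have inner: "cupm n n \<odot> ((wenzl (Suc n) \<otimes> idt (Suc n)) \<odot> capm n n) = scale (\<Delta> (Suc n) / \<Delta> n) (wenzl n \<otimes> idt n)" .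
  have "dg (dcup (Suc n)) \<odot> ((wenzl (Suc n) \<otimes> idt (Suc n)) \<odot> dg (dcap (Suc n))) =
      dg (dcup n) \<odot> ((cupm n n \<odot> ((wenzl (Suc n) \<otimes> idt (Suc n)) \<odot> capm n n)) \<odot> dg (dcap n))"
    unfolding dcup_Suc_comp[of n A] dcap_Suc_comp[of n A] by (simp add: comp_assoc)
  also have "\<dots> = scale (\<Delta> (Suc n)) (idt 0)"
    unfolding inner using Suc Delta_nonzero[of n] by (simp add: comp_linear)
  finally show ?case .
qed

text \<open>The returning strands in \<open>theta\<close> carry an idempotent of their own; it
  slides around the bend and is absorbed by the other one.\<close>

lemma wenzl_theta: "dg (dcup n) \<odot> ((wenzl n \<otimes> wenzl n) \<odot> dg (dcap n)) = scale (\<Delta> n) (idt 0)"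
proof -
  have "(wenzl n \<otimes> wenzl n) \<odot> dg (dcap n) = (wenzl n \<otimes> idt n) \<odot> dg (dcap n)"
    using wenzl_flip_dcap[OF wenzl_cap_ideal[of n]] by (simp add: tensor_linear comp_linear)
  then show ?thesis using wenzl_loop by simp
qed

text \<open>By Schur's lemma the bubble is a multiple of the idempotent. Closing it up determines
  the factor, since one side becomes a theta graph and the other a loop.\<close>

lemma split_merge: "split_vertex A a b c \<odot> merge_vertex A b c a' =
    (if a = a' then scale (theta A a b c / \<Delta> a) (wenzl a) else 0)"
proof -
  have sm: "split_vertex A a b c \<odot> merge_vertex A b c a' \<in> tl_hom a a'"
    by (rule tl_hom_comp[OF split_hom merge_hom])
  have "wenzl a \<odot> ((split_vertex A a b c \<odot> merge_vertex A b c a') \<odot> wenzl a') = split_vertex A a b c \<odot> merge_vertex A b c a'"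
    using comp_reassoc[OF split_absorb(2)[of a b c]] by (simp add: comp_assoc merge_absorb)
  then obtain \<alpha> where \<alpha>: "split_vertex A a b c \<odot> merge_vertex A b c a' = (if a = a' then scale \<alpha> (wenzl a') else 0)"
    using schur[OF sm] by auto
  show ?thesis
  proof (cases "a = a'")
    case True
    have "theta A a b c = closed_value (dg (dcup a) \<odot> ((scale \<alpha> (wenzl a) \<otimes> wenzl a) \<odot> dg (dcap a)))"
      unfolding theta_def jw_wenzl using \<alpha> True by simp
    also have "\<dots> = \<alpha> * \<Delta> a"
      by (simp add: tensor_linear comp_linear wenzl_theta closed_value_def) (simp add: dg_def)
    finally show ?thesis using \<alpha> True Delta_nonzero[of a] by simp
  qed (use \<alpha> in simp)
qed

text \<open>The coefficient of \<open>a\<close> is found by composing with \<open>split_vertex A a b c\<close>. If that vertex is nonzero,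
  this also gives \<open>theta A a b c \<noteq> 0\<close>; otherwise the summand vanishes whatever its coefficient.\<close>

lemma fusion: "wenzl b \<otimes> wenzl c =
    (\<Sum>a | admissible a b c. scale (\<Delta> a / theta A a b c) (merge_vertex A b c a \<odot> split_vertex A a b c))"
proof -
  let ?M = "\<lambda>a. merge_vertex A b c a \<odot> split_vertex A a b c"
  obtain l where l: "wenzl b \<otimes> wenzl c = (\<Sum>a | admissible a b c. scale (l a) (?M a))"
    using fusion_ex by blast
  have "scale (l a) (?M a) = scale (\<Delta> a / theta A a b c) (?M a)" if a: "admissible a b c" for a
  proof (cases "split_vertex A a b c = 0")
    case True
    then show ?thesis by (simp add: comp_linear)
  next
    case False
    have "split_vertex A a b c = split_vertex A a b c \<odot> (wenzl b \<otimes> wenzl c)" by (simp add: split_absorb)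
    also have "\<dots> = (\<Sum>a' | admissible a' b c. scale (l a') (split_vertex A a b c \<odot> ?M a'))"
      unfolding l by (simp add: comp_linear)
    also have "\<dots> = (\<Sum>a' | admissible a' b c. if a' = a then scale (l a * (theta A a b c / \<Delta> a)) (split_vertex A a b c) else 0)"
    proof (intro sum.cong refl)
      fix a'
      have "split_vertex A a b c \<odot> ?M a' = (if a = a' then scale (theta A a b c / \<Delta> a) (wenzl a) else 0) \<odot> split_vertex A a' b c"
        by (rule comp_reassoc[OF split_merge]) simp_all
      then show "scale (l a') (split_vertex A a b c \<odot> ?M a') =
          (if a' = a then scale (l a * (theta A a b c / \<Delta> a)) (split_vertex A a b c) else 0)"
        by (simp add: comp_linear split_absorb)
    qed
    also have "\<dots> = scale (l a * (theta A a b c / \<Delta> a)) (split_vertex A a b c)"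
      using a finite_admissible by simp
    finally have "scale (l a * (theta A a b c / \<Delta> a) - 1) (split_vertex A a b c) = 0"
      by (simp add: lin.scale_left_diff_distrib)
    then have "l a * (theta A a b c / \<Delta> a) = 1" using False by (simp add: lin.scale_eq_0_iff)
    moreover from this have "theta A a b c \<noteq> 0" by auto
    ultimately have "l a = \<Delta> a / theta A a b c" using Delta_nonzero[of a] by (simp add: field_simps)
    then show ?thesis by simp
  qed
  then show ?thesis unfolding l by (intro sum.cong) auto
qed

end

section \<open>Trees\<close>

lemma loop_value_inverse: "loop_value (inverse A) = loop_value A"
  by (simp add: loop_value_def)

lemma tl_comp_inverse [simp]: "tl_comp (inverse A) = tl_comp A"
  by (simp add: tl_comp_def loop_value_inverse fun_eq_iff)

text \<open>The parameter enters the characterisation of the idempotent through composition alone,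
  and composition depends on it only by the loop value.\<close>

lemma jw_inverse [simp]: "jw (inverse A) n = jw A n"
  by (simp add: jw_def is_jones_wenzl_def)

lemma jws_inverse [simp]: "jws (inverse A) = jws A"
  by (simp add: jws_def fun_eq_iff)

lemma tree_map_inverse [simp]: "tree_map (inverse A) t = tree_map A t"
  by (induction t) (simp_all add: split_vertex_def)

lemma strip_map_inverse [simp]: "strip_map (inverse A) xs ys t = strip_map A xs ys t"
  by (simp add: strip_map_def)

lemma kar_hom_inverse [simp]: "kar_hom (inverse A) ys xs = kar_hom A ys xs"
  by (simp add: kar_hom_def)

text \<open>The root label is left free, because the root of a subtree is an internal edge of the
  whole tree and is summed over.\<close>

definition tree_labellings :: "unit ptree \<Rightarrow> nat list \<Rightarrow> nat ptree set" where
  "tree_labellings T L = {t. map_ptree (\<lambda>_. ()) t = T \<and> leaf_labels t = L \<and> all_admissible t}"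

lemma finite_tree_labellings: "finite (tree_labellings T L)"
proof (rule finite_subset)
  show "tree_labellings T L \<subseteq> {t. map_ptree (\<lambda>_. ()) t = T \<and> set_ptree t \<subseteq> {..sum_list L}}"
    using labels_le_leaf_sum by (auto simp: tree_labellings_def)
qed (simp add: finite_bounded_labellings)

lemma length_leaf_labels_map: "length (leaf_labels (map_ptree f t)) = length (leaf_labels t)"
  by (induction t) simp_all

lemma tree_labellings_Ext: "tree_labellings (Ext ()) [a] = {Ext a}"
proof -
  have "t \<in> tree_labellings (Ext ()) [a] \<longleftrightarrow> t = Ext a" for t
    by (cases t) (auto simp: tree_labellings_def)
  then show ?thesis by auto
qed

text \<open>The length condition fixes where the list of leaves splits between the two
  subtrees.\<close>

lemma tree_labellings_Vtx:
  assumes "length L1 = length (leaf_labels T1)"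
  shows "tree_labellings (Vtx () T1 T2) (L1 @ L2) = (\<lambda>((l, r), a). Vtx a l r) `
    (SIGMA p : tree_labellings T1 L1 \<times> tree_labellings T2 L2. {a. admissible a (rootl (fst p)) (rootl (snd p))})"
    (is "?A = ?f ` ?B")
proof (intro equalityI subsetI)
  fix t assume t: "t \<in> ?A"
  then obtain a l r where lr: "t = Vtx a l r" by (cases t) (auto simp: tree_labellings_def)
  have T1: "map_ptree (\<lambda>_. ()) l = T1" using t lr by (simp add: tree_labellings_def)
  have "length (leaf_labels l) = length L1"
    using assms unfolding T1[symmetric] length_leaf_labels_map by simp
  then have "((l, r), a) \<in> ?B" using t lr by (auto simp: tree_labellings_def)
  then have "?f ((l, r), a) \<in> ?f ` ?B" by (rule imageI)
  then show "t \<in> ?f ` ?B" using lr by simp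
next
  fix t assume "t \<in> ?f ` ?B"
  then show "t \<in> ?A" by (auto simp: tree_labellings_def)
qed

context temperley_lieb
begin

lemma tlflip_split: "tlflip (split_vertex A a b c) = merge_vertex A b c a"
  unfolding tlflip_merge[symmetric] by simp

lemma jws_Nil [simp]: "jws A [] = idt 0"
  and jws_Cons: "jws A (a # as) = wenzl a \<otimes> jws A as"
  by (simp_all add: jws_def jw_wenzl)

lemma jws_append: "jws A (as @ bs) = jws A as \<otimes> jws A bs"
  by (induction as) (simp_all add: jws_Cons tensor_assoc)

lemma jws_single [simp]: "jws A [a] = wenzl a"
  by (simp add: jws_Cons)

lemma jws_hom: "jws A as \<in> tl_hom (sum_list as) (sum_list as)"
proof (induction as)
  case (Cons a as)
  then show ?case unfolding jws_Cons by (intro tl_hom_tensor[OF wenzl_hom]) auto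
qed simp

lemma fin_jws [simp]: "fin (jws A as)"
  by (rule tl_hom_fin[OF jws_hom])

lemma jws_idem: "jws A as \<odot> jws A as = jws A as"
proof (induction as)
  case (Cons a as)
  then show ?case by (simp add: jws_Cons interchange[OF wenzl_hom wenzl_hom] wenzl_idem)
qed simp

lemma tree_map_hom: "tree_map A t \<in> tl_hom (rootl t) (sum_list (leaf_labels t))"
proof (induction t)
  case (Vtx a l r)
  have "tree_map A l \<otimes> tree_map A r \<in> tl_hom (rootl l + rootl r) (sum_list (leaf_labels l) + sum_list (leaf_labels r))"
    by (rule tl_hom_tensor[OF Vtx refl refl])
  then show ?case using tl_hom_comp[OF split_hom] by simp
qed (simp add: jw_wenzl)

lemma fin_tree_map [simp]: "fin (tree_map A t)"
  by (rule tl_hom_fin[OF tree_map_hom])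

lemma tree_map_absorb: "wenzl (rootl t) \<odot> tree_map A t = tree_map A t"
  "tree_map A t \<odot> jws A (leaf_labels t) = tree_map A t"
proof -
  show "wenzl (rootl t) \<odot> tree_map A t = tree_map A t"
    by (cases t) (simp_all add: jw_wenzl wenzl_idem comp_reassoc[OF split_absorb(2)])
  show "tree_map A t \<odot> jws A (leaf_labels t) = tree_map A t"
  proof (induction t)
    case (Vtx a l r)
    then show ?case
      by (simp add: jws_append comp_assoc interchange[OF tree_map_hom jws_hom])
  qed (simp add: jw_wenzl wenzl_idem)
qed

text \<open>One fusion coefficient per vertex. The root edge therefore contributes its
  \<open>Delta\<close> although it is external; \<open>nvertex_casimir\<close> divides it
  out.\<close>

fun coeff :: "nat ptree \<Rightarrow> complex" where
  "coeff (Ext a) = 1"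
| "coeff (Vtx a l r) = \<Delta> a / theta A a (rootl l) (rootl r) * (coeff l * coeff r)"

text \<open>The identity on the leaves is resolved along an arbitrary tree shape: the resolutions of
  the two subtrees are juxtaposed, and their two roots are fused.\<close>

lemma tree_resolution:
  "length L = length (leaf_labels T) \<Longrightarrow>
    jws A L = (\<Sum>t\<in>tree_labellings T L. scale (coeff t) (tlflip (tree_map A t) \<odot> tree_map A t))"
proof (induction T arbitrary: L)
  case (Ext u)
  then obtain a where "L = [a]" by (cases L) auto
  then show ?case by (simp add: tree_labellings_Ext jw_wenzl wenzl_idem)
next
  case (Vtx u T1 T2)
  define L1 L2 where "L1 = take (length (leaf_labels T1)) L" and "L2 = drop (length (leaf_labels T1)) L"
  have L: "L = L1 @ L2" and len: "length L1 = length (leaf_labels T1)" "length L2 = length (leaf_labels T2)"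
    using Vtx.prems by (auto simp: L1_def L2_def)
  let ?u = "tree_map A" and ?v = "\<lambda>t. tlflip (tree_map A t) \<odot> tree_map A t"
  let ?X1 = "tree_labellings T1 L1" and ?X2 = "tree_labellings T2 L2"
  let ?Y = "SIGMA p : ?X1 \<times> ?X2. {a. admissible a (rootl (fst p)) (rootl (snd p))}"
  have pair: "(?v l) \<otimes> (?v r) =
      (\<Sum>a | admissible a (rootl l) (rootl r). scale (\<Delta> a / theta A a (rootl l) (rootl r))
        (?v (Vtx a l r)))" for l r
  proof -
    let ?lr = "?u l \<otimes> ?u r" and ?w = "wenzl (rootl l) \<otimes> wenzl (rootl r)"
    have flip: "tlflip ?lr = tlflip (?u l) \<otimes> tlflip (?u r)" by (rule tlflip_tensor)
    have fl: "fin (tlflip ?lr)" "fin (tlflip (?u r))"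
      unfolding flip using tlflip_hom[OF tree_map_hom] tl_hom_fin fin_tensor by blast+
    have lr: "?w \<odot> ?lr = ?lr"
      using interchange[OF wenzl_hom tree_map_hom] by (simp add: tree_map_absorb)
    have "(?v l) \<otimes> (?v r) = tlflip ?lr \<odot> ?lr"
      unfolding flip using interchange[OF tlflip_hom[OF tree_map_hom] tree_map_hom fl(2), of "?u r" A l] by simp
    \<comment> \<open>The idempotents of the two roots are exposed between the trees and their
      mirror images, where \<open>fusion\<close> replaces them by a sum over the new root
      label.\<close>
    also have "\<dots> = tlflip ?lr \<odot> (?w \<odot> ?lr)" unfolding lr ..
    also have "\<dots> = (\<Sum>a | admissible a (rootl l) (rootl r). scale (\<Delta> a / theta A a (rootl l) (rootl r))
        (?v (Vtx a l r)))"
      unfolding fusion comp_linear using fl(1)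
      by (intro sum.cong refl) (simp add: comp_assoc tlflip_comp tlflip_split)
    finally show ?thesis .
  qed
  have "jws A L = (\<Sum>l\<in>?X1. \<Sum>r\<in>?X2. scale (coeff l * coeff r) ((?v l) \<otimes> (?v r)))"
    unfolding L jws_append Vtx.IH(1)[OF len(1)] Vtx.IH(2)[OF len(2)]
    unfolding tensor_linear lin.scale_sum_right lin.scale_scale
    by (subst sum.swap) (simp add: mult.commute)
  also have "\<dots> = (\<Sum>(l, r)\<in>?X1 \<times> ?X2. \<Sum>a | admissible a (rootl l) (rootl r). scale (coeff (Vtx a l r))
        (?v (Vtx a l r)))"
    unfolding sum.cartesian_product pair by (simp add: lin.scale_sum_right case_prod_unfold mult.commute)
  also have "\<dots> = (\<Sum>((l, r), a)\<in>?Y.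
      scale (coeff (Vtx a l r)) (?v (Vtx a l r)))"
    using finite_tree_labellings finite_admissible
    by (subst sum.Sigma[symmetric]) (auto simp: case_prod_unfold)
  also have "\<dots> = (\<Sum>t\<in>tree_labellings (Vtx u T1 T2) L. scale (coeff t) (?v t))"
    unfolding L tree_labellings_Vtx[OF len(1)] unit_eq[of u]
    by (subst sum.reindex) (auto simp: inj_on_def case_prod_unfold simp del: coeff.simps tree_map.simps)
  finally show ?case .
qed

text \<open>Amounts to \<open>kar_hom A [r] L\<close>, with absorption at the two ends stated
  separately.\<close>

definition tree_space :: "nat \<Rightarrow> nat list \<Rightarrow> tl set" where
  "tree_space r L = {f \<in> tl_hom r (sum_list L). wenzl r \<odot> f = f \<and> f \<odot> jws A L = f}"

text \<open>The bilinear form on \<open>tree_space r L\<close>; by Schur's lemma its defining equation can be solved.\<close>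

definition form :: "nat \<Rightarrow> tl \<Rightarrow> tl \<Rightarrow> complex" where
  "form r f g = (SOME \<alpha>. f \<odot> tlflip g = scale \<alpha> (wenzl r))"

lemma tree_space_comp_flip:
  assumes "f \<in> tree_space r L" "g \<in> tree_space s L"
  shows "\<exists>\<alpha>. f \<odot> tlflip g = (if r = s then scale \<alpha> (wenzl s) else 0)"
proof -
  have f: "f \<in> tl_hom r (sum_list L)" "wenzl r \<odot> f = f" and g: "g \<in> tl_hom s (sum_list L)" "wenzl s \<odot> g = g"
    using assms by (simp_all add: tree_space_def)
  have fg: "f \<odot> tlflip g \<in> tl_hom r s" by (rule tl_hom_comp[OF f(1) tlflip_hom[OF g(1)]])
  have fin: "fin f" "fin (tlflip g)" using f g tlflip_hom tl_hom_fin by blast+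
  have "tlflip g \<odot> wenzl s = tlflip g" using arg_cong[OF g(2), of tlflip] by (simp add: tlflip_comp)
  then have "wenzl r \<odot> ((f \<odot> tlflip g) \<odot> wenzl s) = f \<odot> tlflip g"
    using fin comp_reassoc[OF f(2), of "tlflip g"] by (simp add: comp_assoc)
  then show ?thesis using schur[OF fg] by simp
qed

lemma form: "f \<in> tree_space r L \<Longrightarrow> g \<in> tree_space r L \<Longrightarrow> f \<odot> tlflip g = scale (form r f g) (wenzl r)"
  unfolding form_def by (rule someI_ex) (use tree_space_comp_flip in fastforce)

text \<open>Reflection exchanges the two arguments and fixes the nonzero element
  \<open>wenzl r\<close>.\<close>

lemma form_sym:
  assumes "f \<in> tree_space r L" "g \<in> tree_space r L"
  shows "form r f g = form r g f"
proof -
  have "g \<odot> tlflip f = scale (form r f g) (wenzl r)"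
    using arg_cong[OF form[OF assms], of tlflip] by (simp add: tlflip_comp)
  then have "scale (form r f g) (wenzl r) = scale (form r g f) (wenzl r)"
    by (rule trans[OF sym form[OF assms(2,1)]])
  then show ?thesis using wenzl_nonzero by (simp add: lin.scale_cancel_right)
qed

lemma tree_map_space: "leaf_labels t = L \<Longrightarrow> rootl t = r \<Longrightarrow> tree_map A t \<in> tree_space r L"
  using tree_map_hom tree_map_absorb by (auto simp: tree_space_def)

text \<open>Composing \<open>f\<close> with the resolution of its target puts \<open>f\<close> on
  top of a mirrored tree in each term. By Schur's lemma this is the value of the form times an
  idempotent if the tree has root \<open>r\<close>, and zero otherwise.\<close>

lemma tree_expansion:
  assumes len: "length L = length (leaf_labels T)" and f: "f \<in> tree_space r L"
  shows "f = (\<Sum>t | t \<in> tree_labellings T L \<and> rootl t = r. scale (coeff t * form r f (tree_map A t)) (tree_map A t))"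
proof -
  have fin: "fin f" using f tl_hom_fin by (auto simp: tree_space_def)
  have fin_flip: "fin (tlflip (tree_map A t))" for t
    using tlflip_hom[OF tree_map_hom] tl_hom_fin by blast
  have "f = f \<odot> jws A L" using f by (simp add: tree_space_def)
  also have "\<dots> = (\<Sum>t\<in>tree_labellings T L. scale (coeff t) ((f \<odot> tlflip (tree_map A t)) \<odot> tree_map A t))"
    unfolding tree_resolution[OF len] using fin fin_flip by (simp add: comp_linear comp_assoc)
  also have "\<dots> = (\<Sum>t\<in>tree_labellings T L. if rootl t = r then scale (coeff t * form r f (tree_map A t)) (tree_map A t) else 0)"
  proof (intro sum.cong refl)
    fix t assume "t \<in> tree_labellings T L"
    then have t: "tree_map A t \<in> tree_space (rootl t) L"
      by (intro tree_map_space) (auto simp: tree_labellings_def)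
    show "scale (coeff t) ((f \<odot> tlflip (tree_map A t)) \<odot> tree_map A t) =
        (if rootl t = r then scale (coeff t * form r f (tree_map A t)) (tree_map A t) else 0)"
    proof (cases "rootl t = r")
      case True
      then show ?thesis using form[OF f, of "tree_map A t"] t tree_map_absorb(1)[of t] by (simp add: comp_linear)
    next
      case False
      then have "f \<odot> tlflip (tree_map A t) = 0" using tree_space_comp_flip[OF f t] by auto
      then show ?thesis using False by (simp add: comp_linear)
    qed
  qed
  also have "\<dots> = (\<Sum>t | t \<in> tree_labellings T L \<and> rootl t = r. scale (coeff t * form r f (tree_map A t)) (tree_map A t))"
    using finite_tree_labellings by (simp add: sum.inter_filter)
  finally show ?thesis .
qed

text \<open>Bending the edges as a linear operation on tree morphisms, so that expansions of trees
  carry over to their drawings in the strip.\<close>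

definition strip :: "nat list \<Rightarrow> nat list \<Rightarrow> nat \<Rightarrow> tl \<Rightarrow> tl" where
  "strip xs ys r f = ((dg (dcup r) \<odot> (f \<otimes> wenzl r)) \<otimes> jws A ys) \<odot>
    (idt (sum_list xs) \<otimes> dg (dcap (sum_list ys)))"

lemma strip_map_strip: "strip_map A xs ys t = strip xs ys (rootl t) (tree_map A t)"
  by (simp add: strip_map_def strip_def jw_wenzl)

lemma strip_linear: "strip xs ys r (\<Sum>t\<in>X. scale (c t) (F t)) = (\<Sum>t\<in>X. scale (c t) (strip xs ys r (F t)))"
  by (simp add: strip_def comp_linear tensor_linear)

text \<open>The second tensor factor is expanded along \<open>T'\<close>. The mixed coefficients
  contain the form of two trees, so by symmetry the sum over labellings of \<open>T\<close> can be
  carried out in the first factor, where it is again an expansion.\<close>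

lemma casimir:
  assumes len: "length L = length (leaf_labels T)" "length L = length (leaf_labels T')"
  shows "(\<Sum>t | t \<in> tree_labellings T L \<and> rootl t = r. scale (coeff t) (strip xs ys r (tree_map A t) \<boxtimes> strip xs ys r (tree_map A t)))
    = (\<Sum>t | t \<in> tree_labellings T' L \<and> rootl t = r. scale (coeff t) (strip xs ys r (tree_map A t) \<boxtimes> strip xs ys r (tree_map A t)))"
proof -
  let ?X = "\<lambda>T. {t. t \<in> tree_labellings T L \<and> rootl t = r}"
  let ?u = "tree_map A" and ?s = "strip xs ys r"
  have u: "?u t \<in> tree_space r L" if "t \<in> ?X T" for t T
    using that by (intro tree_map_space) (auto simp: tree_labellings_def)
  have expand: "?s (?u t) = (\<Sum>t'\<in>?X T''. scale (coeff t' * form r (?u t) (?u t')) (?s (?u t')))"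
    if "t \<in> ?X T" "length L = length (leaf_labels T'')" for t T T''
    using arg_cong[OF tree_expansion[OF that(2) u[OF that(1)]], of ?s] unfolding strip_linear .
  let ?c = "\<lambda>t t'. coeff t * (coeff t' * form r (?u t) (?u t'))"
  have "(\<Sum>t\<in>?X T. scale (coeff t) (?s (?u t) \<boxtimes> ?s (?u t))) =
      (\<Sum>t\<in>?X T. scale (coeff t) (?s (?u t) \<boxtimes> (\<Sum>t'\<in>?X T'. scale (coeff t' * form r (?u t) (?u t')) (?s (?u t')))))"
    by (intro sum.cong refl) (simp only: expand[OF _ len(2), symmetric])
  also have "\<dots> = (\<Sum>t\<in>?X T. \<Sum>t'\<in>?X T'. scale (?c t t') (?s (?u t) \<boxtimes> ?s (?u t')))"
    by (simp add: boxtimes_linear lin.scale_sum_right)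
  also have "\<dots> = (\<Sum>t'\<in>?X T'. \<Sum>t\<in>?X T. scale (?c t' t) (?s (?u t) \<boxtimes> ?s (?u t')))"
  proof (subst sum.swap, intro sum.cong refl)
    fix t' t assume "t' \<in> ?X T'" "t \<in> ?X T"
    then have "form r (?u t) (?u t') = form r (?u t') (?u t)" using u form_sym by blast
    then show "scale (?c t t') (?s (?u t) \<boxtimes> ?s (?u t')) =
        scale (?c t' t) (?s (?u t) \<boxtimes> ?s (?u t'))"
      by (simp add: mult_ac)
  qed
  also have "\<dots> = (\<Sum>t'\<in>?X T'. scale (coeff t') ((\<Sum>t\<in>?X T. scale (coeff t * form r (?u t') (?u t)) (?s (?u t))) \<boxtimes> ?s (?u t')))"
    by (simp add: boxtimes_linear lin.scale_sum_right)
  also have "\<dots> = (\<Sum>t'\<in>?X T'. scale (coeff t') (?s (?u t') \<boxtimes> ?s (?u t')))"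
    by (intro sum.cong refl) (simp only: expand[OF _ len(1), symmetric])
  finally show ?thesis .
qed

text \<open>At the top the idempotents are supplied by the explicit factor \<open>jws A ys\<close>.
  At the bottom those of \<open>xs\<close> pass the caps and are absorbed by the bent tree, whose
  ends begin with \<open>xs\<close>.\<close>

lemma strip_kar_hom:
  assumes f: "f \<in> tree_space r L" and L: "L @ [r] = xs @ rev ys"
  shows "strip xs ys r f \<in> kar_hom A ys xs"
proof -
  let ?X = "sum_list xs" and ?Y = "sum_list ys"
  let ?g = "dg (dcup r) \<odot> (f \<otimes> wenzl r)" and ?c = "idt ?X \<otimes> dg (dcap ?Y)"
  have f': "f \<in> tl_hom r (sum_list L)" "f \<odot> jws A L = f" using f by (simp_all add: tree_space_def)
  have sum: "sum_list L + r = ?X + ?Y" using arg_cong[OF L, of sum_list] by simp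
  have fw: "f \<otimes> wenzl r \<in> tl_hom (2 * r) (?X + ?Y)" by (rule tl_hom_tensor[OF f'(1) wenzl_hom]) (simp_all add: sum)
  have g: "?g \<in> tl_hom 0 (?X + ?Y)" by (rule tl_hom_comp[OF tl_hom_dcup[OF refl] fw])
  have c: "?c \<in> tl_hom (?X + ?Y + ?Y) ?X" by (rule tl_hom_tensor[OF tl_hom_idt tl_hom_dcap[OF refl]]) simp_all
  have gy: "?g \<otimes> jws A ys \<in> tl_hom ?Y (?X + ?Y + ?Y)" by (rule tl_hom_tensor[OF g jws_hom]) simp_all
  have hom: "strip xs ys r f \<in> tl_hom ?Y ?X" unfolding strip_def by (rule tl_hom_comp[OF gy c])
  have fin: "fin f" "fin ?g" using f'(1) g by auto
  have "(f \<otimes> wenzl r) \<odot> (jws A L \<otimes> wenzl r) = f \<otimes> wenzl r"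
    using interchange[OF f'(1) jws_hom] f'(2) by (simp add: wenzl_idem)
  moreover have "jws A L \<otimes> wenzl r = jws A xs \<otimes> jws A (rev ys)"
    using arg_cong[OF L, of "jws A"] by (simp add: jws_append)
  ultimately have g_abs: "?g \<odot> (jws A xs \<otimes> jws A (rev ys)) = ?g"
    using fin by (simp add: comp_assoc)
  have rev: "jws A (rev ys) \<in> tl_hom ?Y ?Y" using jws_hom[of "rev ys"] by simp
  have xs1: "jws A xs \<otimes> idt ?Y \<in> tl_hom (?X + ?Y) (?X + ?Y)" by (rule tl_hom_tensor[OF jws_hom tl_hom_idt]) simp_all
  have "(jws A xs \<otimes> jws A (rev ys)) \<odot> (jws A xs \<otimes> idt ?Y) = jws A xs \<otimes> jws A (rev ys)"
    using interchange[OF jws_hom jws_hom] comp_idt_right[OF rev] by (simp add: jws_idem)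
  then have g_abs': "?g \<odot> (jws A xs \<otimes> idt ?Y) = ?g"
    using comp_reassoc[OF g_abs, of "jws A xs \<otimes> idt ?Y"] fin g_abs by simp
  have "?c \<odot> jws A xs = (jws A xs \<otimes> idt (2 * ?Y)) \<odot> ?c"
    using tensor_split[OF jws_hom[of xs] tl_hom_dcap[OF refl, of ?Y], of A] by simp
  moreover have "(?g \<otimes> jws A ys) \<odot> (jws A xs \<otimes> idt (2 * ?Y)) = ?g \<otimes> jws A ys"
  proof -
    have "jws A xs \<otimes> idt (2 * ?Y) = (jws A xs \<otimes> idt ?Y) \<otimes> idt ?Y" by (simp add: tensor_assoc mult_2)
    then show ?thesis
      using interchange[OF g xs1, of "jws A ys" "idt ?Y"] g_abs' comp_idt_right[OF jws_hom] by simp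
  qed
  ultimately have r: "strip xs ys r f \<odot> jws A xs = strip xs ys r f"
    unfolding strip_def using fin by (simp add: comp_assoc) (simp add: comp_assoc[symmetric])
  have "jws A ys \<odot> (?g \<otimes> jws A ys) = ?g \<otimes> jws A ys"
    using interchange[OF tl_hom_idt g, of "jws A ys" "jws A ys"] comp_idt_left[OF g] by (simp add: jws_idem)
  then have "jws A ys \<odot> strip xs ys r f = strip xs ys r f"
    unfolding strip_def using fin by (intro comp_reassoc) simp_all
  then show ?thesis unfolding kar_hom_def using hom r by simp
qed

end

section \<open>Membership in the balanced morphism space\<close>

lemma kar_hom_scale: "f \<in> kar_hom A ys xs \<Longrightarrow> scale c f \<in> kar_hom A ys xs"
  by (simp add: kar_hom_def tl_hom_scale comp_linear)

text \<open>Elements of \<open>bal_hom\<close> are sums over sets of pairs, so a summand that occurs already is merged with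
  its other occurrence into \<open>scale 2 f \<boxtimes> g\<close>, which may collide in turn.\<close>

lemma bal_hom_add_single:
  assumes "finite S" "S \<subseteq> kar_hom A (map fst ys) (map fst xs) \<times> kar_hom (inverse A) (map snd ys) (map snd xs)"
    and "f \<in> kar_hom A (map fst ys) (map fst xs)" "g \<in> kar_hom (inverse A) (map snd ys) (map snd xs)"
  shows "f \<boxtimes> g + (\<Sum>(f, g)\<in>S. f \<boxtimes> g) \<in> bal_hom A ys xs"
  using assms
proof (induction "card S" arbitrary: S f rule: less_induct)
  case less
  show ?case
  proof (cases "(f, g) \<in> S")
    case False
    have "f \<boxtimes> g + (\<Sum>(f, g)\<in>S. f \<boxtimes> g) = (\<Sum>(f, g)\<in>insert (f, g) S. f \<boxtimes> g)"
      using less.prems(1) False by simp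
    then show ?thesis unfolding bal_hom_def using less.prems by blast
  next
    case True
    let ?S = "S - {(f, g)}"
    have "(\<Sum>(f, g)\<in>S. f \<boxtimes> g) = f \<boxtimes> g + (\<Sum>(f, g)\<in>?S. f \<boxtimes> g)"
      using sum.remove[OF less.prems(1) True, of "\<lambda>(f, g). f \<boxtimes> g"] by simp
    moreover have "scale 2 f = f + f" using lin.scale_left_distrib[of 1 1 f] by simp
    ultimately have "f \<boxtimes> g + (\<Sum>(f, g)\<in>S. f \<boxtimes> g) = scale 2 f \<boxtimes> g + (\<Sum>(f, g)\<in>?S. f \<boxtimes> g)"
      by (simp add: boxtimes_linear add.assoc)
    moreover have "card ?S < card S" using True less.prems(1) by (metis card_Diff1_less)
    ultimately show ?thesis
      using less.hyps[of ?S "scale 2 f"] less.prems by (auto simp: kar_hom_scale)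
  qed
qed

lemma bal_hom_sum:
  assumes "finite X"
    and "\<And>t. t \<in> X \<Longrightarrow> F t \<in> kar_hom A (map fst ys) (map fst xs)"
    and "\<And>t. t \<in> X \<Longrightarrow> G t \<in> kar_hom (inverse A) (map snd ys) (map snd xs)"
  shows "(\<Sum>t\<in>X. scale (c t) (F t \<boxtimes> G t)) \<in> bal_hom A ys xs"
  using assms
proof (induction X rule: finite_induct)
  case empty
  have "(\<Sum>(f, g)\<in>({} :: (tl \<times> tl) set). f \<boxtimes> g) = 0" by simp
  then show ?case unfolding bal_hom_def by force
next
  case (insert t X)
  then have "(\<Sum>t\<in>X. scale (c t) (F t \<boxtimes> G t)) \<in> bal_hom A ys xs" by simp
  then obtain S where S: "finite S" "S \<subseteq> kar_hom A (map fst ys) (map fst xs) \<times> kar_hom (inverse A) (map snd ys) (map snd xs)"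
    "(\<Sum>t\<in>X. scale (c t) (F t \<boxtimes> G t)) = (\<Sum>(f, g)\<in>S. f \<boxtimes> g)"
    unfolding bal_hom_def by auto
  have "scale (c t) (F t) \<boxtimes> G t + (\<Sum>(f, g)\<in>S. f \<boxtimes> g) \<in> bal_hom A ys xs"
    by (rule bal_hom_add_single[OF S(1,2)]) (use insert.prems kar_hom_scale in auto)
  then show ?case using insert S(3) by (simp add: boxtimes_linear)
qed

context temperley_lieb
begin

lemma coeff_prod: "coeff t = prod_list (map \<Delta> (vertex_labels t)) / theta_product A t"
  by (induction t) (simp_all add: field_simps)

lemma labellings_eq:
  assumes "xs @ rev ys = L @ [r]"
  shows "labellings T xs ys = {t. t \<in> tree_labellings T L \<and> rootl t = r}"
  using assms by (auto simp: labellings_def tree_labellings_def external_labels_def)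

text \<open>The weight of an \<open>n\<close>-vertex runs over internal edges, whereas
  \<open>coeff\<close> counts the edges above all vertices. They differ by the root edge, whose
  label \<open>r\<close> is the same for all labellings; hence the common factor
  \<open>1 / \<Delta> r\<close>.\<close>

lemma nvertex_casimir:
  assumes E: "xs @ rev ys = L @ [r]" and L: "2 \<le> length L"
  shows "nvertex A xs ys T = scale (1 / \<Delta> r) (\<Sum>t | t \<in> tree_labellings T L \<and> rootl t = r.
    scale (coeff t) (strip xs ys r (tree_map A t) \<boxtimes> strip xs ys r (tree_map A t)))"
proof -
  have id: "map fst (map bal zs) = zs" "map snd (map bal zs) = zs"
    "map_ptree fst (map_ptree bal t) = t" "map_ptree snd (map_ptree bal t) = t" for zs t
    by (simp_all add: ptree.map_comp comp_def bal_def ptree.map_ident)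
  have coeff: "(\<Prod>j\<leftarrow>internal_labels t. \<Delta> j) * (1 / theta_product A t) = 1 / \<Delta> r * coeff t"
    if "t \<in> tree_labellings T L" "rootl t = r" for t
  proof (cases t)
    \<comment> \<open>Two or more leaves exclude a bare edge, so the list of vertex labels does
      start with the root label.\<close>
    case (Ext a)
    then show ?thesis using that L by (auto simp: tree_labellings_def)
  next
    case (Vtx a l r')
    then have "vertex_labels t = r # internal_labels t" using that by (simp add: internal_labels_def)
    then show ?thesis using Delta_nonzero[of r] by (simp add: coeff_prod)
  qed
  show ?thesis
    unfolding nvertex_def normalized_map_def pair_strip_map_def id labellings_eq[OF E] lin.scale_sum_right strip_map_inverse
    by (intro sum.cong refl) (simp add: coeff strip_map_strip del: times_divide_eq_right)
qed

end

theorem theorem3p3: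
  fixes A :: complex
    and n k :: nat
    and xs ys :: "nat list"
    and T T' :: "unit ptree"
  assumes "A \<noteq> 0"
    and "\<And>m. Delta A m \<noteq> 0"
    and "3 \<le> n" and "k \<le> n"
    and "length ys = k" and "length xs = n - k"
    and "T \<in> planar_trees n" and "T' \<in> planar_trees n"
  shows "nvertex A xs ys T \<in> bal_hom A (map bal ys) (map bal xs) \<and>
         nvertex A xs ys T = nvertex A xs ys T'"
proof -
  interpret temperley_lieb A using assms(1,2) by unfold_locales
  have len: "length (xs @ rev ys) = n" using assms by simp
  then have "xs @ rev ys \<noteq> []" using assms(3) by auto
  \<comment> \<open>The last external label is fixed by source and target, so both trees have the
    same root label and the same leaves, and are compared in one space.\<close>
  then obtain L r where E: "xs @ rev ys = L @ [r]" by (metis append_butlast_last_id)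
  have L: "Suc (length L) = n" using len unfolding E by simp
  then have L2: "2 \<le> length L" using assms(3) by simp
  have T: "length L = length (leaf_labels T)" "length L = length (leaf_labels T')"
    using assms(7,8) L by (auto simp: planar_trees_def external_labels_def)
  let ?X = "{t. t \<in> tree_labellings T L \<and> rootl t = r}"
  have X: "strip xs ys r (tree_map A t) \<in> kar_hom A ys xs" if "t \<in> ?X" for t
    using that by (intro strip_kar_hom[OF tree_map_space E[symmetric]]) (auto simp: tree_labellings_def)
  have id: "map fst (map bal zs) = zs" "map snd (map bal zs) = zs" for zs
    by (simp_all add: comp_def bal_def)
  have "(\<Sum>t\<in>?X. scale (1 / Delta A r * coeff t) (strip xs ys r (tree_map A t) \<boxtimes> strip xs ys r (tree_map A t)))
      \<in> bal_hom A (map bal ys) (map bal xs)"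
  proof (rule bal_hom_sum)
    show "finite ?X" using finite_tree_labellings by simp
  qed (simp_all only: id kar_hom_inverse X)
  then have "nvertex A xs ys T \<in> bal_hom A (map bal ys) (map bal xs)"
    unfolding nvertex_casimir[OF E L2] by (simp add: lin.scale_sum_right)
  moreover have "nvertex A xs ys T = nvertex A xs ys T'"
    unfolding nvertex_casimir[OF E L2] casimir[OF T] ..
  ultimately show ?thesis ..
qed

end
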